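(* Let $\boldsymbol{u}$ be a bounded smooth solution of the steady Navier-Stokes system $$-\Delta\boldsymbol{u}+(\boldsymbol{u}\cdot\nabla)\boldsymbol{u}+\nabla P=0,\qquad \nabla\cdot\boldsymbol{u}=0$$ in $\Omega=\mathbb{R}^2\times\mathbb{T}$. Then $\boldsymbol{u}$ must be a constant vector provided that one of the following conditions holds: (a) $u^\theta$ is axisymmetric, i.e. $u^\theta$ is independent of $\theta$; (b) $u^r$ is axisymmetric, i.e. $u^r$ is independent of $\theta$; (c) $ru^r$ converges to $0$ as $r\to+\infty$, uniformly in $(\theta,z)$, i.e. $\lim_{r\to+\infty}\sup_{\theta,z}|r\,u^r(r,\theta,z)|=0$; (d) $\|\boldsymbol{u}\|_{L^\infty(\Omega)}<2\pi$. Furthermore, in each of the cases (a), (b), and (c), the constant vector $\boldsymbol{u}$ must be of the form $(0,0,c)$ with $c\in\mathbb{R}$.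
   Context: $\boldsymbol{u}=(u^1,u^2,u^3)$ is a real vector field (velocity) and $P$ is a scalar function (pressure). A smooth solution in $\mathbb{R}^2\times\mathbb{T}$ means a smooth vector field $\boldsymbol{u}$ on $\mathbb{R}^3$ that is periodic in $x_3$ with period $1$ and for which there is a smooth scalar $P$ on $\mathbb{R}^3$ such that the system holds on $\mathbb{R}^3$ (periodicity of $P$ is not assumed). Cylindrical coordinates $(r,\theta,z)$ are $x_1=r\cos\theta$, $x_2=r\sin\theta$, $x_3=z$, and $\boldsymbol{u}=u^r\boldsymbol{e}_r+u^\theta\boldsymbol{e}_\theta+u^z\boldsymbol{e}_z$ with $\boldsymbol{e}_r=(\cos\theta,\sin\theta,0)$, $\boldsymbol{e}_\theta=(-\sin\theta,\cos\theta,0)$, $\boldsymbol{e}_z=(0,0,1)$. $\|\boldsymbol{u}\|_{L^\infty(\Omega)}$ is the supremum of the Euclidean length $|\boldsymbol{u}|$. *)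

theory Defs
  imports "HOL-Analysis.Analysis"
begin

primrec continuously_differentiable ::
    "nat \<Rightarrow> ('a::real_normed_vector \<Rightarrow> 'b::real_normed_vector) \<Rightarrow> bool" where
  "continuously_differentiable 0 f \<longleftrightarrow> continuous_on UNIV f"
| "continuously_differentiable (Suc n) f \<longleftrightarrow>
     (\<forall>x. f differentiable (at x)) \<and>
     (\<forall>v. continuously_differentiable n (\<lambda>x. frechet_derivative f (at x) v))"

definition smooth :: "('a::real_normed_vector \<Rightarrow> 'b::real_normed_vector) \<Rightarrow> bool" where
  "smooth f \<longleftrightarrow> (\<forall>n. continuously_differentiable n f)"

definition partial_deriv :: "'n::finite \<Rightarrow> (real^'n \<Rightarrow> 'b::real_normed_vector) \<Rightarrow> real^'n \<Rightarrow> 'b" where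
  "partial_deriv i f x = frechet_derivative f (at x) (axis i 1)"

definition laplacian :: "(real^'n \<Rightarrow> 'b::real_normed_vector) \<Rightarrow> real^'n \<Rightarrow> 'b" where
  "laplacian f x = (\<Sum>i\<in>UNIV. partial_deriv i (partial_deriv i f) x)"

definition gradient :: "(real^'n \<Rightarrow> real) \<Rightarrow> real^'n \<Rightarrow> real^'n" where
  "gradient P x = (\<chi> i. partial_deriv i P x)"

definition divergence :: "(real^'n \<Rightarrow> real^'n) \<Rightarrow> real^'n \<Rightarrow> real" where
  "divergence u x = (\<Sum>i\<in>UNIV. partial_deriv i (\<lambda>y. u y $ i) x)"

definition advection :: "(real^'n \<Rightarrow> real^'n) \<Rightarrow> (real^'n \<Rightarrow> 'b::real_normed_vector) \<Rightarrow> real^'n \<Rightarrow> 'b" where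
  "advection u f x = (\<Sum>i\<in>UNIV. (u x $ i) *\<^sub>R partial_deriv i f x)"

text \<open>Fields on \<open>\<real>\<^sup>2 \<times> \<T>\<close> are fields on \<open>\<real>\<^sup>3\<close> with period 1 in the third variable;
  the pressure need not be periodic.\<close>

definition smooth_steady_NS_solution :: "(real^3 \<Rightarrow> real^3) \<Rightarrow> bool" where
  "smooth_steady_NS_solution u \<longleftrightarrow>
     smooth u \<and> (\<forall>x. u (x + axis 3 1) = u x) \<and>
     (\<exists>P :: real^3 \<Rightarrow> real. smooth P \<and>
        (\<forall>x. - laplacian u x + advection u u x + gradient P x = 0 \<and> divergence u x = 0))"

definition cyl_point :: "real \<Rightarrow> real \<Rightarrow> real \<Rightarrow> real^3" where
  "cyl_point r \<theta> z = vector [r * cos \<theta>, r * sin \<theta>, z]"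

definition e_r :: "real \<Rightarrow> real^3" where
  "e_r \<theta> = vector [cos \<theta>, sin \<theta>, 0]"

definition e_theta :: "real \<Rightarrow> real^3" where
  "e_theta \<theta> = vector [- sin \<theta>, cos \<theta>, 0]"

definition radial_comp :: "(real^3 \<Rightarrow> real^3) \<Rightarrow> real \<Rightarrow> real \<Rightarrow> real \<Rightarrow> real" where
  "radial_comp u r \<theta> z = u (cyl_point r \<theta> z) \<bullet> e_r \<theta>"

definition swirl_comp :: "(real^3 \<Rightarrow> real^3) \<Rightarrow> real \<Rightarrow> real \<Rightarrow> real \<Rightarrow> real" where
  "swirl_comp u r \<theta> z = u (cyl_point r \<theta> z) \<bullet> e_theta \<theta>"

text \<open>Only \<open>r > 0\<close> is constrained: the frame \<open>e_r\<close>, \<open>e_theta\<close> is not defined on the axis.\<close>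

definition axisymmetric :: "(real \<Rightarrow> real \<Rightarrow> real \<Rightarrow> real) \<Rightarrow> bool" where
  "axisymmetric f \<longleftrightarrow> (\<forall>r>0. \<forall>\<theta> \<theta>' z. f r \<theta> z = f r \<theta>' z)"

end

theory Submission imports Defs begin

text \<open>
  The proof rests on the fact that the domain \<open>\<real>\<^sup>2 \<times> \<T>\<close> is only two-dimensional at infinity:
  a cylinder of radius \<open>R\<close> has volume \<open>R\<^sup>2\<close>. Let \<open>E(R)\<close> be the integral of \<open>|\<nabla>u|\<^sup>2\<close> over one
  period, against a power of a cutoff of radius \<open>R\<close>. Testing the equation with \<open>u\<close> gives (\<open>J_energy\<close>)
  \<open>E(R) \<le> C/R \<integral> |\<nabla>u| |u| + C/R\<^sup>2 |\<integral> Q r u\<^sup>r|\<close>, where \<open>Q = P + |u|\<^sup>2/2\<close> is the Bernoulli function. By the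
  Cauchy-Schwarz inequality the first term is at most a constant times \<open>E(2R)\<^sup>1\<^sup>/\<^sup>2\<close>. If the second
  term is negligible, then \<open>E\<close> is bounded; the integrand of the first term then lives in the tail of a convergent
  integral, so the term tends to zero, and \<open>E = 0\<close>. This is \<open>liouville_scheme\<close>, the common end of all
  cases. It needs \<open>E\<close> to be of order \<open>R\<^sup>2\<close> to begin with.

  That growth, and control of \<open>Q\<close>, come without estimates for the pressure. The vorticity equation
  bounds \<open>\<nabla>\<omega>\<close> by \<open>\<omega>\<close> (\<open>J_grad_vort_le\<close>), integration by parts bounds \<open>\<omega>\<close> by a little of \<open>\<nabla>\<omega>\<close> and the
  bounded \<open>u\<close> (\<open>J_vort_growth\<close>), and a divergence-free field is controlled by its curl (\<open>J_div_curl\<close>).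
  Since \<open>\<nabla>Q\<close> is expressed by \<open>\<nabla>\<omega>\<close> and \<open>u \<times> \<omega>\<close>, its square integral is at most a constant times
  \<open>E(2R)\<close> (\<open>J_grad_Q_growth\<close>), and \<open>Q\<close> turns out to be periodic (\<open>per_smooth_Q\<close>).

  It remains to show that the work \<open>R\<^sup>-\<^sup>2 \<integral> Q r u\<^sup>r\<close> is at most a small multiple of \<open>E(2R) + 1\<close>.

  If \<open>u\<^sup>\<theta>\<close> or \<open>u\<^sup>r\<close> is axisymmetric, then incompressibility forces the mean of \<open>r u\<^sup>r\<close> over every vertical
  fibre to vanish (\<open>fibre_mean_radial_flux_zero_of_swirl\<close>, \<open>fibre_mean_radial_flux_zero_of_radial\<close>), and
  Wirtinger's inequality on the fibres bounds the work by vertical derivatives of \<open>Q\<close> and \<open>r u\<^sup>r\<close>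
  (\<open>liouville_fibre_flux\<close>).

  If \<open>r u\<^sup>r\<close> tends to zero, one uses that the flux through every cylinder vanishes, so that a radial
  function may be subtracted from \<open>Q\<close>; the difference is an integral of \<open>\<nabla>Q\<close> along fibres and
  circles, and the length of the circles is compensated by the decay (\<open>liouville_decay\<close>).

  If \<open>|u| < 2\<pi>\<close>, then \<open>w = \<partial>\<^sub>3 u\<close> solves the linearised equation, and its energy identity has one
  interior term, which the Wirtinger inequality with its sharp constant \<open>2\<pi>\<close> absorbs; so \<open>w = 0\<close>
  (\<open>vertical_derivative_zero\<close>). For a flow that does not depend on the height, the vertical vorticity is
  transported by the flow, hence zero, so the horizontal velocity is harmonic and therefore constant;
  then the derivatives of the vertical velocity are transported as well (\<open>liouville_planar\<close>).

  A constant vector with a horizontal part violates each of the first three conditions: its swirl and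
  radial components vary with the angle, and \<open>r u\<^sup>r\<close> is unbounded.\<close>

section \<open>Calculus of smooth scalar fields\<close>

lemma partial_deriv_eqI:
  assumes "(f has_derivative D) (at x)"
  shows "partial_deriv i f x = D (axis i 1)"
  unfolding partial_deriv_def using frechet_derivative_at[OF assms] by simp

lemma continuously_differentiable_SucD:
  "continuously_differentiable (Suc n) f \<Longrightarrow> continuously_differentiable n f"
proof (induction n arbitrary: f)
  case 0
  then show ?case
    by (auto intro!: continuous_at_imp_continuous_on differentiable_imp_continuous_within)
next
  case (Suc n)
  have "\<forall>v. continuously_differentiable (Suc n) (\<lambda>x. frechet_derivative f (at x) v)"
    using Suc.prems by (subst (asm) continuously_differentiable.simps) blast
  with Suc.IH have "\<forall>v. continuously_differentiable n (\<lambda>x. frechet_derivative f (at x) v)"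
    by blast
  moreover have "\<forall>x. f differentiable (at x)"
    using Suc.prems by (subst (asm) continuously_differentiable.simps) blast
  ultimately show ?case by simp
qed

lemma smooth_differentiable: "smooth f \<Longrightarrow> f differentiable (at x)"
  unfolding smooth_def by (metis continuously_differentiable.simps(2))

lemma smooth_continuous_on: "smooth f \<Longrightarrow> continuous_on S f"
  unfolding smooth_def
  by (metis continuously_differentiable.simps(1) continuous_on_subset subset_UNIV)

lemma smooth_has_derivative: "smooth f \<Longrightarrow> (f has_derivative frechet_derivative f (at x)) (at x)"
  using smooth_differentiable frechet_derivative_works by blast

lemma smooth_partial_deriv [intro!]: "smooth f \<Longrightarrow> smooth (partial_deriv i f)"
  unfolding smooth_def partial_deriv_def[abs_def]
  by (metis continuously_differentiable.simps(2))

lemma continuously_differentiable_const: "continuously_differentiable n (\<lambda>x. c)"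
  by (induction n arbitrary: c) auto

lemma continuously_differentiable_bounded_linear_comp:
  assumes "bounded_linear h" "continuously_differentiable n f"
  shows "continuously_differentiable n (\<lambda>x. h (f x))"
  using assms(2)
proof (induction n arbitrary: f)
  case 0
  then show ?case
    by (simp add: bounded_linear.continuous_on[OF assms(1)])
next
  case (Suc n)
  have d: "(f has_derivative frechet_derivative f (at x)) (at x)" for x
    using Suc.prems by (auto simp: frechet_derivative_works[symmetric])
  have e: "((\<lambda>x. h (f x)) has_derivative (\<lambda>v. h (frechet_derivative f (at x) v))) (at x)" for x
    by (rule bounded_linear.has_derivative[OF assms(1) d])
  have "frechet_derivative (\<lambda>x. h (f x)) (at x) = (\<lambda>v. h (frechet_derivative f (at x) v))" for x
    using frechet_derivative_at[OF e] by simp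
  moreover have "(\<lambda>x. h (f x)) differentiable at x" for x
    using e by (auto simp: differentiable_def)
  ultimately show ?case using Suc by simp
qed

lemma continuously_differentiable_add:
  "continuously_differentiable n f \<Longrightarrow> continuously_differentiable n g \<Longrightarrow>
   continuously_differentiable n (\<lambda>x. f x + g x)"
proof (induction n arbitrary: f g)
  case 0
  then show ?case by (auto intro: continuous_intros)
next
  case (Suc n)
  have f: "(f has_derivative frechet_derivative f (at x)) (at x)"
    and g: "(g has_derivative frechet_derivative g (at x)) (at x)" for x
    using Suc.prems by (auto simp: frechet_derivative_works[symmetric])
  note e = has_derivative_add[OF f g]
  have "frechet_derivative (\<lambda>x. f x + g x) (at x) =
     (\<lambda>v. frechet_derivative f (at x) v + frechet_derivative g (at x) v)" for x
    using frechet_derivative_at[OF e] by simp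
  moreover have "(\<lambda>x. f x + g x) differentiable at x" for x
    using e by (auto simp: differentiable_def)
  ultimately show ?case using Suc by simp
qed

lemma continuously_differentiable_mult:
  fixes f g :: "'a::real_normed_vector \<Rightarrow> real"
  shows "continuously_differentiable n f \<Longrightarrow> continuously_differentiable n g \<Longrightarrow>
   continuously_differentiable n (\<lambda>x. f x * g x)"
proof (induction n arbitrary: f g)
  case 0
  then show ?case by (auto intro: continuous_intros)
next
  case (Suc n)
  have f: "(f has_derivative frechet_derivative f (at x)) (at x)"
    and g: "(g has_derivative frechet_derivative g (at x)) (at x)" for x
    using Suc.prems by (auto simp: frechet_derivative_works[symmetric])
  note e = has_derivative_mult[OF f g]
  have eq: "frechet_derivative (\<lambda>x. f x * g x) (at x) =
     (\<lambda>v. f x * frechet_derivative g (at x) v + frechet_derivative f (at x) v * g x)" for x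
    using frechet_derivative_at[OF e] by simp
  have f': "continuously_differentiable n f" and g': "continuously_differentiable n g"
    using Suc.prems continuously_differentiable_SucD by blast+
  have "continuously_differentiable n
     (\<lambda>x. f x * frechet_derivative g (at x) v + frechet_derivative f (at x) v * g x)" for v
    using Suc.prems f' g' by (intro continuously_differentiable_add Suc.IH) auto
  moreover have "(\<lambda>x. f x * g x) differentiable at x" for x
    using e by (auto simp: differentiable_def)
  ultimately show ?case by (simp add: eq)
qed

lemma smooth_const [intro!]: "smooth (\<lambda>x. c)"
  by (simp add: smooth_def continuously_differentiable_const)

lemma smooth_bounded_linear: "bounded_linear h \<Longrightarrow> smooth h"
  unfolding smooth_def
proof
  fix n assume h: "bounded_linear h"
  have "frechet_derivative h (at x) = h" for x
    using frechet_derivative_at[OF bounded_linear_imp_has_derivative[OF h, of "at x"]] by simp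
  moreover have "h differentiable at x" for x
    using bounded_linear_imp_has_derivative[OF h, of "at x"] by (auto simp: differentiable_def)
  ultimately show "continuously_differentiable n h"
    by (cases n) (auto simp: continuously_differentiable_const linear_continuous_on[OF h])
qed

lemma smooth_nth [intro!]: "smooth (\<lambda>x::real^'n. x $ i)"
  by (rule smooth_bounded_linear[OF bounded_linear_vec_nth])

lemma smooth_component: "smooth f \<Longrightarrow> smooth (\<lambda>x. f x $ i)"
  unfolding smooth_def
  using continuously_differentiable_bounded_linear_comp[OF bounded_linear_vec_nth] by blast

lemma smooth_add [intro!]: "smooth f \<Longrightarrow> smooth g \<Longrightarrow> smooth (\<lambda>x. f x + g x)"
  by (simp add: smooth_def continuously_differentiable_add)

lemma smooth_mult [intro!]:
  fixes f g :: "'a::real_normed_vector \<Rightarrow> real"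
  shows "smooth f \<Longrightarrow> smooth g \<Longrightarrow> smooth (\<lambda>x. f x * g x)"
  by (simp add: smooth_def continuously_differentiable_mult)

lemma smooth_minus [intro!]:
  fixes f :: "'a::real_normed_vector \<Rightarrow> real"
  shows "smooth f \<Longrightarrow> smooth (\<lambda>x. - f x)"
  using smooth_mult[of "\<lambda>x. -1" f] by auto

lemma smooth_diff [intro!]:
  fixes f g :: "'a::real_normed_vector \<Rightarrow> real"
  shows "smooth f \<Longrightarrow> smooth g \<Longrightarrow> smooth (\<lambda>x. f x - g x)"
  using smooth_add[OF _ smooth_minus, of f g] by simp

lemma smooth_power [intro!]:
  fixes f :: "'a::real_normed_vector \<Rightarrow> real"
  shows "smooth f \<Longrightarrow> smooth (\<lambda>x. f x ^ n)"
  by (induction n) auto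

lemma smooth_sum [intro!]:
  fixes f :: "'i \<Rightarrow> 'a::real_normed_vector \<Rightarrow> real"
  shows "(\<And>i. i \<in> A \<Longrightarrow> smooth (f i)) \<Longrightarrow> smooth (\<lambda>x. \<Sum>i\<in>A. f i x)"
  by (induction A rule: infinite_finite_induct) auto

lemma partial_deriv_const [simp]: "partial_deriv i (\<lambda>x. c) = (\<lambda>x. 0)"
  by (rule ext) (simp add: partial_deriv_eqI[OF has_derivative_const])

lemma partial_deriv_nth: "partial_deriv i (\<lambda>x. x $ j) = (\<lambda>x. if i = j then 1 else 0)"
  by (rule ext, subst partial_deriv_eqI[OF bounded_linear_imp_has_derivative[OF bounded_linear_vec_nth]])
     (simp add: axis_def)

lemma partial_deriv_add [simp]:
  assumes "smooth f" "smooth g"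
  shows "partial_deriv i (\<lambda>x. f x + g x) = (\<lambda>x. partial_deriv i f x + partial_deriv i g x)"
  by (rule ext, subst partial_deriv_eqI[OF has_derivative_add[OF smooth_has_derivative smooth_has_derivative]])
     (simp_all add: assms partial_deriv_def)

lemma partial_deriv_mult [simp]:
  fixes f g :: "real^'n \<Rightarrow> real"
  assumes "smooth f" "smooth g"
  shows "partial_deriv i (\<lambda>x. f x * g x) = (\<lambda>x. f x * partial_deriv i g x + partial_deriv i f x * g x)"
  by (rule ext, subst partial_deriv_eqI[OF has_derivative_mult[OF smooth_has_derivative smooth_has_derivative]])
     (simp_all add: assms partial_deriv_def)

lemma partial_deriv_minus [simp]:
  fixes f :: "real^'n \<Rightarrow> real"
  assumes "smooth f"
  shows "partial_deriv i (\<lambda>x. - f x) = (\<lambda>x. - partial_deriv i f x)"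
  using partial_deriv_mult[of "\<lambda>x. -1" f i] assms by (simp add: smooth_const)

lemma partial_deriv_diff [simp]:
  fixes f g :: "real^'n \<Rightarrow> real"
  assumes "smooth f" "smooth g"
  shows "partial_deriv i (\<lambda>x. f x - g x) = (\<lambda>x. partial_deriv i f x - partial_deriv i g x)"
  using partial_deriv_add[of f "\<lambda>x. - g x" i] assms by (simp add: smooth_minus)

lemma partial_deriv_sum [simp]:
  fixes f :: "'i \<Rightarrow> real^'n \<Rightarrow> real"
  assumes "\<And>j. j \<in> A \<Longrightarrow> smooth (f j)"
  shows "partial_deriv i (\<lambda>x. \<Sum>j\<in>A. f j x) = (\<lambda>x. \<Sum>j\<in>A. partial_deriv i (f j) x)"
  using assms
proof (induction A rule: infinite_finite_induct)
  case (insert a A)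
  then have "partial_deriv i (\<lambda>x. f a x + (\<Sum>j\<in>A. f j x)) = (\<lambda>x. partial_deriv i (f a) x + (\<Sum>j\<in>A. partial_deriv i (f j) x))"
    by (subst partial_deriv_add) auto
  with insert show ?case by simp
qed auto

lemma partial_deriv_component:
  assumes "smooth f"
  shows "partial_deriv i (\<lambda>x. f x $ j) = (\<lambda>x. partial_deriv i f x $ j)"
  by (rule ext, subst partial_deriv_eqI[OF bounded_linear.has_derivative[OF bounded_linear_vec_nth smooth_has_derivative[OF assms]]])
     (simp add: partial_deriv_def)

lemma has_derivative_along_line:
  assumes "f differentiable (at (x + t *\<^sub>R axis i 1))"
  shows "((\<lambda>t. f (x + t *\<^sub>R axis i 1)) has_vector_derivative partial_deriv i f (x + t *\<^sub>R axis i 1)) (at t within S)"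
proof -
  let ?x = "x + t *\<^sub>R axis i 1"
  have f: "(f has_derivative frechet_derivative f (at ?x)) (at ?x)"
    using assms frechet_derivative_works by blast
  have g: "((\<lambda>t. x + t *\<^sub>R axis i 1) has_derivative (\<lambda>h. h *\<^sub>R axis i 1)) (at t within S)"
    by (auto intro!: derivative_eq_intros)
  have "linear (frechet_derivative f (at ?x))"
    using f has_derivative_linear by blast
  then show ?thesis
    unfolding has_vector_derivative_def partial_deriv_def
    using has_derivative_compose[OF g f] by (simp add: linear_cmul)
qed

lemma smooth_along_line:
  "smooth f \<Longrightarrow> ((\<lambda>t. f (x + t *\<^sub>R axis i 1)) has_vector_derivative
      partial_deriv i f (x + t *\<^sub>R axis i 1)) (at t within S)"
  by (rule has_derivative_along_line[OF smooth_differentiable])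

text \<open>Differentiating \<open>f (x + t e\<^sub>j) - f x = \<integral>\<^sub>0\<^sup>t \<partial>\<^sub>j f (x + s e\<^sub>j) ds\<close> first in the direction \<open>e\<^sub>i\<close>
  under the integral sign and then in \<open>t\<close> shows that mixed derivatives commute.\<close>

lemma partial_deriv_commute:
  fixes f :: "real^'n \<Rightarrow> real"
  assumes f: "smooth f"
  shows "partial_deriv i (partial_deriv j f) = partial_deriv j (partial_deriv i f)"
proof
  fix x :: "real^'n"
  let ?ei = "axis i (1::real) :: real^'n" and ?ej = "axis j (1::real) :: real^'n"
  have ftc: "f (x + h *\<^sub>R ?ei + t *\<^sub>R ?ej) - f (x + h *\<^sub>R ?ei) =
      integral {0..t} (\<lambda>s. partial_deriv j f (x + h *\<^sub>R ?ei + s *\<^sub>R ?ej))" if "t \<ge> 0" for h t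
    using fundamental_theorem_of_calculus[OF that smooth_along_line[OF f, of "x + h *\<^sub>R ?ei" j]]
    by (simp add: integral_unique)
  have [continuous_intros]: "continuous_on S g \<Longrightarrow> continuous_on S (\<lambda>s. partial_deriv j f (g s))"
    for S :: "'c::topological_space set" and g
    by (rule continuous_on_compose2[OF smooth_continuous_on[of _ UNIV]]) (use f in auto)
  have [continuous_intros]: "continuous_on S g \<Longrightarrow> continuous_on S (\<lambda>s. partial_deriv i (partial_deriv j f) (g s))"
    for S :: "'c::topological_space set" and g
    by (rule continuous_on_compose2[OF smooth_continuous_on[of _ UNIV]]) (use f in auto)
  have key: "partial_deriv i f (x + t *\<^sub>R ?ej) - partial_deriv i f x =
      integral {0..t} (\<lambda>s. partial_deriv i (partial_deriv j f) (x + s *\<^sub>R ?ej))" if t: "t \<ge> 0" for t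
  proof -
    have 1: "((\<lambda>h. f (x + t *\<^sub>R ?ej + h *\<^sub>R ?ei) - f (x + h *\<^sub>R ?ei)) has_field_derivative
        partial_deriv i f (x + t *\<^sub>R ?ej + 0 *\<^sub>R ?ei) - partial_deriv i f (x + 0 *\<^sub>R ?ei)) (at 0 within UNIV)"
      using smooth_along_line[OF f]
      by (intro DERIV_diff) (simp_all only: has_real_derivative_iff_has_vector_derivative)
    have 2: "((\<lambda>h. integral (cbox 0 t) (\<lambda>s. partial_deriv j f (x + s *\<^sub>R ?ej + h *\<^sub>R ?ei))) has_field_derivative
        integral (cbox 0 t) (\<lambda>s. partial_deriv i (partial_deriv j f) (x + s *\<^sub>R ?ej + 0 *\<^sub>R ?ei))) (at 0 within UNIV)"
    proof (rule leibniz_rule_field_derivative)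
      show "((\<lambda>h. partial_deriv j f (x + s *\<^sub>R ?ej + h *\<^sub>R ?ei)) has_field_derivative
          partial_deriv i (partial_deriv j f) (x + s *\<^sub>R ?ej + h *\<^sub>R ?ei)) (at h within UNIV)" for h s
        using smooth_along_line[of "partial_deriv j f"] f
        unfolding has_real_derivative_iff_has_vector_derivative by blast
      show "(\<lambda>s. partial_deriv j f (x + s *\<^sub>R ?ej + h *\<^sub>R ?ei)) integrable_on cbox 0 t" for h
        by (intro integrable_continuous continuous_intros)
      show "continuous_on (UNIV \<times> cbox 0 t)
         (\<lambda>(h, s). partial_deriv i (partial_deriv j f) (x + s *\<^sub>R ?ej + h *\<^sub>R ?ei))"
        unfolding split_beta
        by (intro continuous_intros)
    qed auto
    have "(\<lambda>h. integral (cbox 0 t) (\<lambda>s. partial_deriv j f (x + s *\<^sub>R ?ej + h *\<^sub>R ?ei))) =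
        (\<lambda>h. f (x + t *\<^sub>R ?ej + h *\<^sub>R ?ei) - f (x + h *\<^sub>R ?ei))"
      using ftc[OF t] by (simp add: algebra_simps)
    with 2 have 2: "((\<lambda>h. f (x + t *\<^sub>R ?ej + h *\<^sub>R ?ei) - f (x + h *\<^sub>R ?ei)) has_field_derivative
        integral (cbox 0 t) (\<lambda>s. partial_deriv i (partial_deriv j f) (x + s *\<^sub>R ?ej + 0 *\<^sub>R ?ei))) (at 0 within UNIV)"
      by simp
    show ?thesis using DERIV_unique[OF 1 2] by simp
  qed
  have 1: "((\<lambda>t. integral {0..t} (\<lambda>s. partial_deriv i (partial_deriv j f) (x + s *\<^sub>R ?ej))) has_vector_derivative
      partial_deriv i (partial_deriv j f) (x + 0 *\<^sub>R ?ej)) (at 0 within {0..1})"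
    by (rule integral_has_vector_derivative) (auto intro!: continuous_intros)
  have 2: "((\<lambda>t. partial_deriv i f (x + t *\<^sub>R ?ej) - partial_deriv i f x) has_vector_derivative
      partial_deriv j (partial_deriv i f) (x + 0 *\<^sub>R ?ej) - 0) (at 0 within {0..1})"
    using f by (intro has_vector_derivative_diff smooth_along_line) auto
  have 3: "((\<lambda>t. integral {0..t} (\<lambda>s. partial_deriv i (partial_deriv j f) (x + s *\<^sub>R ?ej))) has_vector_derivative
      partial_deriv j (partial_deriv i f) (x + 0 *\<^sub>R ?ej) - 0) (at 0 within {0..1})"
    by (rule has_vector_derivative_transform[OF _ _ 2]) (auto simp: key)
  show "partial_deriv i (partial_deriv j f) x = partial_deriv j (partial_deriv i f) x"
    using vector_derivative_unique_within[OF _ 1 3] by (simp add: trivial_limit_within islimpt_Icc)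
qed

section \<open>Integration over the periodic slab\<close>

definition slab :: "real \<Rightarrow> real \<Rightarrow> (real^3) set" where
  "slab a b = {x. a \<le> x $ 3 \<and> x $ 3 \<le> b}"

text \<open>The integral over \<open>\<real>\<^sup>2 \<times> \<T>\<close>, taken over one period of \<open>x\<^sub>3\<close>.\<close>

definition slab_integral :: "(real^3 \<Rightarrow> real) \<Rightarrow> real" where
  "slab_integral F = integral (slab 0 1) F"

text \<open>Horizontally compact support, measured by squares so that integrals over the slab become
  integrals over boxes.\<close>

definition vanishes_beyond :: "real \<Rightarrow> (real^3 \<Rightarrow> real) \<Rightarrow> bool" where
  "vanishes_beyond L F \<longleftrightarrow> (\<forall>x. L \<le> \<bar>x $ 1\<bar> \<or> L \<le> \<bar>x $ 2\<bar> \<longrightarrow> F x = 0)"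

abbreviation z_shift :: "real \<Rightarrow> real^3" where
  "z_shift t \<equiv> t *\<^sub>R axis 3 1"

definition z_periodic :: "(real^3 \<Rightarrow> 'a) \<Rightarrow> bool" where
  "z_periodic F \<longleftrightarrow> (\<forall>x. F (x + z_shift 1) = F x)"

lemma vanishes_beyondD: "vanishes_beyond L F \<Longrightarrow> L \<le> \<bar>x $ 1\<bar> \<or> L \<le> \<bar>x $ 2\<bar> \<Longrightarrow> F x = 0"
  by (auto simp: vanishes_beyond_def)

lemma vanishes_beyond_mono: "vanishes_beyond L F \<Longrightarrow> L \<le> L' \<Longrightarrow> vanishes_beyond L' F"
  unfolding vanishes_beyond_def by (meson order_trans)

lemma mem_slab_box:
  "x \<in> cbox (vector [-L, -L, a] :: real^3) (vector [L, L, b]) \<longleftrightarrow>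
    \<bar>x $ 1\<bar> \<le> L \<and> \<bar>x $ 2\<bar> \<le> L \<and> a \<le> x $ 3 \<and> x $ 3 \<le> b"
  by (auto simp: mem_box_cart forall_3)

lemma slab_box_has_integral_iff:
  assumes "vanishes_beyond L F"
  shows "(F has_integral y) (slab a b) \<longleftrightarrow>
    (F has_integral y) (cbox (vector [-L, -L, a]) (vector [L, L, b]))"
proof (rule has_integral_spike_set_eq)
  have "{x \<in> slab a b - cbox (vector [-L, -L, a]) (vector [L, L, b]). F x \<noteq> 0} = {}"
    using assms by (auto simp: slab_def mem_slab_box vanishes_beyond_def not_le dest!: less_imp_le)
  then show "negligible {x \<in> slab a b - cbox (vector [-L, -L, a]) (vector [L, L, b]). F x \<noteq> 0}"
    by (metis negligible_empty)
  have "{x \<in> cbox (vector [-L, -L, a]) (vector [L, L, b]) - slab a b. F x \<noteq> 0} = {}"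
    by (auto simp: slab_def mem_slab_box)
  then show "negligible {x \<in> cbox (vector [-L, -L, a]) (vector [L, L, b]) - slab a b. F x \<noteq> 0}"
    by (metis negligible_empty)
qed

lemma slab_integral_eq_box:
  assumes "vanishes_beyond L F"
  shows "integral (slab a b) F = integral (cbox (vector [-L, -L, a]) (vector [L, L, b])) F"
  using slab_box_has_integral_iff[OF assms]
  by (metis eq_integralD integral_unique)

lemma slab_integrable:
  assumes "vanishes_beyond L F" "continuous_on UNIV F"
  shows "F integrable_on slab a b"
  using slab_box_has_integral_iff[OF assms(1)] integrable_continuous[OF continuous_on_subset[OF assms(2)]]
  unfolding integrable_on_def by blast

lemma slab_integral_swap:
  fixes f :: "real \<Rightarrow> real^3 \<Rightarrow> real"
  assumes cont: "continuous_on UNIV (\<lambda>(t, x). f t x)"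
    and supp: "\<And>t. a \<le> t \<Longrightarrow> t \<le> b \<Longrightarrow> vanishes_beyond L (f t)"
  shows "integral {a..b} (\<lambda>t. slab_integral (f t)) = slab_integral (\<lambda>x. integral {a..b} (\<lambda>t. f t x))"
proof -
  let ?B = "cbox (vector [-L, -L, 0]) (vector [L, L, 1]) :: (real^3) set"
  have "vanishes_beyond L (\<lambda>x. integral {a..b} (\<lambda>t. f t x))"
    unfolding vanishes_beyond_def
  proof (intro allI impI)
    fix x :: "real^3" assume "L \<le> \<bar>x $ 1\<bar> \<or> L \<le> \<bar>x $ 2\<bar>"
    then have "integral {a..b} (\<lambda>t. f t x) = integral {a..b} (\<lambda>t. 0)"
      using supp by (intro integral_cong) (auto intro: vanishes_beyondD)
    then show "integral {a..b} (\<lambda>t. f t x) = 0" by simp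
  qed
  then have "slab_integral (\<lambda>x. integral {a..b} (\<lambda>t. f t x)) = integral ?B (\<lambda>x. integral (cbox a b) (\<lambda>t. f t x))"
    unfolding slab_integral_def by (simp add: slab_integral_eq_box)
  also have "\<dots> = integral (cbox a b) (\<lambda>t. integral ?B (f t))"
    by (rule integral_swap_continuous[symmetric, OF continuous_on_subset[OF cont]]) auto
  also have "\<dots> = integral (cbox a b) (\<lambda>t. slab_integral (f t))"
    unfolding slab_integral_def
    by (rule integral_cong) (simp add: slab_integral_eq_box[OF supp])
  finally show ?thesis by simp
qed

lemma slab_integral_shift:
  assumes F: "vanishes_beyond L F"
  shows "integral (slab a b) (\<lambda>x. F (x + v)) = integral (slab (a + v $ 3) (b + v $ 3)) F"
proof -
  define L' where "L' = L + norm v"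
  have v: "\<bar>v $ i\<bar> \<le> norm v" for i by (rule component_le_norm_cart)
  have 1: "vanishes_beyond L' (\<lambda>x. F (x + v))"
    unfolding vanishes_beyond_def L'_def
  proof (intro allI impI)
    fix x :: "real^3" assume "L + norm v \<le> \<bar>x $ 1\<bar> \<or> L + norm v \<le> \<bar>x $ 2\<bar>"
    then have "L \<le> \<bar>(x + v) $ 1\<bar> \<or> L \<le> \<bar>(x + v) $ 2\<bar>"
      using v[of 1] v[of 2] by (auto simp: abs_if split: if_splits)
    then show "F (x + v) = 0" by (rule vanishes_beyondD[OF F])
  qed
  let ?a = "vector [-L', -L', a] :: real^3" and ?b = "vector [L', L', b] :: real^3"
  have "integral (cbox ?a ?b) (\<lambda>x. F (x + v)) = integral (cbox (?a + v) (?b + v)) F"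
    using integral_shift_cbox[of "?a + v" v "?b + v" F] by simp
  also have "\<dots> = integral (slab (a + v $ 3) (b + v $ 3)) F"
  proof (rule integral_spike_set)
    have "{x \<in> cbox (?a + v) (?b + v) - slab (a + v $ 3) (b + v $ 3). F x \<noteq> 0} = {}"
      by (auto simp: slab_def mem_box_cart forall_3)
    then show "negligible {x \<in> cbox (?a + v) (?b + v) - slab (a + v $ 3) (b + v $ 3). F x \<noteq> 0}"
      by (metis negligible_empty)
    have "F x = 0" if "x \<in> slab (a + v $ 3) (b + v $ 3)" "x \<notin> cbox (?a + v) (?b + v)" for x
    proof -
      have "L \<le> \<bar>x $ 1\<bar> \<or> L \<le> \<bar>x $ 2\<bar>"
        using that v[of 1] v[of 2] unfolding L'_def
        by (auto simp: slab_def mem_box_cart forall_3 abs_if split: if_splits)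
      then show ?thesis by (rule vanishes_beyondD[OF F])
    qed
    then have "{x \<in> slab (a + v $ 3) (b + v $ 3) - cbox (?a + v) (?b + v). F x \<noteq> 0} = {}" by auto
    then show "negligible {x \<in> slab (a + v $ 3) (b + v $ 3) - cbox (?a + v) (?b + v). F x \<noteq> 0}"
      by (metis negligible_empty)
  qed
  finally show ?thesis using slab_integral_eq_box[OF 1] by simp
qed

lemma slab_integral_join:
  assumes "vanishes_beyond L F" "continuous_on UNIV F" "a \<le> b" "b \<le> c"
  shows "integral (slab a b) F + integral (slab b c) F = integral (slab a c) F"
proof -
  have "negligible (slab a b \<inter> slab b c)"
    by (rule negligible_subset[OF negligible_standard_hyperplane[of "axis 3 1" b]])
       (auto simp: slab_def inner_axis axis_in_Basis_iff)
  then have "integral (slab a b \<union> slab b c) F = integral (slab a b) F + integral (slab b c) F"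
    by (intro Henstock_Kurzweil_Integration.integral_Un slab_integrable[OF assms(1,2)])
  moreover have "slab a b \<union> slab b c = slab a c" using assms by (auto simp: slab_def)
  ultimately show ?thesis by simp
qed

text \<open>Vertical translations move the slab; the part that is pushed out is put back by periodicity.\<close>

lemma slab_integral_translate:
  assumes F: "vanishes_beyond L F" "continuous_on UNIV F" "z_periodic F"
    and v: "0 \<le> v $ 3" "v $ 3 \<le> 1"
  shows "slab_integral (\<lambda>x. F (x + v)) = slab_integral F"
proof -
  let ?t = "v $ 3"
  have "integral (slab 0 ?t) F = integral (slab 0 ?t) (\<lambda>x. F (x + z_shift 1))"
    using F(3) by (simp add: z_periodic_def)
  also have "\<dots> = integral (slab 1 (1 + ?t)) F"
    by (subst slab_integral_shift[OF F(1)]) (simp add: axis_def add.commute)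
  finally have "integral (slab ?t (1 + ?t)) F = integral (slab 0 ?t) F + integral (slab ?t 1) F"
    using slab_integral_join[OF F(1,2), of ?t 1 "1 + ?t"] v by simp
  also have "\<dots> = integral (slab 0 1) F"
    using slab_integral_join[OF F(1,2), of 0 ?t 1] v by simp
  finally show ?thesis
    unfolding slab_integral_def by (subst slab_integral_shift[OF F(1)]) simp
qed

lemma slab_integral_add:
  assumes "vanishes_beyond L F" "continuous_on UNIV F" "vanishes_beyond L G" "continuous_on UNIV G"
  shows "slab_integral (\<lambda>x. F x + G x) = slab_integral F + slab_integral G"
  unfolding slab_integral_def by (rule integral_add) (rule slab_integrable[OF assms(1,2)] slab_integrable[OF assms(3,4)])+

lemma slab_integral_cmult: "slab_integral (\<lambda>x. c * F x) = c * slab_integral F"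
  unfolding slab_integral_def by simp

lemma slab_integral_mono:
  assumes "vanishes_beyond L F" "continuous_on UNIV F" "vanishes_beyond M G" "continuous_on UNIV G"
    "\<And>x. 0 \<le> x $ 3 \<Longrightarrow> x $ 3 \<le> 1 \<Longrightarrow> F x \<le> G x"
  shows "slab_integral F \<le> slab_integral G"
  unfolding slab_integral_def
  by (rule integral_le) (use slab_integrable[OF assms(1,2)] slab_integrable[OF assms(3,4)] assms(5) in \<open>auto simp: slab_def\<close>)

lemma slab_integral_eq_0D:
  assumes F: "vanishes_beyond L F" "continuous_on UNIV F" "\<And>x. F x \<ge> 0" and 0: "slab_integral F = 0"
    and x: "0 \<le> x $ 3" "x $ 3 \<le> 1"
  shows "F x = 0"
proof -
  define M where "M = \<bar>L\<bar> + \<bar>x $ 1\<bar> + \<bar>x $ 2\<bar> + 1"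
  have v: "vanishes_beyond M F" by (rule vanishes_beyond_mono[OF F(1)]) (simp add: M_def)
  let ?a = "vector [-M, -M, 0] :: real^3" and ?b = "vector [M, M, 1] :: real^3"
  have "M > 0" by (simp add: M_def)
  then have "box ?a ?b \<noteq> {}"
    using interval_ne_empty_cart(2)[of ?a ?b] by (simp add: forall_3)
  moreover have "integral (cbox ?a ?b) F = 0"
    using 0 slab_integral_eq_box[OF v, of 0 1] by (simp add: slab_integral_def)
  ultimately have "\<forall>x\<in>cbox ?a ?b. F x = 0"
    using integral_cbox_eq_0_iff[OF continuous_on_subset[OF F(2)], of ?a ?b] F(3) by auto
  moreover have "x \<in> cbox ?a ?b" using x unfolding mem_slab_box by (auto simp: M_def)
  ultimately show ?thesis by blast
qed

lemma slab_integral_rotate: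
  fixes T :: "real^3 \<Rightarrow> real^3"
  assumes F: "vanishes_beyond L F" "continuous_on UNIV F"
    and T: "orthogonal_transformation T" "\<And>x. T x $ 3 = x $ 3"
  shows "slab_integral (\<lambda>x. F (T x)) = slab_integral F"
proof -
  \<comment> \<open>The linear change of variables formula is about vector-valued functions.\<close>
  let ?f = "\<lambda>x. vec (F x) :: real^1"
  have lin: "linear T" using T(1) orthogonal_transformation_linear by blast
  have "F absolutely_integrable_on (slab 0 1)"
  proof (rule absolutely_integrable_integrable_bound[where g = "\<lambda>x. \<bar>F x\<bar>"])
    have "vanishes_beyond L (\<lambda>x. \<bar>F x\<bar>)" using F(1) by (simp add: vanishes_beyond_def)
    then show "(\<lambda>x. \<bar>F x\<bar>) integrable_on slab 0 1"
      by (rule slab_integrable) (intro continuous_intros F(2))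
  qed (auto intro: slab_integrable[OF F])
  then have abs: "?f absolutely_integrable_on (slab 0 1)"
    by (subst absolutely_integrable_componentwise_iff) (auto simp: Basis_vec_def inner_axis vec_def)
  have surj: "T ` slab 0 1 = slab 0 1"
  proof -
    have "y \<in> T ` slab 0 1" if "y \<in> slab 0 1" for y
    proof -
      obtain x where "y = T x" using orthogonal_transformation_surj[OF T(1)] by (metis surjD)
      then show ?thesis using that T(2) by (auto simp: slab_def)
    qed
    then show ?thesis using T(2) by (auto simp: slab_def)
  qed
  have "\<bar>det (matrix T)\<bar> = 1" by (simp add: T)
  then have eq: "integral (slab 0 1) ?f = integral (slab 0 1) (?f \<circ> T)"
    using integral_change_of_variables_linear[OF lin, where f = ?f and S = "slab 0 1"] abs surj by simp
  have i1: "?f integrable_on slab 0 1" using abs by (rule set_lebesgue_integral_eq_integral(1))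
  have "(?f \<circ> T) absolutely_integrable_on slab 0 1"
    using absolutely_integrable_on_linear_image[OF lin, where f = ?f and S = "slab 0 1"] abs surj \<open>\<bar>det (matrix T)\<bar> = 1\<close> by auto
  then have i2: "(?f \<circ> T) integrable_on slab 0 1" by (rule set_lebesgue_integral_eq_integral(1))
  show ?thesis
    using eq integral_component_eq_cart[OF i1, of 1] integral_component_eq_cart[OF i2, of 1]
    unfolding slab_integral_def by simp
qed

lemma z_periodic_partial_deriv:
  assumes "z_periodic F" "\<And>x. F differentiable (at x)"
  shows "z_periodic (partial_deriv i F)"
  unfolding z_periodic_def
proof
  fix x :: "real^3"
  have "(F has_derivative frechet_derivative F (at (x + z_shift 1))) (at (x + z_shift 1))"
    using assms(2) frechet_derivative_works by blast
  then have "((\<lambda>y. F (y + z_shift 1)) has_derivative frechet_derivative F (at (x + z_shift 1))) (at x)"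
    by (rule has_derivative_compose[rotated]) (auto intro!: derivative_eq_intros)
  then have "(F has_derivative frechet_derivative F (at (x + z_shift 1))) (at x)"
    using assms(1) by (simp add: z_periodic_def)
  then show "partial_deriv i F (x + z_shift 1) = partial_deriv i F x"
    by (simp add: partial_deriv_def frechet_derivative_at[symmetric])
qed

text \<open>By translation invariance, the integral of \<open>\<partial>\<^sub>i F\<close> is the average over \<open>t \<in> [0, 1]\<close> of the
  integrals of \<open>\<partial>\<^sub>i F (x + t e\<^sub>i)\<close>, that is, the integral of \<open>F (x + e\<^sub>i) - F x\<close>. This treats the
  horizontal and the periodic direction alike.\<close>

lemma slab_integral_partial_deriv:
  assumes F: "vanishes_beyond L F" "z_periodic F" "\<And>x. F differentiable (at x)"
    and cont: "continuous_on UNIV (partial_deriv i F)"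
  shows "slab_integral (partial_deriv i F) = 0"
proof -
  let ?e = "axis i 1 :: real^3" and ?D = "partial_deriv i F"
  have contF: "continuous_on UNIV F"
    by (simp add: F(3) continuous_at_imp_continuous_on differentiable_imp_continuous_within)
  have open_beyond: "?D x = 0" if "L < \<bar>x $ 1\<bar> \<or> L < \<bar>x $ 2\<bar>" for x
  proof -
    have "open {x::real^3. L < \<bar>x $ 1\<bar> \<or> L < \<bar>x $ 2\<bar>}"
      by (intro open_Collect_disj open_Collect_less continuous_intros)
    then have "(F has_derivative (\<lambda>_. 0)) (at x)"
      using that
      by (intro has_derivative_transform_within_open[OF has_derivative_const[of 0]])
         (auto simp: vanishes_beyondD[OF F(1)])
    then show ?thesis by (simp add: partial_deriv_eqI)
  qed
  have D: "vanishes_beyond (L + 1) ?D"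
    unfolding vanishes_beyond_def
  proof (intro allI impI)
    fix x :: "real^3" assume "L + 1 \<le> \<bar>x $ 1\<bar> \<or> L + 1 \<le> \<bar>x $ 2\<bar>"
    then show "?D x = 0" by (intro open_beyond) auto
  qed
  have perD: "z_periodic ?D" using F by (simp add: z_periodic_partial_deriv)
  have e: "0 \<le> (t *\<^sub>R ?e) $ 3" "(t *\<^sub>R ?e) $ 3 \<le> 1" if "0 \<le> t" "t \<le> 1" for t
    using that by (auto simp: axis_def)
  have Dt: "vanishes_beyond (L + 2) (\<lambda>x. ?D (x + t *\<^sub>R ?e))" if "0 \<le> t" "t \<le> 1" for t
    unfolding vanishes_beyond_def
  proof (intro allI impI)
    fix x :: "real^3" assume x: "L + 2 \<le> \<bar>x $ 1\<bar> \<or> L + 2 \<le> \<bar>x $ 2\<bar>"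
    have "\<bar>(t *\<^sub>R ?e) $ k\<bar> \<le> 1" for k using that by (auto simp: axis_def)
    from this[of 1] this[of 2] x have "L < \<bar>(x + t *\<^sub>R ?e) $ 1\<bar> \<or> L < \<bar>(x + t *\<^sub>R ?e) $ 2\<bar>"
      by (auto simp del: vector_scaleR_component)
    then show "?D (x + t *\<^sub>R ?e) = 0" by (rule open_beyond)
  qed
  have "slab_integral ?D = integral {0..1} (\<lambda>t. slab_integral (\<lambda>x. ?D (x + t *\<^sub>R ?e)))"
  proof -
    have "integral {0..1} (\<lambda>t. slab_integral (\<lambda>x. ?D (x + t *\<^sub>R ?e))) = integral {0..1::real} (\<lambda>t. slab_integral ?D)"
      by (rule integral_cong) (auto intro!: slab_integral_translate[OF D cont perD] e)
    then show ?thesis by simp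
  qed
  also have "\<dots> = slab_integral (\<lambda>x. integral {0..1} (\<lambda>t. ?D (x + t *\<^sub>R ?e)))"
  proof (rule slab_integral_swap[OF _ Dt])
    show "continuous_on UNIV (\<lambda>(t, x). ?D (x + t *\<^sub>R ?e))"
      unfolding split_beta by (intro continuous_on_compose2[OF cont] continuous_intros) auto
  qed
  also have "\<dots> = slab_integral (\<lambda>x. F (x + 1 *\<^sub>R ?e) - F x)"
  proof (rule arg_cong[where f = slab_integral], rule ext)
    fix x
    have "((\<lambda>t. ?D (x + t *\<^sub>R ?e)) has_integral F (x + 1 *\<^sub>R ?e) - F (x + 0 *\<^sub>R ?e)) {0..1}"
      by (rule fundamental_theorem_of_calculus) (auto intro: has_derivative_along_line F(3))
    then show "integral {0..1} (\<lambda>t. ?D (x + t *\<^sub>R ?e)) = F (x + 1 *\<^sub>R ?e) - F x"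
      by (simp add: integral_unique)
  qed
  also have "\<dots> = slab_integral (\<lambda>x. F (x + 1 *\<^sub>R ?e)) - slab_integral F"
  proof -
    have "vanishes_beyond (L + 1) (\<lambda>x. F (x + 1 *\<^sub>R ?e))"
      unfolding vanishes_beyond_def
    proof (intro allI impI)
      fix x :: "real^3" assume x: "L + 1 \<le> \<bar>x $ 1\<bar> \<or> L + 1 \<le> \<bar>x $ 2\<bar>"
      have "\<bar>(1 *\<^sub>R ?e) $ k\<bar> \<le> 1" for k by (auto simp: axis_def)
      from this[of 1] this[of 2] x have "L \<le> \<bar>(x + 1 *\<^sub>R ?e) $ 1\<bar> \<or> L \<le> \<bar>(x + 1 *\<^sub>R ?e) $ 2\<bar>"
        by (auto simp del: vector_scaleR_component)
      then show "F (x + 1 *\<^sub>R ?e) = 0" by (rule vanishes_beyondD[OF F(1)])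
    qed
    then have "(\<lambda>x. F (x + 1 *\<^sub>R ?e)) integrable_on slab 0 1"
      by (rule slab_integrable) (intro continuous_on_compose2[OF contF] continuous_intros, auto)
    then show ?thesis
      unfolding slab_integral_def
      by (rule integral_diff) (rule slab_integrable[OF F(1) contF])
  qed
  also have "\<dots> = 0" using slab_integral_translate[OF F(1) contF F(2), of "1 *\<^sub>R ?e"] e[of 1] by simp
  finally show ?thesis .
qed

section \<open>Cutoffs and integration by parts\<close>

text \<open>A Lipschitz cutoff used through its powers: differentiating the power \<open>k + 1\<close> leaves the power \<open>k\<close>
  times \<open>O(1/R)\<close>. The lost power is recovered by Young's inequality, or by doubling the radius.\<close>

definition cutoff :: "real \<Rightarrow> real^3 \<Rightarrow> real" where
  "cutoff R x = max 0 (1 - ((x $ 1)\<^sup>2 + (x $ 2)\<^sup>2) / R\<^sup>2)"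

definition J :: "real \<Rightarrow> nat \<Rightarrow> (real^3 \<Rightarrow> real) \<Rightarrow> real" where
  "J R k F = slab_integral (\<lambda>x. cutoff R x ^ k * F x)"

text \<open>Half the gradient of \<open>x\<^sub>1\<^sup>2 + x\<^sub>2\<^sup>2\<close>, the vector that appears when the cutoff is differentiated.\<close>

definition horizontal :: "3 \<Rightarrow> real^3 \<Rightarrow> real" where
  "horizontal i x = (if i = 3 then 0 else x $ i)"

definition per_smooth :: "(real^3 \<Rightarrow> real) \<Rightarrow> bool" where
  "per_smooth f \<longleftrightarrow> smooth f \<and> z_periodic f"

lemma per_smoothD: "per_smooth f \<Longrightarrow> smooth f" "per_smooth f \<Longrightarrow> z_periodic f"
  by (auto simp: per_smooth_def)

lemma per_smooth_continuous [intro]: "per_smooth f \<Longrightarrow> continuous_on S f"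
  using smooth_continuous_on per_smoothD by blast

lemma per_smooth_intros [intro!]:
  "per_smooth (\<lambda>x. c)"
  "per_smooth f \<Longrightarrow> per_smooth g \<Longrightarrow> per_smooth (\<lambda>x. f x + g x)"
  "per_smooth f \<Longrightarrow> per_smooth g \<Longrightarrow> per_smooth (\<lambda>x. f x * g x)"
  "per_smooth f \<Longrightarrow> per_smooth g \<Longrightarrow> per_smooth (\<lambda>x. f x - g x)"
  "per_smooth f \<Longrightarrow> per_smooth (\<lambda>x. - f x)"
  "per_smooth f \<Longrightarrow> per_smooth (\<lambda>x. f x ^ n)"
  "(\<And>i. i \<in> A \<Longrightarrow> per_smooth (h i)) \<Longrightarrow> per_smooth (\<lambda>x. \<Sum>i\<in>A. h i x)"
  "per_smooth f \<Longrightarrow> per_smooth (partial_deriv i f)"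
proof -
  assume "per_smooth f"
  then show "per_smooth (partial_deriv i f)"
    by (simp add: per_smooth_def smooth_partial_deriv z_periodic_partial_deriv smooth_differentiable)
qed (auto simp: per_smooth_def z_periodic_def)

lemma per_smooth_horizontal: "per_smooth (horizontal i)"
  unfolding per_smooth_def horizontal_def z_periodic_def
  by (cases "i = 3") (auto simp: axis_def)

lemma per_smooth_coord: "i \<noteq> 3 \<Longrightarrow> per_smooth (\<lambda>x. x $ i)"
  unfolding per_smooth_def z_periodic_def by (auto simp: axis_def)

lemma cutoff_bounds: "0 \<le> cutoff R x" "cutoff R x \<le> 1"
  by (auto simp: cutoff_def)

lemma continuous_on_cutoff [continuous_intros]: "continuous_on S (cutoff R)"
proof (cases "R = 0")
  case False
  then show ?thesis unfolding cutoff_def[abs_def] by (intro continuous_intros) auto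
qed (simp add: cutoff_def[abs_def])

lemma cutoff_positiveD:
  assumes "cutoff R x > 0" "R > 0"
  shows "(x $ 1)\<^sup>2 + (x $ 2)\<^sup>2 < R\<^sup>2" "\<bar>horizontal i x\<bar> \<le> R"
proof -
  have "((x $ 1)\<^sup>2 + (x $ 2)\<^sup>2) / R\<^sup>2 < 1" using assms by (auto simp: cutoff_def max_def split: if_splits)
  then show 1: "(x $ 1)\<^sup>2 + (x $ 2)\<^sup>2 < R\<^sup>2" using assms by (simp add: divide_simps)
  have "i = 1 \<or> i = 2 \<or> i = 3" by (rule exhaust_3)
  moreover have "(x $ 1)\<^sup>2 \<le> R\<^sup>2" "(x $ 2)\<^sup>2 \<le> R\<^sup>2"
    using 1 zero_le_power2[of "x $ 1"] zero_le_power2[of "x $ 2"] by linarith+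
  ultimately have "(horizontal i x)\<^sup>2 \<le> R\<^sup>2"
    by (auto simp: horizontal_def)
  then show "\<bar>horizontal i x\<bar> \<le> R" using assms(2) abs_le_square_iff[of "horizontal i x" R] by simp
qed

lemma vanishes_beyond_cutoff:
  assumes "R > 0" "k > 0"
  shows "vanishes_beyond R (\<lambda>x. cutoff R x ^ k * F x)"
  unfolding vanishes_beyond_def
proof (intro allI impI)
  fix x :: "real^3" assume "R \<le> \<bar>x $ 1\<bar> \<or> R \<le> \<bar>x $ 2\<bar>"
  then have "R\<^sup>2 \<le> (x $ 1)\<^sup>2 \<or> R\<^sup>2 \<le> (x $ 2)\<^sup>2"
    using assms abs_le_square_iff[of R "x $ 1"] abs_le_square_iff[of R "x $ 2"] by auto
  then have "R\<^sup>2 \<le> (x $ 1)\<^sup>2 + (x $ 2)\<^sup>2" by (auto simp: add_increasing add_increasing2)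
  then have "cutoff R x = 0" using assms by (simp add: cutoff_def divide_simps)
  then show "cutoff R x ^ k * F x = 0" using assms by simp
qed

lemma continuous_on_cutoff_mult:
  "continuous_on UNIV F \<Longrightarrow> continuous_on UNIV (\<lambda>x. cutoff R x ^ k * F x)"
  by (intro continuous_intros)

lemma J_add:
  assumes "R > 0" "k > 0" "continuous_on UNIV F" "continuous_on UNIV G"
  shows "J R k (\<lambda>x. F x + G x) = J R k F + J R k G"
  unfolding J_def distrib_left
  by (rule slab_integral_add) (rule vanishes_beyond_cutoff continuous_on_cutoff_mult assms)+

lemma J_cmult: "J R k (\<lambda>x. c * F x) = c * J R k F"
  unfolding J_def slab_integral_cmult[symmetric] by (simp add: mult.left_commute)

lemma J_uminus: "J R k (\<lambda>x. - F x) = - J R k F"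
  using J_cmult[of R k "-1" F] by simp

lemma J_diff:
  assumes "R > 0" "k > 0" "continuous_on UNIV F" "continuous_on UNIV G"
  shows "J R k (\<lambda>x. F x - G x) = J R k F - J R k G"
  using J_add[OF assms(1-3), of "\<lambda>x. - G x"] assms(4) by (simp add: J_uminus continuous_on_minus)

lemma J_0 [simp]: "J R k (\<lambda>x. 0) = 0"
  by (simp add: J_def slab_integral_def)

lemma J_sum:
  assumes "R > 0" "k > 0" "\<And>i. i \<in> A \<Longrightarrow> continuous_on UNIV (F i)"
  shows "J R k (\<lambda>x. \<Sum>i\<in>A. F i x) = (\<Sum>i\<in>A. J R k (F i))"
  using assms(3)
proof (induction A rule: infinite_finite_induct)
  case (insert a A)
  then have "J R k (\<lambda>x. F a x + (\<Sum>i\<in>A. F i x)) = J R k (F a) + J R k (\<lambda>x. \<Sum>i\<in>A. F i x)"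
    by (intro J_add[OF assms(1,2)] continuous_on_sum) auto
  with insert show ?case by simp
qed auto

text \<open>The comparison of integrals taken with different powers of the cutoff: this is how Young's
  inequality trades powers of the cutoff between two factors.\<close>

lemma J_combine:
  assumes "R > 0" "k > 0" "m > 0" "n > 0"
    and "continuous_on UNIV F" "continuous_on UNIV G" "continuous_on UNIV H"
    and le: "\<And>x. 0 < cutoff R x \<Longrightarrow> cutoff R x \<le> 1 \<Longrightarrow>
      cutoff R x ^ k * F x \<le> cutoff R x ^ m * G x + cutoff R x ^ n * H x"
  shows "J R k F \<le> J R m G + J R n H"
proof -
  have "J R k F \<le> slab_integral (\<lambda>x. cutoff R x ^ m * G x + cutoff R x ^ n * H x)"
    unfolding J_def
  proof (rule slab_integral_mono)
    show "vanishes_beyond R (\<lambda>x. cutoff R x ^ k * F x)"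
      by (rule vanishes_beyond_cutoff[OF assms(1,2)])
    show "vanishes_beyond R (\<lambda>x. cutoff R x ^ m * G x + cutoff R x ^ n * H x)"
      using vanishes_beyond_cutoff[OF assms(1,3), of G] vanishes_beyond_cutoff[OF assms(1,4), of H]
      unfolding vanishes_beyond_def by (metis add.right_neutral)
    show "cutoff R x ^ k * F x \<le> cutoff R x ^ m * G x + cutoff R x ^ n * H x" for x
      using le[of x] cutoff_bounds[of R x] assms(2-4) by (cases "cutoff R x = 0") (auto simp: power_0_left)
  qed (intro continuous_intros assms)+
  also have "\<dots> = J R m G + J R n H"
    unfolding J_def
    by (rule slab_integral_add) (rule vanishes_beyond_cutoff continuous_on_cutoff_mult assms)+
  finally show ?thesis .
qed

lemma J_mono_power:
  assumes "R > 0" "k > 0" "m > 0" "continuous_on UNIV F" "continuous_on UNIV G"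
    and "\<And>x. 0 < cutoff R x \<Longrightarrow> cutoff R x \<le> 1 \<Longrightarrow> cutoff R x ^ k * F x \<le> cutoff R x ^ m * G x"
  shows "J R k F \<le> J R m G"
  using J_combine[OF assms(1-3,3-5), of "\<lambda>x. 0"] assms(6) by simp

lemma J_mono:
  assumes "R > 0" "k > 0" "continuous_on UNIV F" "continuous_on UNIV G"
    and "\<And>x. 0 < cutoff R x \<Longrightarrow> F x \<le> G x"
  shows "J R k F \<le> J R k G"
  using assms by (intro J_mono_power) auto

lemma J_nonneg:
  assumes "R > 0" "k > 0" "continuous_on UNIV F" "\<And>x. 0 \<le> F x"
  shows "0 \<le> J R k F"
  using J_mono[OF assms(1,2) _ assms(3), of "\<lambda>x. 0"] assms(4) by simp

lemma J_abs:
  assumes "R > 0" "k > 0" "continuous_on UNIV F"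
  shows "\<bar>J R k F\<bar> \<le> J R k (\<lambda>x. \<bar>F x\<bar>)"
proof -
  have c: "continuous_on UNIV (\<lambda>x. \<bar>F x\<bar>)" "continuous_on UNIV (\<lambda>x. - F x)"
    by (intro continuous_intros assms)+
  have "J R k F \<le> J R k (\<lambda>x. \<bar>F x\<bar>)" "J R k (\<lambda>x. - F x) \<le> J R k (\<lambda>x. \<bar>F x\<bar>)"
    by (rule J_mono[OF assms(1,2)]; use c assms(3) in simp)+
  then show ?thesis by (simp add: J_uminus)
qed

lemma J_power_antimono:
  assumes "R > 0" "m > 0" "m \<le> k" "continuous_on UNIV F" "\<And>x. 0 \<le> F x"
  shows "J R k F \<le> J R m F"
  using assms by (intro J_mono_power mult_right_mono power_decreasing) auto

lemma J_radius_compare: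
  assumes "R > 0" "S > 0" "k > 0" "m > 0" "continuous_on UNIV F" "\<And>x. 0 \<le> F x"
    and "\<And>x. cutoff R x ^ k \<le> c * cutoff S x ^ m"
  shows "J R k F \<le> c * J S m F"
  unfolding J_def slab_integral_cmult[symmetric]
proof (rule slab_integral_mono)
  show "vanishes_beyond S (\<lambda>x. c * (cutoff S x ^ m * F x))"
    using vanishes_beyond_cutoff[OF assms(2,4), of F] by (simp add: vanishes_beyond_def)
  show "cutoff R x ^ k * F x \<le> c * (cutoff S x ^ m * F x)" for x
    using mult_right_mono[OF assms(7) assms(6)[of x], of x] by (simp add: mult.assoc)
  show "vanishes_beyond R (\<lambda>x. cutoff R x ^ k * F x)"
    by (rule vanishes_beyond_cutoff[OF assms(1,3)])
qed (intro continuous_intros assms)+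

lemma J_radius_mono:
  assumes "R > 0" "R \<le> S" "k > 0" "continuous_on UNIV F" "\<And>x. 0 \<le> F x"
  shows "J R k F \<le> J S k F"
proof -
  have "cutoff R x \<le> cutoff S x" for x
  proof -
    have "((x $ 1)\<^sup>2 + (x $ 2)\<^sup>2) / S\<^sup>2 \<le> ((x $ 1)\<^sup>2 + (x $ 2)\<^sup>2) / R\<^sup>2"
      using assms by (intro divide_left_mono power_mono mult_pos_pos) auto
    then show ?thesis by (auto simp: cutoff_def)
  qed
  then have "cutoff R x ^ k \<le> 1 * cutoff S x ^ k" for x
    by (simp add: power_mono cutoff_bounds)
  then show ?thesis using J_radius_compare[of R S k k F 1] assms by auto
qed

lemma cutoff_double:
  assumes "R > 0" "cutoff R x > 0"
  shows "3/4 \<le> cutoff (2 * R) x"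
proof -
  have "((x $ 1)\<^sup>2 + (x $ 2)\<^sup>2) / (2 * R)\<^sup>2 \<le> R\<^sup>2 / (2 * R)\<^sup>2"
    using cutoff_positiveD(1)[OF assms(2,1)] by (intro divide_right_mono) auto
  also have "\<dots> = 1/4" using assms by (simp add: power2_eq_square)
  finally show ?thesis unfolding cutoff_def by linarith
qed

text \<open>Where the cutoff of radius \<open>R\<close> is positive, the one of radius \<open>2R\<close> is at least \<open>3/4\<close>. So any
  power of the cutoff can be exchanged for any other at the price of doubling the radius.\<close>

lemma J_double:
  assumes "R > 0" "m > 0" "k > 0" "continuous_on UNIV F" "\<And>x. 0 \<le> F x"
  shows "J R m F \<le> (4/3) ^ k * J (2 * R) k F"
proof (rule J_radius_compare)
  show "cutoff R x ^ m \<le> (4/3) ^ k * cutoff (2 * R) x ^ k" for x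
  proof (cases "cutoff R x > 0")
    case True
    have "cutoff R x ^ m \<le> 1" by (simp add: power_le_one cutoff_bounds)
    also have "1 \<le> ((4/3) * cutoff (2 * R) x) ^ k"
      using cutoff_double[OF assms(1) True] by (intro one_le_power) simp
    finally show ?thesis by (simp only: power_mult_distrib)
  next
    case False
    then have "cutoff R x = 0" using cutoff_bounds[of R x] by simp
    then show ?thesis using assms(2) cutoff_bounds[of "2*R" x] by (simp add: power_0_left)
  qed
qed (use assms in auto)

lemma integral_slab_box_const:
  assumes "L \<ge> 0"
  shows "integral (cbox (vector [-L, -L, 0]) (vector [L, L, 1]) :: (real^3) set) (\<lambda>x. c) = 4 * L\<^sup>2 * c"
proof -
  have ne: "cbox (vector [-L, -L, 0]) (vector [L, L, 1]) \<noteq> ({} :: (real^3) set)"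
    unfolding interval_ne_empty_cart(1) forall_3 using assms by simp
  have prod: "prod f (UNIV :: 3 set) = f 1 * f 2 * f 3" for f :: "3 \<Rightarrow> real"
    unfolding UNIV_3 by (simp add: mult.assoc)
  have "measure lborel (cbox (vector [-L, -L, 0]) (vector [L, L, 1]) :: (real^3) set) = 4 * L\<^sup>2"
    unfolding content_cbox_cart[OF ne] prod by (simp add: power2_eq_square)
  then show ?thesis by (simp only: integral_const real_scaleR_def)
qed

lemma J_one_upper: "R > 0 \<Longrightarrow> k > 0 \<Longrightarrow> J R k (\<lambda>x. 1) \<le> 4 * R\<^sup>2"
proof -
  assume R: "R > 0" and k: "k > 0"
  let ?B = "cbox (vector [-R, -R, 0]) (vector [R, R, 1]) :: (real^3) set"
  have v: "vanishes_beyond R (\<lambda>x. cutoff R x ^ k * 1)" by (rule vanishes_beyond_cutoff[OF R k])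
  have "J R k (\<lambda>x. 1) = integral ?B (\<lambda>x. cutoff R x ^ k * 1)"
    unfolding J_def slab_integral_def by (rule slab_integral_eq_box[OF v])
  also have "\<dots> \<le> integral ?B (\<lambda>x. 1)"
    by (intro integral_le integrable_continuous continuous_intros) (auto simp: power_le_one cutoff_bounds)
  also have "\<dots> = 4 * R\<^sup>2"
    using integral_slab_box_const[of R 1] R by simp
  finally show ?thesis .
qed

lemma J_one_lower: "R > 0 \<Longrightarrow> k > 0 \<Longrightarrow> (1/2) ^ k * R\<^sup>2 \<le> J R k (\<lambda>x. 1)"
proof -
  assume R: "R > 0" and k: "k > 0"
  let ?B = "cbox (vector [-R, -R, 0]) (vector [R, R, 1]) :: (real^3) set"
  let ?C = "cbox (vector [-(R/2), -(R/2), 0]) (vector [R/2, R/2, 1]) :: (real^3) set"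
  have v: "vanishes_beyond R (\<lambda>x. cutoff R x ^ k * 1)" by (rule vanishes_beyond_cutoff[OF R k])
  have "(1/2) ^ k * R\<^sup>2 = integral ?C (\<lambda>x. (1/2) ^ k)"
    using integral_slab_box_const[of "R / 2" "(1/2) ^ k"] R by (simp add: power2_eq_square)
  also have "\<dots> \<le> integral ?C (\<lambda>x. cutoff R x ^ k * 1)"
  proof (intro integral_le integrable_continuous continuous_intros)
    fix x :: "real^3" assume "x \<in> ?C"
    then have "\<bar>x $ 1\<bar> \<le> R/2" "\<bar>x $ 2\<bar> \<le> R/2" by (auto simp: mem_slab_box)
    then have "(x $ 1)\<^sup>2 \<le> (R/2)\<^sup>2" "(x $ 2)\<^sup>2 \<le> (R/2)\<^sup>2"
      using R by (auto simp: abs_le_square_iff[symmetric])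
    then have "(x $ 1)\<^sup>2 + (x $ 2)\<^sup>2 \<le> R\<^sup>2 / 2" by (simp add: power2_eq_square)
    then have "((x $ 1)\<^sup>2 + (x $ 2)\<^sup>2) / R\<^sup>2 \<le> 1/2" using R by (simp add: divide_simps)
    then have "1/2 \<le> cutoff R x" unfolding cutoff_def by linarith
    then show "(1/2) ^ k \<le> cutoff R x ^ k * 1" by (simp add: power_mono)
  qed
  also have "\<dots> \<le> integral ?B (\<lambda>x. cutoff R x ^ k * 1)"
  proof (intro integral_subset_le integrable_continuous continuous_intros)
    show "?C \<subseteq> ?B" using R by (auto simp: mem_slab_box)
  qed (auto simp: cutoff_bounds)
  also have "\<dots> = J R k (\<lambda>x. 1)"
    unfolding J_def slab_integral_def by (rule slab_integral_eq_box[OF v, symmetric])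
  finally show ?thesis .
qed

lemma z_periodic_cutoff_mult: "z_periodic F \<Longrightarrow> z_periodic (\<lambda>x. cutoff R x ^ k * F x)"
  by (simp add: z_periodic_def cutoff_def axis_def)

lemma cutoff_z_shift [simp]: "cutoff R (x + z_shift t) = cutoff R x"
  by (simp add: cutoff_def axis_def)

lemma has_real_derivative_positive_part_power:
  assumes "k > 0"
  shows "((\<lambda>y::real. max 0 y ^ Suc k) has_real_derivative (real (Suc k) * max 0 y ^ k)) (at y)"
proof -
  consider "y > 0" | "y < 0" | "y = 0" by linarith
  then show ?thesis
  proof cases
    case 1
    have "((\<lambda>y. y ^ Suc k) has_real_derivative (real (Suc k) * max 0 y ^ k)) (at y)"
      using 1 DERIV_pow[of "Suc k" y] by (simp add: max_def)
    then show ?thesis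
      by (rule has_field_derivative_transform_within_open[of _ _ _ "{0<..}"]) (use 1 in auto)
  next
    case 2
    have "((\<lambda>y. 0) has_real_derivative (real (Suc k) * max 0 y ^ k)) (at y)"
      using 2 assms by (auto intro!: derivative_eq_intros)
    then show ?thesis
      by (rule has_field_derivative_transform_within_open[of _ _ _ "{..<0}"]) (use 2 in auto)
  next
    case 3
    have "((\<lambda>h::real. max 0 h ^ k * (if h > 0 then 1 else 0)) \<longlongrightarrow> 0) (at 0)"
    proof (rule Lim_null_comparison)
      show "\<forall>\<^sub>F h in at 0. norm (max 0 h ^ k * (if h > 0 then 1 else 0)) \<le> max 0 h ^ k" for h :: real
        by (auto intro!: always_eventually)
      have "((\<lambda>h::real. max 0 h ^ k) \<longlongrightarrow> max 0 0 ^ k) (at 0)" by (intro tendsto_intros)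
      then show "((\<lambda>h::real. max 0 h ^ k) \<longlongrightarrow> 0) (at 0)" unfolding max.idem power_0_left using assms by simp
    qed
    moreover have "(max 0 (0 + h) ^ Suc k - max 0 0 ^ Suc k) / h = max 0 h ^ k * (if h > 0 then 1 else 0)"
      if "h \<noteq> 0" for h :: real
      using that assms by (auto simp: max_def)
    ultimately have "((\<lambda>y::real. max 0 y ^ Suc k) has_real_derivative 0) (at 0)"
      unfolding DERIV_def by (subst tendsto_cong[where g = "\<lambda>h. max 0 h ^ k * (if h > 0 then 1 else 0)"])
        (auto simp: eventually_at_filter)
    then show ?thesis using 3 assms by (simp add: power_0_left)
  qed
qed

lemma has_derivative_cutoff_power:
  assumes "R > 0" "k > 0"
  shows "((\<lambda>x. cutoff R x ^ Suc k) has_derivative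
    (\<lambda>v. - (2 * real (Suc k) / R\<^sup>2) * cutoff R x ^ k * (x $ 1 * v $ 1 + x $ 2 * v $ 2))) (at x)"
proof -
  let ?g = "\<lambda>x::real^3. 1 - ((x $ 1)\<^sup>2 + (x $ 2)\<^sup>2) / R\<^sup>2"
  have n: "((\<lambda>x::real^3. x $ i) has_derivative (\<lambda>v. v $ i)) (at x)" for i
    by (rule bounded_linear_imp_has_derivative[OF bounded_linear_vec_nth])
  have g: "(?g has_derivative (\<lambda>v. - (2 / R\<^sup>2) * (x $ 1 * v $ 1 + x $ 2 * v $ 2))) (at x)"
    by (rule has_derivative_eq_rhs, (rule derivative_intros n)+, use assms in \<open>auto simp: field_simps\<close>)
  have "((\<lambda>y::real. max 0 y ^ Suc k) has_derivative (\<lambda>h. (real (Suc k) * max 0 (?g x) ^ k) * h)) (at (?g x))"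
    using has_real_derivative_positive_part_power[OF assms(2)] unfolding has_field_derivative_def .
  from has_derivative_compose[OF g this] show ?thesis
    unfolding cutoff_def by (rule has_derivative_eq_rhs) (auto simp: field_simps)
qed

text \<open>The divergence theorem against a power of the cutoff. All boundary terms of the energy
  arguments are instances of the right-hand side, which is of relative size \<open>1/R\<close>.\<close>

lemma J_partial_deriv:
  assumes R: "R > 0" and k: "k > 0" and F: "per_smooth F"
  shows "J R (Suc k) (partial_deriv i F) = 2 * real (Suc k) / R\<^sup>2 * J R k (\<lambda>x. horizontal i x * F x)"
proof -
  let ?G = "\<lambda>x. cutoff R x ^ Suc k * F x"
  have d: "(?G has_derivative (\<lambda>v. cutoff R x ^ Suc k * frechet_derivative F (at x) v +
      (- (2 * real (Suc k) / R\<^sup>2) * cutoff R x ^ k * (x $ 1 * v $ 1 + x $ 2 * v $ 2)) * F x)) (at x)" for x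
    using has_derivative_mult[OF has_derivative_cutoff_power[OF R k] smooth_has_derivative[OF per_smoothD(1)[OF F]]]
    by simp
  have h: "x $ 1 * axis i (1::real) $ 1 + x $ 2 * axis i (1::real) $ 2 = horizontal i x" for x :: "real^3"
    using exhaust_3[of i] by (auto simp: axis_def horizontal_def)
  have D: "partial_deriv i ?G = (\<lambda>x. cutoff R x ^ Suc k * partial_deriv i F x +
      (- (2 * real (Suc k) / R\<^sup>2)) * (cutoff R x ^ k * (horizontal i x * F x)))"
    by (rule ext, subst partial_deriv_eqI[OF d]) (simp add: h partial_deriv_def mult.assoc)
  have contF: "continuous_on UNIV F" "continuous_on UNIV (partial_deriv i F)"
    "continuous_on UNIV (\<lambda>x. horizontal i x * F x)"
    using F by (auto intro!: continuous_intros per_smooth_continuous[OF per_smooth_horizontal])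
  have "0 = slab_integral (partial_deriv i ?G)"
  proof (rule slab_integral_partial_deriv[symmetric])
    show "vanishes_beyond R ?G" by (rule vanishes_beyond_cutoff) (use R in auto)
    show "z_periodic ?G" by (rule z_periodic_cutoff_mult[OF per_smoothD(2)[OF F]])
    show "?G differentiable at x" for x using d[of x] by (auto simp: differentiable_def)
    show "continuous_on UNIV (partial_deriv i ?G)" unfolding D by (intro continuous_intros contF)
  qed
  also have "\<dots> = J R (Suc k) (partial_deriv i F) +
      slab_integral (\<lambda>x. (- (2 * real (Suc k) / R\<^sup>2)) * (cutoff R x ^ k * (horizontal i x * F x)))"
    unfolding D J_def
  proof (rule slab_integral_add)
    show "vanishes_beyond R (\<lambda>x. cutoff R x ^ Suc k * partial_deriv i F x)"
      by (rule vanishes_beyond_cutoff) (use R in auto)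
    show "vanishes_beyond R (\<lambda>x. - (2 * real (Suc k) / R\<^sup>2) * (cutoff R x ^ k * (horizontal i x * F x)))"
      using vanishes_beyond_cutoff[OF R k, of "\<lambda>x. horizontal i x * F x"] unfolding vanishes_beyond_def by simp blast
  qed (intro continuous_intros contF)+
  also have "\<dots> = J R (Suc k) (partial_deriv i F) - 2 * real (Suc k) / R\<^sup>2 * J R k (\<lambda>x. horizontal i x * F x)"
    unfolding slab_integral_cmult J_def by simp
  finally show ?thesis by simp
qed

lemma J_parts:
  assumes R: "R > 0" and k: "k > 0" and f: "per_smooth f" and g: "per_smooth g"
  shows "J R (Suc k) (\<lambda>x. f x * partial_deriv i g x) =
    2 * real (Suc k) / R\<^sup>2 * J R k (\<lambda>x. horizontal i x * (f x * g x))
    - J R (Suc k) (\<lambda>x. partial_deriv i f x * g x)"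
proof -
  have "J R (Suc k) (partial_deriv i (\<lambda>x. f x * g x)) =
      J R (Suc k) (\<lambda>x. f x * partial_deriv i g x) + J R (Suc k) (\<lambda>x. partial_deriv i f x * g x)"
    unfolding partial_deriv_mult[OF per_smoothD(1)[OF f] per_smoothD(1)[OF g]]
    using R f g by (intro J_add) auto
  then show ?thesis using J_partial_deriv[OF R k per_smooth_intros(3)[OF f g], of i] by simp
qed

lemma J_horizontal_bound:
  assumes "R > 0" "k > 0" "continuous_on UNIV F"
  shows "\<bar>J R k (\<lambda>x. horizontal i x * F x)\<bar> \<le> R * J R k (\<lambda>x. \<bar>F x\<bar>)"
proof -
  have c: "continuous_on UNIV (\<lambda>x. horizontal i x * F x)" "continuous_on UNIV (\<lambda>x. \<bar>F x\<bar>)"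
    by (intro continuous_intros per_smooth_continuous[OF per_smooth_horizontal] assms)+
  have "\<bar>J R k (\<lambda>x. horizontal i x * F x)\<bar> \<le> J R k (\<lambda>x. \<bar>horizontal i x * F x\<bar>)"
    by (rule J_abs[OF assms(1,2) c(1)])
  also have "\<dots> \<le> J R k (\<lambda>x. R * \<bar>F x\<bar>)"
    using c cutoff_positiveD(2)[OF _ assms(1)] per_smooth_continuous[OF per_smooth_horizontal]
    by (intro J_mono assms continuous_intros) (auto simp: abs_mult intro!: mult_right_mono)
  finally show ?thesis by (simp add: J_cmult)
qed

lemma J_partial_deriv_bound:
  assumes R: "R > 0" and k: "k > 0" and F: "per_smooth F"
  shows "\<bar>J R (Suc k) (partial_deriv i F)\<bar> \<le> 2 * real (Suc k) / R * J R k (\<lambda>x. \<bar>F x\<bar>)"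
proof -
  have "\<bar>J R (Suc k) (partial_deriv i F)\<bar> = 2 * real (Suc k) / R\<^sup>2 * \<bar>J R k (\<lambda>x. horizontal i x * F x)\<bar>"
    using R by (simp add: J_partial_deriv[OF assms] abs_mult)
  also have "\<dots> \<le> 2 * real (Suc k) / R\<^sup>2 * (R * J R k (\<lambda>x. \<bar>F x\<bar>))"
    using F by (intro mult_left_mono J_horizontal_bound R k) auto
  also have "\<dots> = 2 * real (Suc k) / R * J R k (\<lambda>x. \<bar>F x\<bar>)"
    using R by (simp add: power2_eq_square)
  finally show ?thesis .
qed

lemma J_parts_bound:
  assumes R: "R > 0" and k: "k > 0" and f: "per_smooth f" and g: "per_smooth g"
  shows "\<bar>J R (Suc k) (\<lambda>x. f x * partial_deriv i g x) + J R (Suc k) (\<lambda>x. partial_deriv i f x * g x)\<bar>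
    \<le> 2 * real (Suc k) / R * J R k (\<lambda>x. \<bar>f x\<bar> * \<bar>g x\<bar>)"
proof -
  have fg: "per_smooth (\<lambda>x. f x * g x)" using f g by auto
  have "J R (Suc k) (partial_deriv i (\<lambda>x. f x * g x)) =
      J R (Suc k) (\<lambda>x. f x * partial_deriv i g x) + J R (Suc k) (\<lambda>x. partial_deriv i f x * g x)"
    unfolding partial_deriv_mult[OF per_smoothD(1)[OF f] per_smoothD(1)[OF g]]
    using R f g by (intro J_add) auto
  then show ?thesis using J_partial_deriv_bound[OF R k fg, of i] by (simp add: abs_mult)
qed

lemma continuous_on_fibre_integral:
  fixes F :: "real^3 \<Rightarrow> real"
  assumes "continuous_on UNIV F"
  shows "continuous_on UNIV (\<lambda>x. integral {0..1} (\<lambda>t. F (x + z_shift t)))"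
proof -
  have "continuous_on UNIV (\<lambda>x. integral (cbox 0 1) (\<lambda>t. F (x + z_shift t)))"
  proof (rule integral_continuous_on_param)
    show "continuous_on (UNIV \<times> cbox 0 1) (\<lambda>(x, t). F (x + z_shift t))"
      unfolding split_beta by (intro continuous_on_compose2[OF assms] continuous_intros) auto
  qed
  then show ?thesis by simp
qed

text \<open>The cutoff does not see the vertical variable, so a periodic integrand may be replaced by its
  average over each fibre.\<close>

lemma J_fibre_average:
  assumes R: "R > 0" and k: "k > 0" and F: "continuous_on UNIV F" "z_periodic F"
  shows "J R k (\<lambda>x. integral {0..1} (\<lambda>t. F (x + z_shift t))) = J R k F"
proof -
  let ?G = "\<lambda>x. cutoff R x ^ k * F x"
  have v: "vanishes_beyond R ?G" by (rule vanishes_beyond_cutoff[OF R k])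
  have cG: "continuous_on UNIV ?G" by (rule continuous_on_cutoff_mult[OF F(1)])
  have t: "0 \<le> (z_shift t) $ 3" "(z_shift t) $ 3 \<le> 1" if "0 \<le> t" "t \<le> 1" for t
    using that by (auto simp: axis_def)
  have "integral {0..1} (\<lambda>t. slab_integral (\<lambda>x. ?G (x + z_shift t))) = integral {0..1::real} (\<lambda>t. slab_integral ?G)"
    using t by (intro integral_cong slab_integral_translate[OF v cG z_periodic_cutoff_mult[OF F(2)]]) auto
  moreover have "integral {0..1} (\<lambda>t. slab_integral (\<lambda>x. ?G (x + z_shift t))) =
      slab_integral (\<lambda>x. integral {0..1} (\<lambda>t. ?G (x + z_shift t)))"
  proof (rule slab_integral_swap)
    show "continuous_on UNIV (\<lambda>(t, x). ?G (x + z_shift t))"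
      unfolding split_beta by (intro continuous_on_compose2[OF cG] continuous_intros) auto
    show "vanishes_beyond R (\<lambda>x. ?G (x + z_shift t))" for t
      unfolding cutoff_z_shift by (rule vanishes_beyond_cutoff[OF R k])
  qed
  ultimately show ?thesis by (simp add: J_def)
qed

lemma z_periodic_of_int:
  assumes "z_periodic F"
  shows "F (x + z_shift (of_int n)) = F x"
proof -
  have nat: "F (x + z_shift (real m)) = F x" for m x
  proof (induction m)
    case (Suc m)
    have "F (x + z_shift (real (Suc m))) = F ((x + z_shift (real m)) + z_shift 1)"
      by (simp add: scaleR_left_distrib algebra_simps)
    then show ?case using Suc assms by (simp add: z_periodic_def)
  qed simp
  show ?thesis
  proof (cases "n \<ge> 0")
    case True
    then show ?thesis using nat[of x "nat n"] by simp
  next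
    case False
    then show ?thesis using nat[of "x + z_shift (of_int n)" "nat (-n)"] by (simp add: scaleR_left_distrib[symmetric])
  qed
qed

lemma J_eq_0D:
  assumes R: "R > 0" and k: "k > 0" and F: "continuous_on UNIV F" "z_periodic F" "\<And>x. F x \<ge> 0"
    and J: "J R k F = 0" and x: "cutoff R x > 0"
  shows "F x = 0"
proof -
  let ?y = "x + z_shift (of_int (- \<lfloor>x $ 3\<rfloor>))"
  have "cutoff R ?y ^ k * F ?y = 0"
  proof (rule slab_integral_eq_0D[OF vanishes_beyond_cutoff[OF R k]])
    show "slab_integral (\<lambda>x. cutoff R x ^ k * F x) = 0" using J by (simp add: J_def)
    show "0 \<le> ?y $ 3" "?y $ 3 \<le> 1" by (simp_all add: axis_def) linarith+
  qed (auto intro!: continuous_on_cutoff_mult F mult_nonneg_nonneg simp: cutoff_bounds)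
  then have "F ?y = 0" using x unfolding cutoff_z_shift by simp
  then show ?thesis using z_periodic_of_int[OF F(2), of x "- \<lfloor>x $ 3\<rfloor>"] by simp
qed

section \<open>Wirtinger's inequality on the fibres\<close>

text \<open>Jacobi's argument: \<open>T = \<beta> tan (\<beta> (t - p - 1/4))\<close> solves the Riccati equation \<open>T' = \<beta>\<^sup>2 + T\<^sup>2\<close>, so
  \<open>h'\<^sup>2 - \<beta>\<^sup>2 h\<^sup>2 + (T h\<^sup>2)' = (h' + T h)\<^sup>2 \<ge> 0\<close>, and \<open>T h\<^sup>2\<close> vanishes at both ends. For the optimal
  \<open>\<beta> = 2\<pi>\<close> the tangent would blow up at the ends, whence the detour over \<open>\<beta>\<^sup>2 = 4\<pi>\<^sup>2 z\<close> with \<open>z < 1\<close>.\<close>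

lemma wirtinger_dirichlet:
  fixes h h' :: "real \<Rightarrow> real"
  assumes h: "\<And>t. (h has_real_derivative h' t) (at t)" and cont: "continuous_on UNIV h'"
    and zero: "h p = 0" "h (p + 1/2) = 0"
  shows "4 * pi\<^sup>2 * integral {p..p+1/2} (\<lambda>t. (h t)\<^sup>2) \<le> integral {p..p+1/2} (\<lambda>t. (h' t)\<^sup>2)"
proof (rule field_le_mult_one_interval)
  fix z :: real assume z: "0 < z" "z < 1"
  define \<beta> where "\<beta> = 2 * pi * sqrt z"
  define T where "T t = \<beta> * tan (\<beta> * (t - (p + 1/4)))" for t
  let ?I = "{p..p+1/2}"
  have \<beta>: "0 < \<beta>" "\<beta> < 2 * pi" using z by (auto simp: \<beta>_def)
  have cos: "cos (\<beta> * (t - (p + 1/4))) > 0" if "t \<in> ?I" for t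
  proof (rule cos_gt_zero_pi)
    have "\<bar>t - (p + 1/4)\<bar> \<le> 1/4" using that by (auto simp: abs_if)
    then have "\<bar>\<beta> * (t - (p + 1/4))\<bar> \<le> \<beta> * (1/4)" using \<beta> by (simp add: abs_mult)
    also have "\<dots> < pi / 2" using \<beta> by simp
    finally show "- (pi / 2) < \<beta> * (t - (p + 1/4))" "\<beta> * (t - (p + 1/4)) < pi / 2" by auto
  qed
  have conth: "continuous_on S h" for S
    using h by (meson DERIV_isCont continuous_at_imp_continuous_on)
  have conth': "continuous_on S h'" for S using cont continuous_on_subset by blast
  have contT: "continuous_on ?I T"
    unfolding T_def[abs_def] using cos by (intro continuous_intros) (auto simp: less_imp_neq[symmetric])
  have T': "(T has_real_derivative (\<beta>\<^sup>2 + (T t)\<^sup>2)) (at t)" if "t \<in> ?I" for t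
  proof -
    have c: "cos (\<beta> * (t - (p + 1/4))) \<noteq> 0" using cos[OF that] by simp
    have "((\<lambda>t. \<beta> * (t - (p + 1/4))) has_real_derivative \<beta>) (at t)"
      by (auto intro!: derivative_eq_intros)
    from DERIV_cmult[OF DERIV_chain2[OF DERIV_tan[OF c] this], of \<beta>]
    have "(T has_real_derivative \<beta> * (inverse ((cos (\<beta> * (t - (p + 1/4))))\<^sup>2) * \<beta>)) (at t)"
      unfolding T_def[abs_def] .
    moreover have "\<beta> * (inverse ((cos (\<beta> * (t - (p + 1/4))))\<^sup>2) * \<beta>) = \<beta>\<^sup>2 * (1 + (tan (\<beta> * (t - (p + 1/4))))\<^sup>2)"
      unfolding tan_sec[OF c] by (simp add: power_inverse power2_eq_square)
    ultimately show ?thesis by (simp add: T_def power_mult_distrib distrib_left)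
  qed
  let ?G' = "\<lambda>t. (\<beta>\<^sup>2 + (T t)\<^sup>2) * (h t)\<^sup>2 + 2 * T t * h t * h' t"
  have "(?G' has_integral (T (p + 1/2) * (h (p + 1/2))\<^sup>2 - T p * (h p)\<^sup>2)) ?I"
  proof (rule fundamental_theorem_of_calculus)
    fix t assume t: "t \<in> ?I"
    have "((\<lambda>t. T t * (h t)\<^sup>2) has_real_derivative ?G' t) (at t)"
      by (rule derivative_eq_intros T'[OF t] h refl)+ (simp add: algebra_simps)
    then show "((\<lambda>t. T t * (h t)\<^sup>2) has_vector_derivative ?G' t) (at t within ?I)"
      by (simp add: has_real_derivative_iff_has_vector_derivative has_vector_derivative_at_within)
  qed simp
  then have G: "(?G' has_integral 0) ?I" using zero by simp
  have i1: "((\<lambda>t. (h' t)\<^sup>2) has_integral integral ?I (\<lambda>t. (h' t)\<^sup>2)) ?I"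
    and i2: "((\<lambda>t. (h t)\<^sup>2) has_integral integral ?I (\<lambda>t. (h t)\<^sup>2)) ?I"
    by (intro integrable_integral integrable_continuous_real continuous_intros conth conth')+
  have "((\<lambda>t. (h' t)\<^sup>2 + ?G' t - \<beta>\<^sup>2 * (h t)\<^sup>2) has_integral
      (integral ?I (\<lambda>t. (h' t)\<^sup>2) + 0 - \<beta>\<^sup>2 * integral ?I (\<lambda>t. (h t)\<^sup>2))) ?I"
    by (intro has_integral_add has_integral_diff has_integral_mult_right i1 i2 G)
  moreover have "(h' t)\<^sup>2 + ?G' t - \<beta>\<^sup>2 * (h t)\<^sup>2 = (h' t + T t * h t)\<^sup>2" for t
    by (simp add: power2_eq_square algebra_simps)
  ultimately have "((\<lambda>t. (h' t + T t * h t)\<^sup>2) has_integral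
      (integral ?I (\<lambda>t. (h' t)\<^sup>2) + 0 - \<beta>\<^sup>2 * integral ?I (\<lambda>t. (h t)\<^sup>2))) ?I"
    by simp
  from has_integral_nonneg[OF this]
  have "0 \<le> integral ?I (\<lambda>t. (h' t)\<^sup>2) - \<beta>\<^sup>2 * integral ?I (\<lambda>t. (h t)\<^sup>2)" by simp
  moreover have "\<beta>\<^sup>2 = z * (4 * pi\<^sup>2)" using z by (simp add: \<beta>_def power_mult_distrib)
  ultimately show "z * (4 * pi\<^sup>2 * integral ?I (\<lambda>t. (h t)\<^sup>2)) \<le> integral ?I (\<lambda>t. (h' t)\<^sup>2)"
    by (simp add: mult.assoc)
qed

lemma integral_period_shift:
  fixes g :: "real \<Rightarrow> real"
  assumes cont: "continuous_on UNIV g" and per: "\<And>t. g (t + 1) = g t"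
  shows "integral {a..a+1} g = integral {0..1} g"
proof -
  have nat: "g (t + real n) = g t" for t n
  proof (induction n)
    case (Suc n)
    have "g (t + real (Suc n)) = g ((t + real n) + 1)" by (simp add: algebra_simps)
    then show ?case using per Suc by simp
  qed simp
  have int: "g (t + of_int n) = g t" for t n
  proof (cases "n \<ge> 0")
    case False
    then show ?thesis using nat[of "t + of_int n" "nat (- n)"] by simp
  qed (use nat[of t "nat n"] in simp)
  have shift: "integral {b + of_int n..c + of_int n} g = integral {b..c} g" for b c n
    using integral_shift_real_ivl[of "b + of_int n" "of_int n" "c + of_int n" g] int by simp
  define s where "s = frac a"
  have s: "0 \<le> s" "s \<le> 1" "a = s + of_int \<lfloor>a\<rfloor>" by (auto simp: s_def frac_def) linarith+
  have i: "g integrable_on {b..c}" for b c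
    using cont continuous_on_subset by (intro integrable_continuous_real) blast
  have "integral {a..a+1} g = integral {s..s+1} g"
    using shift[of s "\<lfloor>a\<rfloor>" "s + 1"] s(3) by (simp add: algebra_simps)
  also have "\<dots> = integral {s..1} g + integral {1..s+1} g"
    using s by (intro Henstock_Kurzweil_Integration.integral_combine[symmetric] i) auto
  also have "integral {1..s+1} g = integral {0..s} g" using shift[of 0 1 s] by simp
  also have "integral {s..1} g + integral {0..s} g = integral {0..1} g"
    using s Henstock_Kurzweil_Integration.integral_combine[OF s(1,2) i] by simp
  finally show ?thesis .
qed

text \<open>The constant is sharp, and it is what produces the threshold \<open>2\<pi>\<close>. A \<open>1\<close>-periodic function
  takes equal values at some \<open>a\<close> and \<open>a + 1/2\<close>; subtracting this value leaves a function
  vanishing at both ends of two intervals of length \<open>1/2\<close>, where the Dirichlet inequality holds with the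
  same constant.\<close>

lemma wirtinger_periodic:
  fixes f f' :: "real \<Rightarrow> real"
  assumes f: "\<And>t. (f has_real_derivative f' t) (at t)" and cont: "continuous_on UNIV f'"
    and per: "\<And>t. f (t + 1) = f t" and mean: "integral {0..1} f = 0"
  shows "4 * pi\<^sup>2 * integral {0..1} (\<lambda>t. (f t)\<^sup>2) \<le> integral {0..1} (\<lambda>t. (f' t)\<^sup>2)"
proof -
  have contf: "continuous_on S f" for S
    using f by (meson DERIV_isCont continuous_at_imp_continuous_on)
  have contf': "continuous_on S f'" for S using cont continuous_on_subset by blast
  have per': "f' (t + 1) = f' t" for t
  proof -
    have "((\<lambda>t. f (t + 1)) has_real_derivative f' (t + 1)) (at t)"
      using f[of "t + 1"] by (simp add: DERIV_shift)
    then show ?thesis using f[of t] per by (simp add: DERIV_unique)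
  qed
  have "\<exists>a\<ge>0. a \<le> 1/2 \<and> f a - f (a + 1/2) = 0"
  proof -
    have c: "continuous_on {0..1/2} (\<lambda>t. f t - f (t + 1/2))"
      by (intro continuous_intros continuous_on_compose2[OF contf[of UNIV]]) auto
    have e: "f (1/2) - f (1/2 + 1/2) = - (f 0 - f (0 + 1/2))" using per[of 0] by simp
    show ?thesis
    proof (cases "f 0 - f (0 + 1/2) \<le> 0")
      case True
      then show ?thesis using e IVT'[OF _ _ _ c, of 0] by auto
    next
      case False
      then show ?thesis using e IVT2'[OF _ _ _ c, of 0] by auto
    qed
  qed
  then obtain a where a: "f (a + 1/2) = f a" by (metis eq_iff_diff_eq_0)
  define h where "h t = f t - f a" for t
  have h: "(h has_real_derivative f' t) (at t)" for t
    unfolding h_def by (auto intro!: derivative_eq_intros f)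
  have z: "h a = 0" "h (a + 1/2) = 0" "h (a + 1/2 + 1/2) = 0"
    using a per[of a] by (auto simp: h_def add.commute)
  have conth: "continuous_on S h" for S unfolding h_def[abs_def] by (intro continuous_intros contf)
  have comb: "integral {a..a+1} g = integral {a..a+1/2} g + integral {a+1/2..a+1/2+1/2} g"
    if "continuous_on UNIV g" for g :: "real \<Rightarrow> real"
  proof -
    have "g integrable_on {b..c}" for b c
      using that continuous_on_subset by (intro integrable_continuous_real) blast
    then show ?thesis
      using Henstock_Kurzweil_Integration.integral_combine[of a "a + 1/2" "a + 1" g] by (simp add: add.commute)
  qed
  have "4 * pi\<^sup>2 * integral {0..1} (\<lambda>t. (h t)\<^sup>2) \<le> integral {0..1} (\<lambda>t. (f' t)\<^sup>2)"
  proof -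
    have "integral {0..1} (\<lambda>t. (h t)\<^sup>2) = integral {a..a+1} (\<lambda>t. (h t)\<^sup>2)"
      using per by (intro integral_period_shift[symmetric] continuous_intros conth) (simp add: h_def)
    moreover have "integral {0..1} (\<lambda>t. (f' t)\<^sup>2) = integral {a..a+1} (\<lambda>t. (f' t)\<^sup>2)"
      using per' by (intro integral_period_shift[symmetric] continuous_intros contf') simp
    moreover have c: "continuous_on UNIV (\<lambda>t. (h t)\<^sup>2)" "continuous_on UNIV (\<lambda>t. (f' t)\<^sup>2)"
      by (intro continuous_intros conth contf')+
    ultimately show ?thesis
      unfolding comb[OF c(1)] comb[OF c(2)]
      using add_mono[OF wirtinger_dirichlet[OF h cont z(1,2)] wirtinger_dirichlet[OF h cont z(2,3)]]
      by (simp only: distrib_left)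
  qed
  moreover have "integral {0..1} (\<lambda>t. (f t)\<^sup>2) \<le> integral {0..1} (\<lambda>t. (h t)\<^sup>2)"
  proof -
    have i: "f integrable_on {0..1}" "(\<lambda>t. (f t)\<^sup>2) integrable_on {0..1}"
      by (intro integrable_continuous_real continuous_intros contf)+
    have "((\<lambda>t. (f t)\<^sup>2 - 2 * f a * f t + (f a)\<^sup>2) has_integral
        (integral {0..1} (\<lambda>t. (f t)\<^sup>2) - 2 * f a * integral {0..1} f + (f a)\<^sup>2)) {0..1}"
      using has_integral_const_real[of "(f a)\<^sup>2" 0 1]
      by (intro has_integral_add has_integral_diff has_integral_mult_right integrable_integral i) simp
    moreover have "(f t)\<^sup>2 - 2 * f a * f t + (f a)\<^sup>2 = (h t)\<^sup>2" for t
      by (simp add: h_def power2_eq_square algebra_simps)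
    ultimately have "integral {0..1} (\<lambda>t. (h t)\<^sup>2) = integral {0..1} (\<lambda>t. (f t)\<^sup>2) + (f a)\<^sup>2"
      using mean by (simp add: integral_unique)
    then show ?thesis by simp
  qed
  ultimately show ?thesis
    by (meson mult_left_mono order_trans zero_le_power2 mult_nonneg_nonneg zero_le_numeral)
qed

definition fibre_mean :: "(real^3 \<Rightarrow> real) \<Rightarrow> real^3 \<Rightarrow> real" where
  "fibre_mean F x = integral {0..1} (\<lambda>t. F (x + z_shift t))"

lemma per_smooth_on_fibre:
  assumes "per_smooth f"
  shows "((\<lambda>t. f (x + z_shift t)) has_real_derivative partial_deriv 3 f (x + z_shift t)) (at t)"
    and "continuous_on S (\<lambda>t. f (x + z_shift t))"
    and "f (x + z_shift (t + 1)) = f (x + z_shift t)"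
proof -
  show "((\<lambda>t. f (x + z_shift t)) has_real_derivative partial_deriv 3 f (x + z_shift t)) (at t)"
    using smooth_along_line[OF per_smoothD(1)[OF assms]]
    by (simp add: has_real_derivative_iff_has_vector_derivative)
  show "continuous_on S (\<lambda>t. f (x + z_shift t))"
    by (intro continuous_on_compose2[OF per_smooth_continuous[OF assms, of UNIV]] continuous_intros) auto
  have "f (x + z_shift (t + 1)) = f ((x + z_shift t) + z_shift 1)"
    by (simp add: scaleR_left_distrib add.assoc)
  then show "f (x + z_shift (t + 1)) = f (x + z_shift t)"
    using per_smoothD(2)[OF assms] by (simp only: z_periodic_def)
qed

lemma fibre_mean_partial_deriv_3:
  assumes "per_smooth f"
  shows "fibre_mean (partial_deriv 3 f) x = 0"
proof -
  have "((\<lambda>t. partial_deriv 3 f (x + z_shift t)) has_integral f (x + z_shift 1) - f (x + z_shift 0)) {0..1}"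
    by (rule fundamental_theorem_of_calculus) (auto intro: smooth_along_line per_smoothD(1)[OF assms])
  then show ?thesis using per_smoothD(2)[OF assms] by (simp add: z_periodic_def fibre_mean_def integral_unique)
qed

lemma fibre_wirtinger:
  assumes f: "per_smooth f" and mean: "fibre_mean f x = 0"
  shows "4 * pi\<^sup>2 * fibre_mean (\<lambda>x. (f x)\<^sup>2) x \<le> fibre_mean (\<lambda>x. (partial_deriv 3 f x)\<^sup>2) x"
  unfolding fibre_mean_def
  using mean f
  by (intro wirtinger_periodic per_smooth_on_fibre[OF f])
     (auto simp: fibre_mean_def intro!: per_smooth_on_fibre)

lemma J_fibre_mean:
  assumes "R > 0" "k > 0" "per_smooth F"
  shows "J R k (fibre_mean F) = J R k F"
  using J_fibre_average[OF assms(1,2) per_smooth_continuous[OF assms(3)] per_smoothD(2)[OF assms(3)]]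
  by (simp add: fibre_mean_def[abs_def])

lemma continuous_on_fibre_mean: "per_smooth F \<Longrightarrow> continuous_on UNIV (fibre_mean F)"
  unfolding fibre_mean_def[abs_def] by (intro continuous_on_fibre_integral per_smooth_continuous)

lemma J_wirtinger:
  assumes R: "R > 0" "k > 0" and f: "per_smooth f" and mean: "\<And>x. fibre_mean f x = 0"
  shows "4 * pi\<^sup>2 * J R k (\<lambda>x. (f x)\<^sup>2) \<le> J R k (\<lambda>x. (partial_deriv 3 f x)\<^sup>2)"
proof -
  have s: "per_smooth (\<lambda>x. (f x)\<^sup>2)" "per_smooth (\<lambda>x. (partial_deriv 3 f x)\<^sup>2)" using f by auto
  have "J R k (\<lambda>x. 4 * pi\<^sup>2 * fibre_mean (\<lambda>x. (f x)\<^sup>2) x) \<le> J R k (fibre_mean (\<lambda>x. (partial_deriv 3 f x)\<^sup>2))"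
    using fibre_wirtinger[OF f mean] by (intro J_mono R continuous_intros continuous_on_fibre_mean s)
  then show ?thesis by (simp only: J_cmult J_fibre_mean[OF R s(1)] J_fibre_mean[OF R s(2)])
qed

text \<open>If \<open>v\<close> has mean zero on every fibre, then only the oscillation of \<open>q\<close> on the fibres is seen by \<open>v\<close>,
  and both factors are controlled by their vertical derivatives.\<close>

lemma J_pairing:
  assumes R: "R > 0" "k > 0" and q: "per_smooth q" and v: "per_smooth v"
    and mean: "\<And>x. fibre_mean v x = 0" and \<mu>: "\<mu> > 0"
  shows "\<bar>J R k (\<lambda>x. q x * v x)\<bar> \<le>
    \<mu> / 2 * J R k (\<lambda>x. (partial_deriv 3 q x)\<^sup>2) + 1 / (2 * \<mu>) * J R k (\<lambda>x. (partial_deriv 3 v x)\<^sup>2)"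
proof -
  let ?b = "\<lambda>x. \<mu> / 2 * fibre_mean (\<lambda>x. (partial_deriv 3 q x)\<^sup>2) x + 1 / (2 * \<mu>) * fibre_mean (\<lambda>x. (partial_deriv 3 v x)\<^sup>2) x"
  have s: "per_smooth (\<lambda>x. q x * v x)" "per_smooth (\<lambda>x. (partial_deriv 3 q x)\<^sup>2)"
    "per_smooth (\<lambda>x. (partial_deriv 3 v x)\<^sup>2)" using q v by auto
  have point: "\<bar>fibre_mean (\<lambda>x. q x * v x) x\<bar> \<le> ?b x" for x
  proof -
    define c where "c = fibre_mean q x"
    let ?Q = "\<lambda>t. q (x + z_shift t)" and ?V = "\<lambda>t. v (x + z_shift t)"
    let ?q = "\<lambda>x. q x - c"
    have q': "per_smooth ?q" using q by auto
    have iq: "?Q integrable_on {0..1}" and iv: "?V integrable_on {0..1}"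
      and iqv: "(\<lambda>t. ?Q t * ?V t) integrable_on {0..1}"
      and iq2: "(\<lambda>t. (?Q t - c)\<^sup>2) integrable_on {0..1}" and iv2: "(\<lambda>t. (?V t)\<^sup>2) integrable_on {0..1}"
      by (intro integrable_continuous_real continuous_intros per_smooth_on_fibre(2) q v)+
    have "fibre_mean ?q x = integral {0..1} (\<lambda>t. ?Q t - c)" by (simp add: fibre_mean_def)
    also have "\<dots> = integral {0..1} ?Q - integral {0..1} (\<lambda>t::real. c)"
      by (rule integral_diff[OF iq]) (rule integrable_const_ivl)
    also have "\<dots> = 0" by (simp add: c_def fibre_mean_def)
    finally have q0: "fibre_mean ?q x = 0" .
    have "fibre_mean (\<lambda>x. q x * v x) x = integral {0..1} (\<lambda>t. ?Q t * ?V t) - c * integral {0..1} ?V"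
      using mean[of x] by (simp add: fibre_mean_def)
    also have "\<dots> = integral {0..1} (\<lambda>t. ?Q t * ?V t) - integral {0..1} (\<lambda>t. c * ?V t)" by simp
    also have "\<dots> = integral {0..1} (\<lambda>t. ?Q t * ?V t - c * ?V t)"
      by (intro integral_diff[symmetric] iqv integrable_continuous_real continuous_intros per_smooth_on_fibre(2) v)
    also have "norm \<dots> \<le> integral {0..1} (\<lambda>t. \<mu> / 2 * (?Q t - c)\<^sup>2 + 1 / (2 * \<mu>) * (?V t)\<^sup>2)"
    proof (rule integral_norm_bound_integral)
      show "(\<lambda>t. ?Q t * ?V t - c * ?V t) integrable_on {0..1}"
        "(\<lambda>t. \<mu> / 2 * (?Q t - c)\<^sup>2 + 1 / (2 * \<mu>) * (?V t)\<^sup>2) integrable_on {0..1}"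
        by (intro integrable_continuous_real continuous_intros per_smooth_on_fibre(2) q v)+
      fix t
      have y: "\<bar>a * b\<bar> \<le> \<mu> / 2 * a\<^sup>2 + 1 / (2 * \<mu>) * b\<^sup>2" for a b :: real
      proof -
        have "0 \<le> (\<mu> * \<bar>a\<bar> - \<bar>b\<bar>)\<^sup>2" by simp
        then have "2 * \<mu> * (\<bar>a\<bar> * \<bar>b\<bar>) \<le> \<mu>\<^sup>2 * a\<^sup>2 + b\<^sup>2"
          by (simp add: power2_diff power_mult_distrib)
        then show ?thesis using \<mu> by (simp add: abs_mult divide_simps power2_eq_square algebra_simps)
      qed
      show "norm (?Q t * ?V t - c * ?V t) \<le> \<mu> / 2 * (?Q t - c)\<^sup>2 + 1 / (2 * \<mu>) * (?V t)\<^sup>2"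
        using y[of "?Q t - c" "?V t"] by (simp add: left_diff_distrib)
    qed
    also have "\<dots> = \<mu> / 2 * fibre_mean (\<lambda>x. (?q x)\<^sup>2) x + 1 / (2 * \<mu>) * fibre_mean (\<lambda>x. (v x)\<^sup>2) x"
      unfolding fibre_mean_def
      by (subst integral_add) (intro integrable_continuous_real continuous_intros per_smooth_on_fibre(2) q v | simp only: integral_mult_right)+
    also have "\<dots> \<le> ?b x"
    proof -
      have pi: "1 \<le> 4 * pi\<^sup>2"
      proof -
        have "1 \<le> pi * pi" using pi_ge_two mult_mono[of 1 pi 1 pi] by simp
        then show ?thesis by (simp add: power2_eq_square)
      qed
      have le: "fibre_mean (\<lambda>x. (g x)\<^sup>2) x \<le> fibre_mean (\<lambda>x. (partial_deriv 3 g x)\<^sup>2) x"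
        if "per_smooth g" "fibre_mean g x = 0" for g
      proof -
        have "0 \<le> fibre_mean (\<lambda>x. (g x)\<^sup>2) x"
          unfolding fibre_mean_def by (intro integral_nonneg integrable_continuous_real continuous_intros per_smooth_on_fibre(2) that) simp
        then have "fibre_mean (\<lambda>x. (g x)\<^sup>2) x \<le> 4 * pi\<^sup>2 * fibre_mean (\<lambda>x. (g x)\<^sup>2) x"
          using mult_right_mono[OF pi] by fastforce
        then show ?thesis using fibre_wirtinger[OF that] by simp
      qed
      have dq: "partial_deriv 3 ?q = partial_deriv 3 q"
        using per_smoothD(1)[OF q] by (simp add: smooth_const)
      show ?thesis using le[OF q' q0] le[OF v mean] \<mu> unfolding dq
        by (intro add_mono mult_left_mono) auto
    qed
    finally show ?thesis by simp
  qed
  have "\<bar>J R k (\<lambda>x. q x * v x)\<bar> = \<bar>J R k (fibre_mean (\<lambda>x. q x * v x))\<bar>"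
    by (simp only: J_fibre_mean[OF R s(1)])
  also have "\<dots> \<le> J R k (\<lambda>x. \<bar>fibre_mean (\<lambda>x. q x * v x) x\<bar>)"
    by (intro J_abs R continuous_on_fibre_mean s)
  also have "\<dots> \<le> J R k ?b"
    using point by (intro J_mono R continuous_intros continuous_on_fibre_mean s)
  also have "\<dots> = \<mu> / 2 * J R k (fibre_mean (\<lambda>x. (partial_deriv 3 q x)\<^sup>2)) +
      1 / (2 * \<mu>) * J R k (fibre_mean (\<lambda>x. (partial_deriv 3 v x)\<^sup>2))"
    by (subst J_add) (intro R continuous_intros continuous_on_fibre_mean s | simp only: J_cmult)+
  finally show ?thesis by (simp only: J_fibre_mean[OF R s(2)] J_fibre_mean[OF R s(3)])
qed

section \<open>Divergence-free fields\<close>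

text \<open>Young's inequality with the powers of the cutoff distributed over the two factors.\<close>

lemma J_young:
  assumes R: "R > 0" and pos: "k > 0" "m > 0" "n > 0" and mn: "m + n \<le> 2 * k"
    and c: "continuous_on UNIV f" "continuous_on UNIV g" and \<delta>: "\<delta> > 0"
  shows "J R k (\<lambda>x. \<bar>f x\<bar> * \<bar>g x\<bar>) \<le> \<delta> * J R m (\<lambda>x. (f x)\<^sup>2) + 1 / (4 * \<delta>) * J R n (\<lambda>x. (g x)\<^sup>2)"
proof -
  have "J R k (\<lambda>x. \<bar>f x\<bar> * \<bar>g x\<bar>) \<le> J R m (\<lambda>x. \<delta> * (f x)\<^sup>2) + J R n (\<lambda>x. 1 / (4 * \<delta>) * (g x)\<^sup>2)"
  proof (rule J_combine[OF R pos])
    fix x assume s: "0 < cutoff R x" "cutoff R x \<le> 1"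
    let ?s = "cutoff R x"
    define A where "A = ?s ^ m * (\<delta> * (f x)\<^sup>2)"
    define B where "B = ?s ^ n * (1 / (4 * \<delta>) * (g x)\<^sup>2)"
    have AB: "0 \<le> A" "0 \<le> B" using s \<delta> by (auto simp: A_def B_def)
    have "(?s ^ k * (\<bar>f x\<bar> * \<bar>g x\<bar>))\<^sup>2 = ?s ^ (2 * k) * ((f x)\<^sup>2 * (g x)\<^sup>2)"
      by (simp add: power_mult_distrib power_mult[symmetric] mult.commute[of k])
    also have "\<dots> \<le> ?s ^ (m + n) * ((f x)\<^sup>2 * (g x)\<^sup>2)"
      using s mn by (intro mult_right_mono power_decreasing) auto
    also have "\<dots> = 4 * A * B" using \<delta> by (simp add: A_def B_def power_add)
    also have "\<dots> \<le> (A + B)\<^sup>2"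
      using zero_le_power2[of "A - B"] by (simp add: power2_eq_square algebra_simps)
    finally have "?s ^ k * (\<bar>f x\<bar> * \<bar>g x\<bar>) \<le> A + B"
      by (rule power2_le_imp_le) (use AB in simp)
    then show "?s ^ k * (\<bar>f x\<bar> * \<bar>g x\<bar>) \<le> ?s ^ m * (\<delta> * (f x)\<^sup>2) + ?s ^ n * (1 / (4 * \<delta>) * (g x)\<^sup>2)"
      by (simp add: A_def B_def)
  qed (intro continuous_intros c)+
  then show ?thesis by (simp only: J_cmult)
qed

lemma J_sum2:
  fixes F :: "3 \<Rightarrow> 3 \<Rightarrow> real^3 \<Rightarrow> real"
  assumes "R > 0" "k > 0" "\<And>i j. continuous_on UNIV (F i j)"
  shows "J R k (\<lambda>x. \<Sum>i\<in>UNIV. \<Sum>j\<in>UNIV. F i j x) = (\<Sum>i\<in>UNIV. \<Sum>j\<in>UNIV. J R k (F i j))"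
proof -
  have "J R k (\<lambda>x. \<Sum>i\<in>UNIV. \<Sum>j\<in>UNIV. F i j x) = (\<Sum>i\<in>UNIV. J R k (\<lambda>x. \<Sum>j\<in>UNIV. F i j x))"
    by (intro J_sum continuous_on_sum assms)
  then show ?thesis by (simp add: J_sum assms)
qed

text \<open>\<open>\<Sum>\<^sub>i\<^sub>j \<partial>\<^sub>i V\<^sub>j \<partial>\<^sub>j V\<^sub>i\<close> is a divergence if \<open>V\<close> is divergence-free, so the full gradient is
  controlled by the curl up to a term carried by the derivative of the cutoff.\<close>

lemma J_div_curl:
  fixes V :: "3 \<Rightarrow> real^3 \<Rightarrow> real"
  assumes R: "R > 0" and k: "k > 0" and V: "\<And>i. per_smooth (V i)"
    and div: "\<And>x. (\<Sum>i\<in>UNIV. partial_deriv i (V i) x) = 0"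
  shows "J R (k + 2) (\<lambda>x. \<Sum>i\<in>UNIV. \<Sum>j\<in>UNIV. (partial_deriv i (V j) x)\<^sup>2) \<le>
    J R (k + 2) (\<lambda>x. \<Sum>i\<in>UNIV. \<Sum>j\<in>UNIV. (partial_deriv i (V j) x - partial_deriv j (V i) x)\<^sup>2) +
    12 * real (k + 2)^2 / R\<^sup>2 * J R k (\<lambda>x. \<Sum>j\<in>UNIV. (V j x)\<^sup>2)"
    (is "?G \<le> ?A + _ * ?B")
proof -
  define K where "K = real (k + 2)"
  have K: "K > 0" by (simp add: K_def)
  have k2: "k + 2 > 0" "k + 1 > 0" by auto
  define D where "D i j = partial_deriv i (V j)" for i j
  have D: "per_smooth (D i j)" for i j unfolding D_def by (rule per_smooth_intros(8)[OF V])
  have c: "continuous_on UNIV (V j)" "continuous_on UNIV (D i j)" "continuous_on UNIV (partial_deriv l (D i j))" for i j l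
    by (rule per_smooth_continuous V D per_smooth_intros(8))+
  have G: "?G = (\<Sum>i\<in>UNIV. \<Sum>j\<in>UNIV. J R (k + 2) (\<lambda>x. (D i j x)\<^sup>2))"
    unfolding D_def[symmetric] by (intro J_sum2 R k2 continuous_intros c)
  have B: "?B = (\<Sum>j\<in>UNIV. J R k (\<lambda>x. (V j x)\<^sup>2))"
    by (intro J_sum R k continuous_intros c)
  define T where "T = (\<Sum>i\<in>UNIV. \<Sum>j\<in>UNIV. J R (k + 2) (\<lambda>x. D j i x * D i j x))"
  have "?G = J R (k + 2) (\<lambda>x. 1/2 * (\<Sum>i\<in>UNIV. \<Sum>j\<in>UNIV. (D i j x - D j i x)\<^sup>2) + (\<Sum>i\<in>UNIV. \<Sum>j\<in>UNIV. D j i x * D i j x))"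
    unfolding D_def[symmetric] sum_3 by (simp add: power2_eq_square algebra_simps)
  also have "\<dots> = 1/2 * ?A + T"
  proof -
    have "continuous_on UNIV (\<lambda>x. 1/2 * (\<Sum>i\<in>UNIV. \<Sum>j\<in>UNIV. (D i j x - D j i x)\<^sup>2))"
      "continuous_on UNIV (\<lambda>x. \<Sum>i\<in>UNIV. \<Sum>j\<in>UNIV. D j i x * D i j x)"
      by (intro continuous_intros c)+
    note add = J_add[OF R k2(1) this]
    show ?thesis
      unfolding D_def[symmetric] T_def add J_cmult J_sum2[OF R k2(1) continuous_on_mult[OF c(2) c(2)]] ..
  qed
  finally have GT: "?G = 1/2 * ?A + T" .
  \<comment> \<open>Young's inequality with weight \<open>R / (4 K)\<close> leaves half of the gradient, which is absorbed.\<close>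
  have scale: "2 * K / R * (R / (4 * K) * X + 1 / (4 * (R / (4 * K))) * Y) = 1/2 * X + 2 * K\<^sup>2 / R\<^sup>2 * Y" for X Y
    using R K by (simp add: divide_simps power2_eq_square)
  have "T + (\<Sum>i\<in>UNIV. \<Sum>j\<in>UNIV. J R (k + 2) (\<lambda>x. partial_deriv i (D j i) x * V j x)) \<le>
      (\<Sum>i\<in>UNIV. \<Sum>j\<in>UNIV. 2 * K / R * J R (k + 1) (\<lambda>x. \<bar>D j i x\<bar> * \<bar>V j x\<bar>))"
    unfolding T_def sum.distrib[symmetric]
  proof (intro sum_mono)
    fix i j
    show "J R (k + 2) (\<lambda>x. D j i x * D i j x) + J R (k + 2) (\<lambda>x. partial_deriv i (D j i) x * V j x)
        \<le> 2 * K / R * J R (k + 1) (\<lambda>x. \<bar>D j i x\<bar> * \<bar>V j x\<bar>)"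
      using J_parts_bound[OF R k2(2) D V, of j i i j] by (simp add: D_def K_def)
  qed
  also have "(\<Sum>i\<in>UNIV. \<Sum>j\<in>UNIV. J R (k + 2) (\<lambda>x. partial_deriv i (D j i) x * V j x)) = 0"
  proof -
    have "(\<Sum>i\<in>UNIV. partial_deriv i (D j i) x) = 0" for j x
    proof -
      have "(\<lambda>x. \<Sum>i\<in>UNIV. partial_deriv i (V i) x) = (\<lambda>x. 0)" using div by auto
      then have "partial_deriv j (\<lambda>x. \<Sum>i\<in>UNIV. partial_deriv i (V i) x) x = 0" by simp
      then show ?thesis
        using V per_smoothD(1) by (simp add: smooth_partial_deriv D_def partial_deriv_commute[of _ _ j])
    qed
    then have "J R (k + 2) (\<lambda>x. \<Sum>i\<in>UNIV. partial_deriv i (D j i) x * V j x) = 0" for j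
      by (simp add: sum_distrib_right[symmetric])
    then have "(\<Sum>i\<in>UNIV. J R (k + 2) (\<lambda>x. partial_deriv i (D j i) x * V j x)) = 0" for j
      by (subst (asm) J_sum) (auto intro!: R continuous_intros c)
    then show ?thesis by (subst sum.swap) simp
  qed
  also have "(\<Sum>i\<in>UNIV. \<Sum>j\<in>UNIV. 2 * K / R * J R (k + 1) (\<lambda>x. \<bar>D j i x\<bar> * \<bar>V j x\<bar>)) \<le>
      (\<Sum>i\<in>UNIV. \<Sum>j\<in>UNIV. 1/2 * J R (k + 2) (\<lambda>x. (D j i x)\<^sup>2) + 2 * K\<^sup>2 / R\<^sup>2 * J R k (\<lambda>x. (V j x)\<^sup>2))"
  proof (intro sum_mono)
    fix i j
    have "J R (k + 1) (\<lambda>x. \<bar>D j i x\<bar> * \<bar>V j x\<bar>) \<le>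
        R / (4 * K) * J R (k + 2) (\<lambda>x. (D j i x)\<^sup>2) + 1 / (4 * (R / (4 * K))) * J R k (\<lambda>x. (V j x)\<^sup>2)"
      by (rule J_young) (use R K k c in auto)
    moreover have "0 \<le> 2 * K / R" using R K by simp
    ultimately have "2 * K / R * J R (k + 1) (\<lambda>x. \<bar>D j i x\<bar> * \<bar>V j x\<bar>) \<le>
        2 * K / R * (R / (4 * K) * J R (k + 2) (\<lambda>x. (D j i x)\<^sup>2) + 1 / (4 * (R / (4 * K))) * J R k (\<lambda>x. (V j x)\<^sup>2))"
      by (rule mult_left_mono)
    then
    show "2 * K / R * J R (k + 1) (\<lambda>x. \<bar>D j i x\<bar> * \<bar>V j x\<bar>) \<le>
        1/2 * J R (k + 2) (\<lambda>x. (D j i x)\<^sup>2) + 2 * K\<^sup>2 / R\<^sup>2 * J R k (\<lambda>x. (V j x)\<^sup>2)"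
      unfolding scale .
  qed
  also have "\<dots> = 1/2 * ?G + 6 * K\<^sup>2 / R\<^sup>2 * ?B"
  proof -
    have G': "?G = (\<Sum>i\<in>UNIV. \<Sum>j\<in>UNIV. J R (k + 2) (\<lambda>x. (D j i x)\<^sup>2))"
      unfolding G by (rule sum.swap)
    show ?thesis
      unfolding G' B sum.distrib sum_distrib_left[symmetric] by simp
  qed
  finally have "T \<le> 1/2 * ?G + 6 * K\<^sup>2 / R\<^sup>2 * ?B" by simp
  moreover have "12 * K\<^sup>2 / R\<^sup>2 * ?B = 2 * (6 * K\<^sup>2 / R\<^sup>2 * ?B)" by simp
  ultimately show ?thesis using GT unfolding K_def[symmetric] by linarith
qed

lemma J_lincomb:
  assumes "R > 0" "k > 0" "continuous_on UNIV F" "continuous_on UNIV G"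
  shows "J R k (\<lambda>x. a * F x + b * G x) = a * J R k F + b * J R k G"
  using J_add[OF assms(1,2), of "\<lambda>x. a * F x" "\<lambda>x. b * G x"] assms(3,4)
  by (simp add: J_cmult continuous_on_mult_left)

definition horizontal_sq :: "real^3 \<Rightarrow> real" where
  "horizontal_sq x = (x $ 1)\<^sup>2 + (x $ 2)\<^sup>2"

text \<open>The flux density \<open>r V\<^sup>r\<close>, which unlike \<open>V\<^sup>r\<close> itself is smooth across the axis.\<close>

definition radial_flux :: "(3 \<Rightarrow> real^3 \<Rightarrow> real) \<Rightarrow> real^3 \<Rightarrow> real" where
  "radial_flux V x = x $ 1 * V 1 x + x $ 2 * V 2 x"

lemma radial_flux_eq_sum: "radial_flux V x = (\<Sum>i\<in>UNIV. horizontal i x * V i x)"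
  by (simp add: radial_flux_def horizontal_def sum_3)

lemma per_smooth_radial_flux: "(\<And>i. per_smooth (V i)) \<Longrightarrow> per_smooth (radial_flux V)"
  unfolding radial_flux_def[abs_def] by (intro per_smooth_intros per_smooth_coord) auto

text \<open>A divergence-free field has no flux through vertical cylinders. In integrated form: \<open>g V\<^sup>r\<close>
  integrates to zero for every radial \<open>g\<close>, since \<open>g e\<^sub>r\<close> is the gradient of a compactly supported
  radial function.\<close>

lemma J_radial_flux_zero:
  fixes V :: "3 \<Rightarrow> real^3 \<Rightarrow> real"
  assumes R: "R > 0" and k: "k > 0" and V: "\<And>i. per_smooth (V i)"
    and div: "\<And>x. (\<Sum>i\<in>UNIV. partial_deriv i (V i) x) = 0"
    and g: "continuous_on UNIV g"
  shows "J R k (\<lambda>x. g (horizontal_sq x) * radial_flux V x) = 0"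
proof -
  define \<gamma> where "\<gamma> t = g t * max 0 (1 - t / R\<^sup>2) ^ k" for t
  \<comment> \<open>A primitive of \<open>\<gamma>\<close> that vanishes from \<open>R\<^sup>2\<close> on. Starting at \<open>-1\<close> makes \<open>0\<close>, the value of
    \<open>horizontal_sq\<close> on the axis, an interior point.\<close>
  define \<Gamma> where "\<Gamma> t = integral {-1..t} \<gamma> - integral {-1..R\<^sup>2} \<gamma>" for t
  have c\<gamma>: "continuous_on S \<gamma>" for S
    unfolding \<gamma>_def[abs_def] using R
    by (intro continuous_intros continuous_on_subset[OF g]) auto
  have \<Gamma>': "(\<Gamma> has_real_derivative \<gamma> t) (at t)" if "t \<ge> 0" for t
  proof -
    have "((\<lambda>t. integral {-1..t} \<gamma>) has_real_derivative \<gamma> t) (at t within {-1..t+1})"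
      by (rule integral_has_real_derivative[OF c\<gamma>]) (use that in auto)
    then have "((\<lambda>t. integral {-1..t} \<gamma>) has_real_derivative \<gamma> t) (at t)"
      using that at_within_interior[of t "{-1..t+1}"] by simp
    from DERIV_diff[OF this DERIV_const] show ?thesis unfolding \<Gamma>_def[abs_def] by simp
  qed
  have \<Gamma>0: "\<Gamma> t = 0" if "t \<ge> R\<^sup>2" for t
  proof -
    have "integral {-1..t} \<gamma> = integral {-1..R\<^sup>2} \<gamma> + integral {R\<^sup>2..t} \<gamma>"
    proof (rule Henstock_Kurzweil_Integration.integral_combine[symmetric])
      show "-1 \<le> R\<^sup>2" using zero_le_power2[of R] by linarith
    qed (use that in \<open>auto intro: integrable_continuous_real c\<gamma>\<close>)
    also have "integral {R\<^sup>2..t} \<gamma> = integral {R\<^sup>2..t} (\<lambda>_. 0)"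
      using R k by (intro integral_cong) (auto simp: \<gamma>_def divide_simps)
    finally show ?thesis by (simp add: \<Gamma>_def)
  qed
  define F where "F i x = \<Gamma> (horizontal_sq x) * V i x" for i x
  have nonneg: "horizontal_sq x \<ge> 0" for x by (simp add: horizontal_sq_def)
  have n: "((\<lambda>x::real^3. x $ i) has_derivative (\<lambda>v. v $ i)) (at x)" for i x
    by (rule bounded_linear_imp_has_derivative[OF bounded_linear_vec_nth])
  have hs: "(horizontal_sq has_derivative (\<lambda>v. 2 * (x $ 1 * v $ 1 + x $ 2 * v $ 2))) (at x)" for x
    unfolding horizontal_sq_def[abs_def]
    by (rule has_derivative_eq_rhs, (rule derivative_intros n)+) (auto simp: algebra_simps)
  have \<Gamma>hs: "((\<lambda>x. \<Gamma> (horizontal_sq x)) has_derivative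
      (\<lambda>v. \<gamma> (horizontal_sq x) * (2 * (x $ 1 * v $ 1 + x $ 2 * v $ 2)))) (at x)" for x
    using has_derivative_compose[OF hs, of \<Gamma> "\<lambda>h. \<gamma> (horizontal_sq x) * h" x] \<Gamma>'[OF nonneg, of x]
    by (simp add: has_field_derivative_def)
  have dF: "(F i has_derivative (\<lambda>v. \<Gamma> (horizontal_sq x) * frechet_derivative (V i) (at x) v +
      \<gamma> (horizontal_sq x) * (2 * (x $ 1 * v $ 1 + x $ 2 * v $ 2)) * V i x)) (at x)" for i x
    unfolding F_def[abs_def]
    by (rule has_derivative_mult[OF \<Gamma>hs smooth_has_derivative[OF per_smoothD(1)[OF V]]])
  have h: "x $ 1 * axis i (1::real) $ 1 + x $ 2 * axis i (1::real) $ 2 = horizontal i x" for x :: "real^3" and i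
    using exhaust_3[of i] by (auto simp: axis_def horizontal_def)
  have D: "partial_deriv i (F i) = (\<lambda>x. \<Gamma> (horizontal_sq x) * partial_deriv i (V i) x +
      2 * \<gamma> (horizontal_sq x) * (horizontal i x * V i x))" for i
    by (rule ext, subst partial_deriv_eqI[OF dF]) (simp add: h partial_deriv_def algebra_simps)
  have chs: "continuous_on UNIV horizontal_sq"
    unfolding horizontal_sq_def[abs_def] by (intro continuous_intros)
  have c\<Gamma>: "continuous_on UNIV (\<lambda>x. \<Gamma> (horizontal_sq x))"
    using \<Gamma>hs by (meson continuous_at_imp_continuous_on has_derivative_continuous)
  have cD: "continuous_on UNIV (partial_deriv i (F i))" for i
    unfolding D
    by (intro continuous_intros c\<Gamma> continuous_on_compose2[OF c\<gamma>[of UNIV] chs]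
          per_smooth_continuous V per_smooth_intros(8) per_smooth_horizontal) auto
  have vF: "vanishes_beyond R (F i)" for i
    unfolding vanishes_beyond_def
  proof (intro allI impI)
    fix x :: "real^3" assume "R \<le> \<bar>x $ 1\<bar> \<or> R \<le> \<bar>x $ 2\<bar>"
    then have "R\<^sup>2 \<le> (x $ 1)\<^sup>2 \<or> R\<^sup>2 \<le> (x $ 2)\<^sup>2"
      using R abs_le_square_iff[of R "x $ 1"] abs_le_square_iff[of R "x $ 2"] by auto
    then have "R\<^sup>2 \<le> horizontal_sq x"
      unfolding horizontal_sq_def using zero_le_power2[of "x $ 1"] zero_le_power2[of "x $ 2"] by linarith
    then show "F i x = 0" by (simp add: F_def \<Gamma>0)
  qed
  have zero: "slab_integral (partial_deriv i (F i)) = 0" for i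
  proof (rule slab_integral_partial_deriv[OF vF _ _ cD])
    show "z_periodic (F i)"
      using per_smoothD(2)[OF V, of i] by (simp add: z_periodic_def F_def horizontal_sq_def axis_def)
    show "F i differentiable at x" for x using dF by (auto simp: differentiable_def)
  qed
  have int: "partial_deriv i (F i) integrable_on slab 0 1" for i
  proof (rule slab_integrable[OF _ cD])
    show "vanishes_beyond (R + 1) (partial_deriv i (F i))"
      unfolding vanishes_beyond_def D
    proof (intro allI impI)
      fix x :: "real^3" assume "R + 1 \<le> \<bar>x $ 1\<bar> \<or> R + 1 \<le> \<bar>x $ 2\<bar>"
      then have "R \<le> \<bar>x $ 1\<bar> \<or> R \<le> \<bar>x $ 2\<bar>" by auto
      then have "R\<^sup>2 \<le> (x $ 1)\<^sup>2 \<or> R\<^sup>2 \<le> (x $ 2)\<^sup>2"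
        using R abs_le_square_iff[of R "x $ 1"] abs_le_square_iff[of R "x $ 2"] by auto
      then have "R\<^sup>2 \<le> horizontal_sq x"
        unfolding horizontal_sq_def using zero_le_power2[of "x $ 1"] zero_le_power2[of "x $ 2"] by linarith
      moreover from this have "\<gamma> (horizontal_sq x) = 0" using R k by (auto simp: \<gamma>_def divide_simps)
      ultimately show "\<Gamma> (horizontal_sq x) * partial_deriv i (V i) x +
          2 * \<gamma> (horizontal_sq x) * (horizontal i x * V i x) = 0" by (simp add: \<Gamma>0)
    qed
  qed
  have "0 = (\<Sum>i\<in>UNIV. slab_integral (partial_deriv i (F i)))" by (simp add: zero)
  also have "\<dots> = slab_integral (\<lambda>x. \<Sum>i\<in>UNIV. partial_deriv i (F i) x)"
    unfolding slab_integral_def using int by (intro integral_sum[symmetric]) auto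
  also have "(\<lambda>x. \<Sum>i\<in>UNIV. partial_deriv i (F i) x) =
      (\<lambda>x. 2 * (cutoff R x ^ k * (g (horizontal_sq x) * radial_flux V x)))"
  proof
    fix x
    have "(\<Sum>i\<in>UNIV. partial_deriv i (F i) x) = \<Gamma> (horizontal_sq x) * (\<Sum>i\<in>UNIV. partial_deriv i (V i) x)
        + 2 * \<gamma> (horizontal_sq x) * radial_flux V x"
      unfolding D radial_flux_eq_sum sum.distrib sum_distrib_left ..
    then show "(\<Sum>i\<in>UNIV. partial_deriv i (F i) x) = 2 * (cutoff R x ^ k * (g (horizontal_sq x) * radial_flux V x))"
      unfolding div by (simp add: \<gamma>_def cutoff_def horizontal_sq_def)
  qed
  also have "slab_integral \<dots> = 2 * J R k (\<lambda>x. g (horizontal_sq x) * radial_flux V x)"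
    unfolding J_def by (rule slab_integral_cmult)
  finally show ?thesis by simp
qed

section \<open>The Liouville scheme\<close>

text \<open>Iterating the doubling inequality \<open>n\<close> times gains \<open>8\<^sup>-\<^sup>n\<close>, against which the quadratic growth loses
  only \<open>4\<^sup>n\<close>; what remains is the geometric series of the constants.\<close>

lemma bounded_of_doubling:
  fixes H :: "real \<Rightarrow> real"
  assumes nonneg: "\<And>R. R \<ge> 1 \<Longrightarrow> 0 \<le> H R"
    and mono: "\<And>R S. 1 \<le> R \<Longrightarrow> R \<le> S \<Longrightarrow> H R \<le> H S"
    and growth: "\<And>R. R \<ge> 1 \<Longrightarrow> H R \<le> A * R\<^sup>2"
    and doubling: "\<And>R. R \<ge> R0 \<Longrightarrow> H R \<le> 1/8 * H (2 * R) + C"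
  shows "\<exists>B. \<forall>R\<ge>1. H R \<le> B"
proof -
  define R1 where "R1 = max 1 R0"
  define D where "D = \<bar>C\<bar>"
  have it: "H R \<le> (1/8) ^ n * H (2 ^ n * R) + 2 * D" if R: "R \<ge> R1" for R n
  proof -
    have *: "H R \<le> (1/8) ^ n * H (2 ^ n * R) + (\<Sum>i<n. (1/8) ^ i) * D" for n
    proof (induction n)
      case (Suc n)
      have "1 * R \<le> 2 ^ n * R" using R by (intro mult_right_mono) (auto simp: R1_def)
      moreover have "R0 \<le> 1 * R" using R by (simp add: R1_def)
      ultimately have "2 ^ n * R \<ge> R0" by (rule order_trans[rotated])
      from doubling[OF this] have "H (2 ^ n * R) \<le> 1/8 * H (2 * (2 ^ n * R)) + D"
        by (simp add: D_def)
      then have "(1/8) ^ n * H (2 ^ n * R) \<le> (1/8) ^ n * (1/8 * H (2 * (2 ^ n * R)) + D)"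
        by (intro mult_left_mono) auto
      with Suc show ?case by (simp add: algebra_simps)
    qed simp
    have "(\<Sum>i<n. (1/8::real) ^ i) = (1 - (1/8) ^ n) / (1 - 1/8)" by (simp add: sum_gp_strict)
    also have "\<dots> \<le> 1 / (1 - 1/8)" by (intro divide_right_mono) auto
    finally have "(\<Sum>i<n. (1/8::real) ^ i) \<le> 2" by simp
    then have "(\<Sum>i<n. (1/8) ^ i) * D \<le> 2 * D" by (intro mult_right_mono) (auto simp: D_def)
    with *[of n] show ?thesis by linarith
  qed
  have le: "H R \<le> 2 * D" if R: "R \<ge> R1" for R
  proof -
    have "H R \<le> (1/2) ^ n * (A * R\<^sup>2) + 2 * D" for n
    proof -
      have "2 ^ n * R \<ge> 1 * 1" using R by (intro mult_mono) (auto simp: R1_def)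
      then have "(1/8) ^ n * H (2 ^ n * R) \<le> (1/8) ^ n * (A * (2 ^ n * R)\<^sup>2)"
        by (intro mult_left_mono growth) auto
      also have "\<dots> = (1/2) ^ n * (A * R\<^sup>2)"
      proof -
        have "(1/8::real) ^ n * (2 ^ n)\<^sup>2 = (1/2) ^ n"
          by (simp add: power_mult_distrib[symmetric] power2_eq_square)
        then show ?thesis by (simp add: power_mult_distrib)
      qed
      finally show ?thesis using it[OF R, of n] by linarith
    qed
    moreover have "(\<lambda>n. (1/2) ^ n * (A * R\<^sup>2) + 2 * D) \<longlonglongrightarrow> 0 * (A * R\<^sup>2) + 2 * D"
      by (intro tendsto_intros LIMSEQ_power_zero) simp
    ultimately show ?thesis
      using LIMSEQ_le_const by fastforce
  qed
  have "H R \<le> 2 * D" if "R \<ge> 1" for R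
    using le[of "max R R1"] mono[of R "max R R1"] that by simp
  then show ?thesis by blast
qed

text \<open>Bounded energy makes the boundary terms small: on a fixed cylinder they are \<open>O(1)\<close>, and outside it
  they are paid for by the tail of the energy.\<close>

lemma J_boundary_small:
  assumes cont: "continuous_on UNIV f" "continuous_on UNIV h" "continuous_on UNIV e"
    and nonneg: "\<And>x. 0 \<le> f x" "\<And>x. 0 \<le> h x" "\<And>x. 0 \<le> e x"
    and bounded: "\<And>R. R \<ge> 1 \<Longrightarrow> J R 7 f \<le> B"
    and young: "\<And>x \<mu>. \<mu> > 0 \<Longrightarrow> h x \<le> \<mu> * f x + e x / \<mu>"
    and growth: "\<And>R. R \<ge> 1 \<Longrightarrow> J R 6 e \<le> A * R\<^sup>2"
    and \<epsilon>: "\<epsilon> > 0"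
  shows "\<exists>R0\<ge>1. \<forall>R\<ge>R0. J R 6 h \<le> \<epsilon> * R"
proof -
  define q where "q = (4/3::real) ^ 7"
  have q: "q > 0" by (simp add: q_def)
  have A: "A \<ge> 0" using growth[of 1] J_nonneg[of 1 6 e] cont nonneg by auto
  have B: "B \<ge> 0" using bounded[of 1] J_nonneg[of 1 7 f] cont nonneg by fastforce
  define \<Lambda> where "\<Lambda> = 4 * (A + 1) / \<epsilon>"
  have \<Lambda>: "\<Lambda> > 0" using A \<epsilon> by (simp add: \<Lambda>_def)
  define \<eta> where "\<eta> = \<epsilon> / (4 * \<Lambda> * q)"
  have \<eta>: "\<eta> > 0" using \<epsilon> \<Lambda> q by (simp add: \<eta>_def)
  \<comment> \<open>\<open>L\<close> is chosen so large that the energy beyond \<open>L\<close> is at most \<open>\<eta>\<close>.\<close>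
  define T where "T = (SUP R\<in>{1..}. J R 7 f)"
  have bdd: "bdd_above ((\<lambda>R. J R 7 f) ` {1..})" using bounded by (intro bdd_aboveI2[of _ _ B]) auto
  have "\<exists>L\<in>{1::real..}. T - \<eta> < J L 7 f"
    unfolding T_def using \<eta> by (subst less_cSUP_iff[OF _ bdd, symmetric]) auto
  then obtain L where L: "L \<ge> 1" "T - \<eta> < J L 7 f" by auto
  have tail: "J R 7 f - J L 7 f \<le> \<eta>" if "R \<ge> 1" for R
    using L(2) cSUP_upper[OF _ bdd, of R] that unfolding T_def by simp
  define \<phi> where "\<phi> x = cutoff L x ^ 7" for x
  have \<phi>: "0 \<le> \<phi> x" "\<phi> x \<le> 1" for x by (auto simp: \<phi>_def cutoff_bounds power_le_one)
  have c\<phi>: "continuous_on UNIV \<phi>" unfolding \<phi>_def[abs_def] by (intro continuous_intros)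
  note cs = continuous_intros cont c\<phi>
  define E where "E = J L 7 h"
  \<comment> \<open>On the cylinder of radius \<open>L\<close> the seventh power of the cutoff of radius \<open>2R\<close> differs from \<open>1\<close> by at
    most \<open>\<kappa> R\<close>, by Bernoulli's inequality.\<close>
  define \<kappa> where "\<kappa> R = 7 * L\<^sup>2 / (4 * R\<^sup>2)" for R :: real
  have main: "J R 6 h \<le> E + \<Lambda> * R * (q * (\<eta> + \<kappa> R * B)) + A * R / \<Lambda>" if R: "R \<ge> L" for R
  proof -
    have R1: "R \<ge> 1" "R > 0" using R L by auto
    have "J R 6 h = J R 6 (\<lambda>x. \<phi> x * h x) + J R 6 (\<lambda>x. (1 - \<phi> x) * h x)"
      using J_add[of R 6 "\<lambda>x. \<phi> x * h x" "\<lambda>x. (1 - \<phi> x) * h x"] R1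
      by (simp add: cs) (simp add: algebra_simps)
    also have "J R 6 (\<lambda>x. \<phi> x * h x) \<le> E"
    proof -
      have "J R 6 (\<lambda>x. \<phi> x * h x) \<le> slab_integral (\<lambda>x. \<phi> x * h x)"
        unfolding J_def
      proof (rule slab_integral_mono)
        show "vanishes_beyond R (\<lambda>x. cutoff R x ^ 6 * (\<phi> x * h x))"
          by (rule vanishes_beyond_cutoff) (use R1 in auto)
        show "vanishes_beyond L (\<lambda>x. \<phi> x * h x)"
          unfolding \<phi>_def by (rule vanishes_beyond_cutoff) (use L in auto)
        show "cutoff R x ^ 6 * (\<phi> x * h x) \<le> \<phi> x * h x" for x
          using \<phi>[of x] nonneg by (intro mult_left_le_one_le) (auto simp: cutoff_bounds power_le_one)
      qed (intro cs)+
      then show ?thesis by (simp add: E_def J_def \<phi>_def)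
    qed
    also have "J R 6 (\<lambda>x. (1 - \<phi> x) * h x) \<le> \<Lambda> * R * J R 6 (\<lambda>x. (1 - \<phi> x) * f x) + 1 / (\<Lambda> * R) * J R 6 e"
    proof -
      have "J R 6 (\<lambda>x. (1 - \<phi> x) * h x) \<le> J R 6 (\<lambda>x. \<Lambda> * R * ((1 - \<phi> x) * f x) + 1 / (\<Lambda> * R) * e x)"
      proof (rule J_mono)
        fix x
        have "(1 - \<phi> x) * h x \<le> (1 - \<phi> x) * (\<Lambda> * R * f x + e x / (\<Lambda> * R))"
          using \<phi>[of x] \<Lambda> R1 by (intro mult_left_mono young) auto
        also have "\<dots> = \<Lambda> * R * ((1 - \<phi> x) * f x) + (1 - \<phi> x) * (e x / (\<Lambda> * R))"
          by (simp add: algebra_simps)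
        also have "(1 - \<phi> x) * (e x / (\<Lambda> * R)) \<le> e x / (\<Lambda> * R)"
          using \<phi>[of x] \<Lambda> R1 nonneg by (intro mult_left_le_one_le) auto
        finally show "(1 - \<phi> x) * h x \<le> \<Lambda> * R * ((1 - \<phi> x) * f x) + 1 / (\<Lambda> * R) * e x" by simp
      qed (use R1 \<Lambda> in \<open>auto intro!: cs\<close>)
      also have "\<dots> = \<Lambda> * R * J R 6 (\<lambda>x. (1 - \<phi> x) * f x) + 1 / (\<Lambda> * R) * J R 6 e"
        using R1 by (intro J_lincomb cs) auto
      finally show ?thesis .
    qed
    also have "1 / (\<Lambda> * R) * J R 6 e \<le> 1 / (\<Lambda> * R) * (A * R\<^sup>2)"
      using \<Lambda> R1 by (intro mult_left_mono growth) auto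
    also have "1 / (\<Lambda> * R) * (A * R\<^sup>2) = A * R / \<Lambda>" using R1 \<Lambda> by (simp add: power2_eq_square)
    also have "\<Lambda> * R * J R 6 (\<lambda>x. (1 - \<phi> x) * f x) \<le> \<Lambda> * R * (q * (\<eta> + \<kappa> R * B))"
    proof (rule mult_left_mono)
      have \<kappa>0: "0 \<le> \<kappa> R" by (simp add: \<kappa>_def)
      let ?c = "\<lambda>x. cutoff (2 * R) x ^ 7"
      have "J R 6 (\<lambda>x. (1 - \<phi> x) * f x) \<le> slab_integral (\<lambda>x. q * ((1 + \<kappa> R) * (?c x * f x) - \<phi> x * f x))"
        unfolding J_def
      proof (rule slab_integral_mono)
        show "vanishes_beyond R (\<lambda>x. cutoff R x ^ 6 * ((1 - \<phi> x) * f x))"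
          by (rule vanishes_beyond_cutoff) (use R1 in auto)
        have "vanishes_beyond (2 * R) (\<lambda>x. ?c x * f x)"
          by (rule vanishes_beyond_cutoff) (use R1 in auto)
        moreover have "vanishes_beyond (2 * R) (\<lambda>x. \<phi> x * f x)"
          by (rule vanishes_beyond_mono[of L])
             (use R R1 L(1) in \<open>auto simp: \<phi>_def intro!: vanishes_beyond_cutoff\<close>)
        ultimately show "vanishes_beyond (2 * R) (\<lambda>x. q * ((1 + \<kappa> R) * (?c x * f x) - \<phi> x * f x))"
          unfolding vanishes_beyond_def by (metis mult_zero_right diff_zero)
        fix x
        have "cutoff R x ^ 6 * (1 - \<phi> x) \<le> q * ((1 + \<kappa> R) * ?c x - \<phi> x)"
        proof (cases "cutoff L x > 0")
          case True
          have xL: "(x $ 1)\<^sup>2 + (x $ 2)\<^sup>2 < L\<^sup>2" using cutoff_positiveD(1)[OF True] L by simp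
          let ?t = "L\<^sup>2 / (2 * R)\<^sup>2"
          have t: "0 \<le> ?t" "?t \<le> 1/4"
            using R L(1) power_mono[of L R 2] R1 by (auto simp: divide_simps power_mult_distrib)
          have "((x $ 1)\<^sup>2 + (x $ 2)\<^sup>2) / (2 * R)\<^sup>2 \<le> ?t" using xL by (intro divide_right_mono) auto
          then have ge: "1 - ?t \<le> cutoff (2 * R) x" unfolding cutoff_def by linarith
          have "1 - 7 * ?t \<le> (1 - ?t) ^ 7"
            using Bernoulli_inequality[of "- ?t" 7] t by simp
          also have "\<dots> \<le> ?c x" using ge t by (intro power_mono) auto
          finally have c1: "1 - 7 * ?t \<le> ?c x" .
          have "(3/4) ^ 7 \<le> (1 - ?t) ^ 7" using t by (intro power_mono) auto
          also have "\<dots> \<le> ?c x" using ge t by (intro power_mono) auto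
          finally have c2: "1 \<le> q * ?c x"
            using mult_left_mono[of "(3/4) ^ 7" "?c x" q] q
            by (simp add: q_def power_mult_distrib[symmetric])
          have \<kappa>: "\<kappa> R = 7 * ?t" by (simp add: \<kappa>_def power_mult_distrib)
          have mono: "\<phi> x \<le> ?c x"
          proof -
            have "((x $ 1)\<^sup>2 + (x $ 2)\<^sup>2) / (2 * R)\<^sup>2 \<le> ((x $ 1)\<^sup>2 + (x $ 2)\<^sup>2) / L\<^sup>2"
              using R L R1 by (intro divide_left_mono power_mono mult_pos_pos) auto
            then have "cutoff L x \<le> cutoff (2 * R) x" by (auto simp: cutoff_def)
            then show ?thesis unfolding \<phi>_def by (intro power_mono) (auto simp: cutoff_bounds)
          qed
          have "cutoff R x ^ 6 * (1 - \<phi> x) \<le> 1 * (1 - \<phi> x)"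
            using \<phi>[of x] by (intro mult_right_mono) (auto simp: cutoff_bounds power_le_one)
          also have "\<dots> \<le> (?c x - \<phi> x) + \<kappa> R" using c1 unfolding \<kappa>[symmetric] by simp
          also have "\<dots> \<le> q * (?c x - \<phi> x) + \<kappa> R * (q * ?c x)"
          proof (rule add_mono)
            have "1 \<le> q" by (simp add: q_def)
            then show "?c x - \<phi> x \<le> q * (?c x - \<phi> x)"
              using mult_right_mono[of 1 q "?c x - \<phi> x"] mono by simp
            show "\<kappa> R \<le> \<kappa> R * (q * ?c x)"
              using mult_left_mono[OF c2 \<kappa>0] by simp
          qed
          finally show ?thesis by (simp add: algebra_simps)
        next
          case False
          then have "cutoff L x = 0" using cutoff_bounds[of L x] by simp
          then have \<phi>0: "\<phi> x = 0" by (simp add: \<phi>_def)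
          have "cutoff R x ^ 6 \<le> q * ?c x"
          proof (cases "cutoff R x > 0")
            case True
            have "cutoff R x ^ 6 \<le> 1" by (simp add: power_le_one cutoff_bounds)
            also have "1 \<le> ((4/3) * cutoff (2 * R) x) ^ 7"
              using cutoff_double[OF R1(2) True] by (intro one_le_power) simp
            finally show ?thesis by (simp only: power_mult_distrib q_def)
          next
            case False
            then have "cutoff R x = 0" using cutoff_bounds[of R x] by simp
            then show ?thesis using q cutoff_bounds[of "2*R" x] by simp
          qed
          also have "\<dots> \<le> (1 + \<kappa> R) * (q * ?c x)"
            using q cutoff_bounds[of "2*R" x] \<kappa>0 by (simp add: distrib_right)
          finally show ?thesis using \<phi>0 by (simp add: algebra_simps)
        qed
        from mult_right_mono[OF this nonneg(1)[of x]]
        show "cutoff R x ^ 6 * ((1 - \<phi> x) * f x) \<le> q * ((1 + \<kappa> R) * (?c x * f x) - \<phi> x * f x)"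
          by (simp add: algebra_simps)
      qed (intro cs)+
      also have "\<dots> = q * ((1 + \<kappa> R) * J (2 * R) 7 f - J L 7 f)"
      proof -
        have i: "(\<lambda>x. ?c x * f x) integrable_on slab 0 1" "(\<lambda>x. \<phi> x * f x) integrable_on slab 0 1"
          unfolding \<phi>_def
          by (intro slab_integrable[OF vanishes_beyond_cutoff] continuous_intros cont; use R1 L in simp)+
        have "((\<lambda>x. q * ((1 + \<kappa> R) * (?c x * f x) - \<phi> x * f x)) has_integral
            q * ((1 + \<kappa> R) * integral (slab 0 1) (\<lambda>x. ?c x * f x) - integral (slab 0 1) (\<lambda>x. \<phi> x * f x))) (slab 0 1)"
          by (intro has_integral_mult_right has_integral_diff integrable_integral i)
        then show ?thesis unfolding J_def slab_integral_def \<phi>_def by (rule integral_unique)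
      qed
      also have "\<dots> \<le> q * (\<eta> + \<kappa> R * B)"
      proof -
        have "\<kappa> R * J (2 * R) 7 f \<le> \<kappa> R * B" using R1 \<kappa>0 by (intro mult_left_mono bounded) auto
        then show ?thesis using tail[of "2 * R"] R1 q by (intro mult_left_mono) (auto simp: algebra_simps)
      qed
      finally show "J R 6 (\<lambda>x. (1 - \<phi> x) * f x) \<le> q * (\<eta> + \<kappa> R * B)" .
    qed (use \<Lambda> R1 in simp)
    finally show ?thesis by linarith
  qed
  define K where "K = \<bar>E\<bar> + \<Lambda> * q * 7 * L\<^sup>2 * B"
  define R0 where "R0 = max L (4 * K / \<epsilon>)"
  have "J R 6 h \<le> \<epsilon> * R" if "R \<ge> R0" for R
  proof -
    have R: "R \<ge> L" "R \<ge> 1" "K \<le> \<epsilon> / 4 * R" using that L \<epsilon> by (auto simp: R0_def field_simps)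
    have "\<Lambda> * R * (q * \<eta>) = \<epsilon> / 4 * R" using \<Lambda> q by (simp add: \<eta>_def)
    moreover have "\<Lambda> * R * (q * (\<kappa> R * B)) = (\<Lambda> * q * 7 * L\<^sup>2 * B) / (4 * R)"
      using R by (simp add: \<kappa>_def power2_eq_square)
    ultimately have "\<Lambda> * R * (q * (\<eta> + \<kappa> R * B)) = \<epsilon> / 4 * R + (\<Lambda> * q * 7 * L\<^sup>2 * B) / (4 * R)"
      by (simp add: distrib_left)
    moreover have "(\<Lambda> * q * 7 * L\<^sup>2 * B) / (4 * R) \<le> \<Lambda> * q * 7 * L\<^sup>2 * B"
    proof -
      have "0 \<le> \<Lambda> * q * 7 * L\<^sup>2 * B" using \<Lambda> q B by simp
      then show ?thesis using R mult_left_mono[of 1 "4 * R" "\<Lambda> * q * 7 * L\<^sup>2 * B"]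
        by (subst pos_divide_le_eq) auto
    qed
    moreover have "A * R / \<Lambda> \<le> \<epsilon> / 4 * R"
    proof -
      have "A / \<Lambda> \<le> \<epsilon> / 4" using A \<epsilon> by (simp add: \<Lambda>_def field_simps)
      then show ?thesis using mult_right_mono[of "A / \<Lambda>" "\<epsilon> / 4" R] R by simp
    qed
    ultimately have "J R 6 h \<le> K + \<epsilon> / 4 * R + \<epsilon> / 4 * R"
      using main[OF R(1)] unfolding K_def by linarith
    then show ?thesis using R(2,3) \<epsilon> mult_pos_pos[of \<epsilon> R] by linarith
  qed
  then show ?thesis using L by (intro exI[of _ R0]) (auto simp: R0_def)
qed

text \<open>The common end of all the arguments below. The energy density \<open>f\<close> is dominated by the boundary
  term \<open>h\<close> at the next smaller power of the cutoff, and \<open>h\<close> is at most a geometric mean of \<open>f\<close> and of a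
  density \<open>e\<close> of two-dimensional growth. Then the energy is bounded, hence its boundary term is \<open>o(1)\<close>,
  hence it vanishes.\<close>

lemma liouville_scheme:
  assumes cont: "continuous_on UNIV f" "continuous_on UNIV h" "continuous_on UNIV e"
    and per: "z_periodic f"
    and nonneg: "\<And>x. 0 \<le> f x" "\<And>x. 0 \<le> h x" "\<And>x. 0 \<le> e x"
    and young: "\<And>x \<mu>. \<mu> > 0 \<Longrightarrow> h x \<le> \<mu> * f x + e x / \<mu>"
    and growth_e: "\<And>R. R \<ge> 1 \<Longrightarrow> J R 6 e \<le> A * R\<^sup>2"
    and growth_f: "\<And>R. R \<ge> 1 \<Longrightarrow> J R 7 f \<le> A' * R\<^sup>2"
    and C: "C \<ge> 0"
    and key: "\<And>\<epsilon>. \<epsilon> > 0 \<Longrightarrow> \<exists>R0. \<forall>R\<ge>R0. J R 7 f \<le> C / R * J R 6 h + \<epsilon> * (J (2 * R) 7 f + 1)"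
  shows "f x = 0"
proof -
  define q where "q = (4/3::real) ^ 7"
  have q: "q > 0" by (simp add: q_def)
  have A: "A \<ge> 0" using growth_e[of 1] J_nonneg[of 1 6 e] cont nonneg by auto
  have H0: "0 \<le> J R 7 f" if "R \<ge> 1" for R using that by (intro J_nonneg cont nonneg) auto
  have mono: "J R 7 f \<le> J S 7 f" if "1 \<le> R" "R \<le> S" for R S
    using that by (intro J_radius_mono cont nonneg) auto
  obtain R0 where R0: "\<And>R. R \<ge> R0 \<Longrightarrow> J R 7 f \<le> C / R * J R 6 h + 1/16 * (J (2 * R) 7 f + 1)"
    using key[of "1/16"] by auto
  \<comment> \<open>Together with the \<open>1/16\<close> above this makes the factor \<open>1/8\<close> of \<open>bounded_of_doubling\<close>.\<close>
  define \<delta> where "\<delta> = 1 / (16 * (C + 1) * q)"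
  have \<delta>: "\<delta> > 0" using C q by (simp add: \<delta>_def)
  have C\<delta>: "C * \<delta> * q \<le> 1/16" using C q by (simp add: \<delta>_def divide_simps)
  have "J R 7 f \<le> 1/8 * J (2 * R) 7 f + (C * A / \<delta> + 1/16)" if "R \<ge> max 1 R0" for R
  proof -
    have R: "R \<ge> 1" "R \<ge> R0" "R > 0" using that by auto
    have "J R 6 h \<le> J R 6 (\<lambda>x. \<delta> * R * f x + 1 / (\<delta> * R) * e x)"
      using young[of "\<delta> * R"] \<delta> R by (intro J_mono continuous_intros cont) auto
    also have "\<dots> = \<delta> * R * J R 6 f + 1 / (\<delta> * R) * J R 6 e" using R by (intro J_lincomb cont) auto
    also have "\<dots> \<le> \<delta> * R * (q * J (2 * R) 7 f) + 1 / (\<delta> * R) * (A * R\<^sup>2)"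
      unfolding q_def using R \<delta> by (intro add_mono mult_left_mono J_double growth_e cont nonneg) auto
    finally have "C / R * J R 6 h \<le> C / R * (\<delta> * R * (q * J (2 * R) 7 f) + 1 / (\<delta> * R) * (A * R\<^sup>2))"
      using C R by (intro mult_left_mono) auto
    also have "\<dots> = C * \<delta> * q * J (2 * R) 7 f + C * A / \<delta>"
      using R \<delta> by (simp add: field_simps power2_eq_square)
    also have "C * \<delta> * q * J (2 * R) 7 f \<le> 1/16 * J (2 * R) 7 f"
      using R by (intro mult_right_mono C\<delta> H0) auto
    finally show ?thesis using R0[OF R(2)] unfolding distrib_left by linarith
  qed
  with H0 mono growth_f have "\<exists>B. \<forall>R\<ge>1. J R 7 f \<le> B"
    by (rule bounded_of_doubling[where H = "\<lambda>R. J R 7 f"])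
  then obtain B where B: "\<And>R. R \<ge> 1 \<Longrightarrow> J R 7 f \<le> B" by auto
  have B0: "B \<ge> 0" using H0[of 1] B[of 1] by simp
  have small: "J R 7 f \<le> \<eta>" if R: "R \<ge> 1" and \<eta>: "\<eta> > 0" for R \<eta>
  proof -
    have "\<eta> / (2 * (C + 1)) > 0" using \<eta> C by simp
    from J_boundary_small[OF cont nonneg B young growth_e this]
    obtain R1 where R1: "\<And>R. R \<ge> R1 \<Longrightarrow> J R 6 h \<le> \<eta> / (2 * (C + 1)) * R" by auto
    have "\<eta> / (2 * (B + 1)) > 0" using \<eta> B0 by simp
    from key[OF this] obtain R2 where R2: "\<And>R. R \<ge> R2 \<Longrightarrow>
        J R 7 f \<le> C / R * J R 6 h + \<eta> / (2 * (B + 1)) * (J (2 * R) 7 f + 1)" by auto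
    define S where "S = max R (max R1 R2)"
    have S: "S \<ge> 1" "S \<ge> R" "S \<ge> R1" "S \<ge> R2" using R by (auto simp: S_def)
    have "C / S * J S 6 h \<le> C / S * (\<eta> / (2 * (C + 1)) * S)"
      using C S R1[OF S(3)] by (intro mult_left_mono) auto
    also have "\<dots> \<le> \<eta> / 2" using C S \<eta> by (simp add: divide_simps)
    finally have 1: "C / S * J S 6 h \<le> \<eta> / 2" .
    have "\<eta> / (2 * (B + 1)) * (J (2 * S) 7 f + 1) \<le> \<eta> / (2 * (B + 1)) * (B + 1)"
      using S \<eta> B0 B[of "2 * S"] by (intro mult_left_mono) auto
    also have "\<dots> = \<eta> / 2" using B0 by (simp add: divide_simps)
    finally have "J S 7 f \<le> \<eta>" using R2[OF S(4)] 1 by linarith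
    then show ?thesis using mono[OF R S(2)] by linarith
  qed
  define R where "R = \<bar>x $ 1\<bar> + \<bar>x $ 2\<bar> + 1"
  have R: "R \<ge> 1" by (simp add: R_def)
  have "J R 7 f \<le> 0" by (rule field_le_epsilon) (use small[OF R] in simp)
  then have J0: "J R 7 f = 0" using H0[OF R] by simp
  have "(x $ 1)\<^sup>2 + (x $ 2)\<^sup>2 < R\<^sup>2"
  proof -
    have "(x $ 1)\<^sup>2 + (x $ 2)\<^sup>2 \<le> (\<bar>x $ 1\<bar> + \<bar>x $ 2\<bar>)\<^sup>2" by (simp add: power2_sum)
    also have "\<dots> < R\<^sup>2" unfolding R_def by (intro power_strict_mono) auto
    finally show ?thesis .
  qed
  then have "cutoff R x > 0" using R by (simp add: cutoff_def max_def divide_simps)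
  then show ?thesis using J_eq_0D[OF _ _ cont(1) per nonneg(1) J0] R by simp
qed

section \<open>Steady flows\<close>

text \<open>The system is used in the form \<open>- \<Delta> U\<^sub>j + (\<Sum>\<^sub>l U\<^sub>l a\<^sub>l\<^sub>j) + \<partial>\<^sub>j Q = 0\<close> with the antisymmetric vorticity
  \<open>a\<^sub>l\<^sub>j = \<partial>\<^sub>l U\<^sub>j - \<partial>\<^sub>j U\<^sub>l\<close> and the Bernoulli function \<open>Q = P + |U|\<^sup>2 / 2\<close>. The fields are
  indexed families of scalars, which suits integration by parts term by term.\<close>

locale steady_flow =
  fixes U :: "3 \<Rightarrow> real^3 \<Rightarrow> real" and Q :: "real^3 \<Rightarrow> real" and M :: real
  assumes U: "\<And>i. per_smooth (U i)"
    and bound: "\<And>i x. \<bar>U i x\<bar> \<le> M"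
    and div: "\<And>x. (\<Sum>i\<in>UNIV. partial_deriv i (U i) x) = 0"
    and Q: "smooth Q"
    and momentum: "\<And>j x. (\<Sum>l\<in>UNIV. partial_deriv l (partial_deriv l (U j)) x) =
      (\<Sum>l\<in>UNIV. U l x * (partial_deriv l (U j) x - partial_deriv j (U l) x)) + partial_deriv j Q x"
begin

definition vort :: "3 \<Rightarrow> 3 \<Rightarrow> real^3 \<Rightarrow> real" where
  "vort i j x = partial_deriv i (U j) x - partial_deriv j (U i) x"

text \<open>The Lamb vector \<open>\<omega> \<times> U\<close>.\<close>

definition lamb :: "3 \<Rightarrow> real^3 \<Rightarrow> real" where
  "lamb j x = (\<Sum>l\<in>UNIV. U l x * vort l j x)"

definition grad_sq :: "real^3 \<Rightarrow> real" where
  "grad_sq x = (\<Sum>i\<in>UNIV. \<Sum>j\<in>UNIV. (partial_deriv i (U j) x)\<^sup>2)"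

definition vort_sq :: "real^3 \<Rightarrow> real" where
  "vort_sq x = (\<Sum>i\<in>UNIV. \<Sum>j\<in>UNIV. (vort i j x)\<^sup>2)"

definition grad_vort_sq :: "real^3 \<Rightarrow> real" where
  "grad_vort_sq x = (\<Sum>i\<in>UNIV. \<Sum>j\<in>UNIV. \<Sum>l\<in>UNIV. (partial_deriv l (vort i j) x)\<^sup>2)"

lemma M: "M \<ge> 0" using bound[of 1 0] by linarith

lemma per_smooth_vort: "per_smooth (vort i j)"
  unfolding vort_def[abs_def] by (intro per_smooth_intros(4,8) U)

lemma per_smooth_lamb: "per_smooth (lamb j)"
  unfolding lamb_def[abs_def] by (intro per_smooth_intros(3,7) U per_smooth_vort)

lemma per_smooth_grad_sq: "per_smooth grad_sq"
  unfolding grad_sq_def[abs_def] by (intro per_smooth_intros(6-8) U)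

lemma per_smooth_vort_sq: "per_smooth vort_sq"
  unfolding vort_sq_def[abs_def] by (intro per_smooth_intros(6-8) per_smooth_vort)

lemma per_smooth_grad_vort_sq: "per_smooth grad_vort_sq"
  unfolding grad_vort_sq_def[abs_def] by (intro per_smooth_intros(6-8) per_smooth_vort)

lemmas per_smooth_flow = U per_smooth_vort per_smooth_lamb per_smooth_grad_sq per_smooth_vort_sq
  per_smooth_grad_vort_sq

lemmas smooth_flow = per_smooth_flow[THEN per_smoothD(1)] Q

lemma continuous_flow: "continuous_on S (U i)" "continuous_on S (vort i j)" "continuous_on S (lamb j)"
  "continuous_on S grad_sq" "continuous_on S vort_sq" "continuous_on S grad_vort_sq"
  "continuous_on S (partial_deriv i (U j))" "continuous_on S (partial_deriv l (vort i j))"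
  "continuous_on S (partial_deriv i Q)"
  by (rule per_smooth_continuous per_smooth_flow per_smooth_intros(8) smooth_continuous_on smooth_partial_deriv Q)+

lemma nonneg_flow: "0 \<le> grad_sq x" "0 \<le> vort_sq x" "0 \<le> grad_vort_sq x"
  by (auto simp: grad_sq_def vort_sq_def grad_vort_sq_def intro!: sum_nonneg)

lemma vort_antisym: "vort j i x = - vort i j x"
  by (simp add: vort_def)

lemma component_le_sum_sq: "(F i)\<^sup>2 \<le> (\<Sum>i\<in>UNIV. (F i)\<^sup>2)" for F :: "3 \<Rightarrow> real"
  by (rule member_le_sum) auto

lemma component_le_sum_sq2: "(F i j)\<^sup>2 \<le> (\<Sum>i\<in>UNIV. \<Sum>j\<in>UNIV. (F i j)\<^sup>2)" for F :: "3 \<Rightarrow> 3 \<Rightarrow> real"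
proof -
  have "(\<Sum>j\<in>UNIV. (F i j)\<^sup>2) \<le> (\<Sum>i\<in>UNIV. \<Sum>j\<in>UNIV. (F i j)\<^sup>2)"
    by (rule member_le_sum[of i UNIV "\<lambda>i. \<Sum>j\<in>UNIV. (F i j)\<^sup>2"]) (auto intro: sum_nonneg)
  then show ?thesis using component_le_sum_sq[of "F i" j] by linarith
qed

lemma vort_le: "(vort i j x)\<^sup>2 \<le> vort_sq x"
  unfolding vort_sq_def by (rule component_le_sum_sq2)

lemma grad_le: "(partial_deriv i (U j) x)\<^sup>2 \<le> grad_sq x"
  unfolding grad_sq_def by (rule component_le_sum_sq2)

lemma grad_vort_le: "(partial_deriv l (vort i j) x)\<^sup>2 \<le> grad_vort_sq x"
proof -
  have "(\<Sum>j\<in>UNIV. \<Sum>l\<in>UNIV. (partial_deriv l (vort i j) x)\<^sup>2) \<le> grad_vort_sq x"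
    unfolding grad_vort_sq_def
    by (rule member_le_sum[of i UNIV "\<lambda>i. \<Sum>j\<in>UNIV. \<Sum>l\<in>UNIV. (partial_deriv l (vort i j) x)\<^sup>2"])
       (auto intro!: sum_nonneg)
  then show ?thesis using component_le_sum_sq2[of "\<lambda>j l. partial_deriv l (vort i j) x" j l] by linarith
qed

lemma sum_sq_3: "(\<Sum>l\<in>(UNIV::3 set). F l)\<^sup>2 \<le> 3 * (\<Sum>l\<in>UNIV. (F l)\<^sup>2)" for F :: "3 \<Rightarrow> real"
proof -
  have "0 \<le> (F 1 - F 2)\<^sup>2 + (F 1 - F 3)\<^sup>2 + (F 2 - F 3)\<^sup>2" by simp
  then show ?thesis unfolding sum_3 by (simp add: power2_eq_square algebra_simps)
qed

lemma lamb_sum_le: "(lamb j x)\<^sup>2 \<le> 3 * M\<^sup>2 * (\<Sum>l\<in>UNIV. (vort l j x)\<^sup>2)"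
proof -
  have "(lamb j x)\<^sup>2 \<le> 3 * (\<Sum>l\<in>UNIV. (U l x * vort l j x)\<^sup>2)"
    unfolding lamb_def by (rule sum_sq_3)
  also have "(\<Sum>l\<in>UNIV. (U l x * vort l j x)\<^sup>2) \<le> (\<Sum>l\<in>UNIV. M\<^sup>2 * (vort l j x)\<^sup>2)"
  proof (rule sum_mono)
    fix l
    have "(U l x)\<^sup>2 \<le> M\<^sup>2" using bound[of l x] M by (simp add: abs_le_square_iff[symmetric])
    then show "(U l x * vort l j x)\<^sup>2 \<le> M\<^sup>2 * (vort l j x)\<^sup>2"
      unfolding power_mult_distrib by (rule mult_right_mono) simp
  qed
  finally show ?thesis by (simp add: sum_distrib_left[symmetric])
qed

lemma lamb_le: "(lamb j x)\<^sup>2 \<le> 3 * M\<^sup>2 * vort_sq x"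
proof -
  have "(\<Sum>l\<in>UNIV. (vort l j x)\<^sup>2) \<le> vort_sq x"
    unfolding vort_sq_def by (intro sum_mono component_le_sum_sq)
  then show ?thesis using lamb_sum_le[of j x] by (meson mult_left_mono order_trans zero_le_power2 mult_nonneg_nonneg zero_le_numeral)
qed

lemma vort_sq_le_grad_sq: "vort_sq x \<le> 4 * grad_sq x"
proof -
  have "vort_sq x \<le> (\<Sum>i\<in>UNIV. \<Sum>j\<in>UNIV. 2 * (partial_deriv i (U j) x)\<^sup>2 + 2 * (partial_deriv j (U i) x)\<^sup>2)"
    unfolding vort_sq_def
  proof (intro sum_mono)
    fix i j
    show "(vort i j x)\<^sup>2 \<le> 2 * (partial_deriv i (U j) x)\<^sup>2 + 2 * (partial_deriv j (U i) x)\<^sup>2"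
      using zero_le_power2[of "partial_deriv i (U j) x + partial_deriv j (U i) x"]
      unfolding vort_def power2_sum power2_diff by linarith
  qed
  also have "\<dots> = 2 * grad_sq x + 2 * (\<Sum>i\<in>UNIV. \<Sum>j\<in>UNIV. (partial_deriv j (U i) x)\<^sup>2)"
    by (simp add: sum.distrib sum_distrib_left grad_sq_def)
  also have "(\<Sum>i\<in>UNIV. \<Sum>j\<in>UNIV. (partial_deriv j (U i) x)\<^sup>2) = grad_sq x"
    unfolding grad_sq_def by (rule sum.swap)
  finally show ?thesis by simp
qed

lemma partial_deriv_div: "(\<Sum>i\<in>UNIV. partial_deriv i (partial_deriv j (U i)) x) = 0"
proof -
  have "(\<lambda>x. \<Sum>i\<in>UNIV. partial_deriv i (U i) x) = (\<lambda>x. 0)" using div by auto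
  then have "partial_deriv j (\<lambda>x. \<Sum>i\<in>UNIV. partial_deriv i (U i) x) x = 0" by simp
  then show ?thesis
    by (simp add: smooth_partial_deriv smooth_flow partial_deriv_commute[of _ _ j])
qed

lemma laplacian_eq_vort:
  "(\<Sum>l\<in>UNIV. partial_deriv l (partial_deriv l (U j)) x) = (\<Sum>l\<in>UNIV. partial_deriv l (vort l j) x)"
proof -
  have "partial_deriv l (vort l j) x = partial_deriv l (partial_deriv l (U j)) x - partial_deriv l (partial_deriv j (U l)) x" for l
    unfolding vort_def[abs_def] by (simp add: smooth_partial_deriv smooth_flow)
  then show ?thesis by (simp add: sum_subtractf partial_deriv_div)
qed

lemma partial_deriv_Q: "partial_deriv j Q x = (\<Sum>l\<in>UNIV. partial_deriv l (vort l j) x) - lamb j x"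
  using momentum[of j x] unfolding laplacian_eq_vort lamb_def vort_def by simp

text \<open>The equation itself expresses \<open>\<nabla>Q\<close> by the vorticity and its derivatives, so that \<open>\<nabla>Q\<close> is
  controlled without any theory of the pressure.\<close>

lemma grad_Q_le: "(\<Sum>j\<in>UNIV. (partial_deriv j Q x)\<^sup>2) \<le> 6 * grad_vort_sq x + 6 * M\<^sup>2 * vort_sq x"
proof -
  have "(partial_deriv j Q x)\<^sup>2 \<le> 6 * (\<Sum>l\<in>UNIV. (partial_deriv l (vort l j) x)\<^sup>2) + 6 * M\<^sup>2 * (\<Sum>l\<in>UNIV. (vort l j x)\<^sup>2)" for j
  proof -
    have "(partial_deriv j Q x)\<^sup>2 \<le> 2 * (\<Sum>l\<in>UNIV. partial_deriv l (vort l j) x)\<^sup>2 + 2 * (lamb j x)\<^sup>2"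
      using zero_le_power2[of "(\<Sum>l\<in>UNIV. partial_deriv l (vort l j) x) + lamb j x"]
      unfolding partial_deriv_Q power2_sum power2_diff by linarith
    then show ?thesis using sum_sq_3[of "\<lambda>l. partial_deriv l (vort l j) x"] lamb_sum_le[of j x] by linarith
  qed
  then have "(\<Sum>j\<in>UNIV. (partial_deriv j Q x)\<^sup>2) \<le>
      (\<Sum>j\<in>UNIV. 6 * (\<Sum>l\<in>UNIV. (partial_deriv l (vort l j) x)\<^sup>2) + 6 * M\<^sup>2 * (\<Sum>l\<in>UNIV. (vort l j x)\<^sup>2))"
    by (rule sum_mono)
  also have "\<dots> = 6 * (\<Sum>j\<in>UNIV. \<Sum>l\<in>UNIV. (partial_deriv l (vort l j) x)\<^sup>2) + 6 * M\<^sup>2 * (\<Sum>j\<in>UNIV. \<Sum>l\<in>UNIV. (vort l j x)\<^sup>2)"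
    by (simp add: sum.distrib sum_distrib_left)
  also have "(\<Sum>j\<in>UNIV. \<Sum>l\<in>UNIV. (vort l j x)\<^sup>2) = vort_sq x" unfolding vort_sq_def by (rule sum.swap)
  also have "(\<Sum>j\<in>UNIV. \<Sum>l\<in>UNIV. (partial_deriv l (vort l j) x)\<^sup>2) \<le> grad_vort_sq x"
  proof -
    have "(\<Sum>j\<in>UNIV. \<Sum>l\<in>UNIV. (partial_deriv l (vort l j) x)\<^sup>2) = (\<Sum>l\<in>UNIV. \<Sum>j\<in>UNIV. (partial_deriv l (vort l j) x)\<^sup>2)"
      by (rule sum.swap)
    also have "\<dots> \<le> grad_vort_sq x"
      unfolding grad_vort_sq_def
      by (intro sum_mono component_le_sum_sq[of "\<lambda>l. partial_deriv l (vort _ _) x"])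
    finally show ?thesis .
  qed
  finally show ?thesis by simp
qed

lemma vorticity_equation:
  "(\<Sum>l\<in>UNIV. partial_deriv l (partial_deriv l (vort i j)) x) = partial_deriv i (lamb j) x - partial_deriv j (lamb i) x"
proof -
  have eq: "(\<Sum>l\<in>UNIV. partial_deriv i (partial_deriv l (partial_deriv l (U j))) x) =
      partial_deriv i (lamb j) x + partial_deriv i (partial_deriv j Q) x" for i j x
  proof -
    have "(\<lambda>x. \<Sum>l\<in>UNIV. partial_deriv l (partial_deriv l (U j)) x) = (\<lambda>x. lamb j x + partial_deriv j Q x)"
      using momentum by (auto simp: lamb_def vort_def)
    then have "partial_deriv i (\<lambda>x. \<Sum>l\<in>UNIV. partial_deriv l (partial_deriv l (U j)) x) x =
        partial_deriv i (\<lambda>x. lamb j x + partial_deriv j Q x) x" by simp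
    then show ?thesis by (simp add: smooth_partial_deriv smooth_flow)
  qed
  have comm: "partial_deriv l (partial_deriv l (partial_deriv i (U j))) = partial_deriv i (partial_deriv l (partial_deriv l (U j)))" for i j l
    by (simp add: partial_deriv_commute[of _ l i] smooth_flow smooth_partial_deriv)
  have "partial_deriv l (partial_deriv l (vort i j)) x =
      partial_deriv i (partial_deriv l (partial_deriv l (U j))) x - partial_deriv j (partial_deriv l (partial_deriv l (U i))) x" for l
    unfolding vort_def[abs_def] by (simp add: smooth_partial_deriv smooth_flow comm)
  then have "(\<Sum>l\<in>UNIV. partial_deriv l (partial_deriv l (vort i j)) x) =
      partial_deriv i (lamb j) x + partial_deriv i (partial_deriv j Q) x - (partial_deriv j (lamb i) x + partial_deriv j (partial_deriv i Q) x)"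
    by (simp add: sum_subtractf eq)
  then show ?thesis by (simp add: partial_deriv_commute[OF Q, of i j])
qed

section \<open>A priori bounds\<close>

text \<open>The vorticity equation has no pressure, and testing it with the vorticity itself bounds the
  derivatives of the vorticity by the vorticity.\<close>

lemma J_grad_vort_le:
  obtains C where "C \<ge> 0" "\<And>R. R \<ge> 1 \<Longrightarrow> J R 6 grad_vort_sq \<le> C * J R 4 vort_sq"
proof -
  \<comment> \<open>Each of the nine pairs of indices may use up \<open>1/18\<close> of \<open>J R 6 grad_vort_sq\<close>; half of it is then
    absorbed. This fixes the weights in Young's inequality below.\<close>
  define C0 where "C0 = 11664 + 108 * M\<^sup>2 + 24 * (1 + M\<^sup>2)"
  have "J R 6 grad_vort_sq \<le> 18 * C0 * J R 4 vort_sq" if R: "R \<ge> 1" for R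
  proof -
    have R0: "R > 0" using R by simp
    let ?X = "J R 6 grad_vort_sq" and ?Y = "J R 4 vort_sq"
    have Y0: "0 \<le> ?Y" by (intro J_nonneg R0 continuous_flow nonneg_flow) simp
    have kR: "12 / R \<le> 12" using R by (simp add: divide_simps)
    note cs = continuous_intros continuous_flow
    have c2: "continuous_on UNIV (partial_deriv l (partial_deriv l (vort i j)))"
      "continuous_on UNIV (partial_deriv p (lamb j))" for i j l p
      by (rule per_smooth_continuous per_smooth_intros(8) per_smooth_vort per_smooth_lamb)+
    have dX: "J R 6 (\<lambda>x. (partial_deriv l (vort i j) x)\<^sup>2) \<le> ?X" for i j l
      by (intro J_mono R0 cs grad_vort_le) simp
    have aY: "J R 4 (\<lambda>x. (vort i j x)\<^sup>2) \<le> ?Y" for i j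
      by (intro J_mono R0 cs vort_le) simp
    have gY: "J R k (\<lambda>x. (lamb j x)\<^sup>2) \<le> 3 * M\<^sup>2 * ?Y" if "k \<ge> 4" for j k
    proof -
      have "J R k (\<lambda>x. (lamb j x)\<^sup>2) \<le> J R 4 (\<lambda>x. (lamb j x)\<^sup>2)"
        using that by (intro J_power_antimono R0 cs) auto
      also have "\<dots> \<le> J R 4 (\<lambda>x. 3 * M\<^sup>2 * vort_sq x)"
        by (intro J_mono R0 cs lamb_le) simp
      finally show ?thesis by (simp add: J_cmult)
    qed
    have bdry1: "12 / R * J R 5 (\<lambda>x. \<bar>partial_deriv l (vort i j) x\<bar> * \<bar>vort i j x\<bar>) \<le> 1/108 * ?X + 3888 * ?Y" for i j l
    proof -
      have "J R 5 (\<lambda>x. \<bar>partial_deriv l (vort i j) x\<bar> * \<bar>vort i j x\<bar>) \<le>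
          1/1296 * J R 6 (\<lambda>x. (partial_deriv l (vort i j) x)\<^sup>2) + 1 / (4 * (1/1296)) * J R 4 (\<lambda>x. (vort i j x)\<^sup>2)"
        by (intro J_young R0 cs) auto
      also have "\<dots> \<le> 1/1296 * ?X + 324 * ?Y" using dX[of l i j] aY[of i j] by simp
      finally have *: "J R 5 (\<lambda>x. \<bar>partial_deriv l (vort i j) x\<bar> * \<bar>vort i j x\<bar>) \<le> 1/1296 * ?X + 324 * ?Y" .
      have "0 \<le> J R 5 (\<lambda>x. \<bar>partial_deriv l (vort i j) x\<bar> * \<bar>vort i j x\<bar>)" by (intro J_nonneg R0 cs) auto
      then have "12 / R * J R 5 (\<lambda>x. \<bar>partial_deriv l (vort i j) x\<bar> * \<bar>vort i j x\<bar>) \<le>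
          12 * J R 5 (\<lambda>x. \<bar>partial_deriv l (vort i j) x\<bar> * \<bar>vort i j x\<bar>)" by (rule mult_right_mono[OF kR])
      with * show ?thesis by simp
    qed
    have bdry2: "12 / R * J R 5 (\<lambda>x. \<bar>vort i j x\<bar> * \<bar>lamb l x\<bar>) \<le> 12 * (1 + M\<^sup>2) * ?Y" for i j l
    proof -
      have "J R 5 (\<lambda>x. \<bar>vort i j x\<bar> * \<bar>lamb l x\<bar>) \<le>
          1 * J R 4 (\<lambda>x. (vort i j x)\<^sup>2) + 1 / (4 * 1) * J R 6 (\<lambda>x. (lamb l x)\<^sup>2)"
        by (intro J_young R0 cs) auto
      also have "\<dots> \<le> ?Y + 1/4 * (3 * M\<^sup>2 * ?Y)" using aY[of i j] gY[of 6 l] by simp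
      also have "\<dots> \<le> (1 + M\<^sup>2) * ?Y" using mult_nonneg_nonneg[OF zero_le_power2[of M] Y0] by (simp add: algebra_simps)
      finally have *: "J R 5 (\<lambda>x. \<bar>vort i j x\<bar> * \<bar>lamb l x\<bar>) \<le> (1 + M\<^sup>2) * ?Y" .
      have "0 \<le> J R 5 (\<lambda>x. \<bar>vort i j x\<bar> * \<bar>lamb l x\<bar>)" by (intro J_nonneg R0 cs) auto
      then have "12 / R * J R 5 (\<lambda>x. \<bar>vort i j x\<bar> * \<bar>lamb l x\<bar>) \<le> 12 * J R 5 (\<lambda>x. \<bar>vort i j x\<bar> * \<bar>lamb l x\<bar>)"
        by (rule mult_right_mono[OF kR])
      also have "\<dots> \<le> 12 * ((1 + M\<^sup>2) * ?Y)" by (intro mult_left_mono *) simp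
      finally show ?thesis by (simp only: mult.assoc)
    qed
    define E where "E = 1/72 * ?X + 54 * M\<^sup>2 * ?Y + 12 * (1 + M\<^sup>2) * ?Y"
    have inner: "\<bar>J R 6 (\<lambda>x. vort i j x * partial_deriv p (lamb l) x)\<bar> \<le>
        1/72 * ?X + 54 * M\<^sup>2 * ?Y + 12 * (1 + M\<^sup>2) * ?Y" for i j l p
    proof -
      have 1: "\<bar>J R 6 (\<lambda>x. vort i j x * partial_deriv p (lamb l) x) + J R 6 (\<lambda>x. partial_deriv p (vort i j) x * lamb l x)\<bar>
          \<le> 12 / R * J R 5 (\<lambda>x. \<bar>vort i j x\<bar> * \<bar>lamb l x\<bar>)"
        using J_parts_bound[OF R0, of 5 "vort i j" "lamb l" p] per_smooth_flow by simp
      have "\<bar>J R 6 (\<lambda>x. partial_deriv p (vort i j) x * lamb l x)\<bar> \<le> J R 6 (\<lambda>x. \<bar>partial_deriv p (vort i j) x\<bar> * \<bar>lamb l x\<bar>)"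
        using J_abs[OF R0, of 6 "\<lambda>x. partial_deriv p (vort i j) x * lamb l x"] by (simp add: abs_mult cs)
      also have "\<dots> \<le> 1/72 * J R 6 (\<lambda>x. (partial_deriv p (vort i j) x)\<^sup>2) + 1 / (4 * (1/72)) * J R 6 (\<lambda>x. (lamb l x)\<^sup>2)"
        by (intro J_young R0 cs) auto
      also have "\<dots> \<le> 1/72 * ?X + 18 * (3 * M\<^sup>2 * ?Y)" using dX[of p i j] gY[of 6 l] by simp
      finally show ?thesis using 1 bdry2[of i j l] by (simp add: abs_le_iff)
    qed
    have one: "J R 6 (\<lambda>x. \<Sum>l\<in>UNIV. (partial_deriv l (vort i j) x)\<^sup>2) \<le> 1/18 * ?X + C0 * ?Y" for i j
    proof -
      have "J R 6 (\<lambda>x. \<Sum>l\<in>UNIV. (partial_deriv l (vort i j) x)\<^sup>2) =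
          (\<Sum>l\<in>UNIV. J R 6 (\<lambda>x. (partial_deriv l (vort i j) x)\<^sup>2))"
        by (intro J_sum R0 cs) simp
      also have "\<dots> \<le> (\<Sum>l\<in>UNIV. - J R 6 (\<lambda>x. partial_deriv l (partial_deriv l (vort i j)) x * vort i j x) + (1/108 * ?X + 3888 * ?Y))"
      proof (rule sum_mono)
        fix l
        have "\<bar>J R 6 (\<lambda>x. (partial_deriv l (vort i j) x)\<^sup>2) + J R 6 (\<lambda>x. partial_deriv l (partial_deriv l (vort i j)) x * vort i j x)\<bar>
            \<le> 12 / R * J R 5 (\<lambda>x. \<bar>partial_deriv l (vort i j) x\<bar> * \<bar>vort i j x\<bar>)"
          using J_parts_bound[OF R0 _ per_smooth_intros(8)[OF per_smooth_vort] per_smooth_vort, of 5 l i j l i j]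
          by (simp add: power2_eq_square)
        with bdry1[of l i j] show "J R 6 (\<lambda>x. (partial_deriv l (vort i j) x)\<^sup>2) \<le>
            - J R 6 (\<lambda>x. partial_deriv l (partial_deriv l (vort i j)) x * vort i j x) + (1/108 * ?X + 3888 * ?Y)"
          by linarith
      qed
      also have "\<dots> = - (\<Sum>l\<in>UNIV. J R 6 (\<lambda>x. partial_deriv l (partial_deriv l (vort i j)) x * vort i j x)) + (1/36 * ?X + 11664 * ?Y)"
        by (simp add: sum_3)
      also have "(\<Sum>l\<in>UNIV. J R 6 (\<lambda>x. partial_deriv l (partial_deriv l (vort i j)) x * vort i j x)) =
          J R 6 (\<lambda>x. \<Sum>l\<in>UNIV. partial_deriv l (partial_deriv l (vort i j)) x * vort i j x)"
        by (rule J_sum[symmetric, OF R0]) (simp, intro cs c2)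
      also have "\<dots> = J R 6 (\<lambda>x. vort i j x * partial_deriv i (lamb j) x - vort i j x * partial_deriv j (lamb i) x)"
        unfolding sum_distrib_right[symmetric] vorticity_equation by (simp add: algebra_simps)
      also have "\<dots> = J R 6 (\<lambda>x. vort i j x * partial_deriv i (lamb j) x) - J R 6 (\<lambda>x. vort i j x * partial_deriv j (lamb i) x)"
        by (rule J_diff[OF R0]) (auto intro!: cs c2)
      finally have "J R 6 (\<lambda>x. \<Sum>l\<in>UNIV. (partial_deriv l (vort i j) x)\<^sup>2) \<le>
          2 * E + (1/36 * ?X + 11664 * ?Y)"
        using inner[of i j i j, folded E_def] inner[of i j j i, folded E_def] by linarith
      also have "\<dots> = 1/18 * ?X + C0 * ?Y" by (simp add: C0_def E_def algebra_simps)
      finally show ?thesis .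
    qed
    have "?X = (\<Sum>i\<in>UNIV. \<Sum>j\<in>UNIV. J R 6 (\<lambda>x. \<Sum>l\<in>UNIV. (partial_deriv l (vort i j) x)\<^sup>2))"
      unfolding grad_vort_sq_def by (intro J_sum2 R0 cs) simp
    also have "\<dots> \<le> (\<Sum>i\<in>(UNIV::3 set). \<Sum>j\<in>(UNIV::3 set). 1/18 * ?X + C0 * ?Y)"
      by (intro sum_mono one)
    also have "\<dots> = 1/2 * ?X + 9 * C0 * ?Y" by simp
    finally show ?thesis by linarith
  qed
  moreover have "18 * C0 \<ge> 0" by (simp add: C0_def)
  ultimately show thesis using that by blast
qed

text \<open>Conversely \<open>a\<^sub>i\<^sub>j\<^sup>2\<close> is \<open>a\<^sub>i\<^sub>j\<close> times a derivative of the bounded field \<open>U\<close>, so that the vorticity is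
  controlled by a small multiple of its derivatives plus the volume. Combining the two bounds gives
  two-dimensional growth of all energies, with no information on the pressure.\<close>

lemma J_vort_growth:
  obtains C where "\<And>R. R \<ge> 1 \<Longrightarrow> J R 4 vort_sq \<le> C * R\<^sup>2"
proof -
  obtain C where C: "C \<ge> 0" "\<And>R. R \<ge> 1 \<Longrightarrow> J R 6 grad_vort_sq \<le> C * J R 4 vort_sq"
    using J_grad_vort_le by blast
  \<comment> \<open>As before the nine pairs of indices share one half, here of \<open>J R 4 vort_sq\<close>.\<close>
  define \<delta> where "\<delta> = 1 / (72 * (C + 1))"
  have \<delta>: "\<delta> > 0" "\<delta> * C \<le> 1/72" using C by (auto simp: \<delta>_def divide_simps)
  define K where "K = 1 / (2 * \<delta>) + 2304"
  have "J R 4 vort_sq \<le> 2 * (9 * (K * (4 * M\<^sup>2))) * R\<^sup>2" if R: "R \<ge> 1" for R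
  proof -
    have R0: "R > 0" using R by simp
    let ?X = "J R 6 grad_vort_sq" and ?Y = "J R 4 vort_sq" and ?V = "4 * M\<^sup>2 * R\<^sup>2"
    have Y0: "0 \<le> ?Y" by (intro J_nonneg R0 continuous_flow nonneg_flow) simp
    have kR: "8 / R \<le> 8" using R by (simp add: divide_simps)
    note cs = continuous_intros continuous_flow
    have U2: "J R 2 (\<lambda>x. (U j x)\<^sup>2) \<le> ?V" for j
    proof -
      have "(U j x)\<^sup>2 \<le> M\<^sup>2" for x using bound[of j x] M by (simp add: abs_le_square_iff[symmetric])
      then have "J R 2 (\<lambda>x. (U j x)\<^sup>2) \<le> J R 2 (\<lambda>x. M\<^sup>2 * 1)" by (intro J_mono R0 cs) auto
      also have "\<dots> \<le> M\<^sup>2 * (4 * R\<^sup>2)" unfolding J_cmult by (intro mult_left_mono J_one_upper R0) auto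
      finally show ?thesis by simp
    qed
    have half: "\<bar>J R 4 (\<lambda>x. vort i j x * partial_deriv p (U l) x)\<bar> \<le> 1/72 * ?Y + 1/72 * ?Y + 1/2 * (K * ?V)" for i j p l
    proof -
      have 1: "\<bar>J R 4 (\<lambda>x. vort i j x * partial_deriv p (U l) x) + J R 4 (\<lambda>x. partial_deriv p (vort i j) x * U l x)\<bar>
          \<le> 8 / R * J R 3 (\<lambda>x. \<bar>vort i j x\<bar> * \<bar>U l x\<bar>)"
        using J_parts_bound[OF R0, of 3 "vort i j" "U l" p] per_smooth_flow by simp
      have 2: "0 \<le> J R 3 (\<lambda>x. \<bar>vort i j x\<bar> * \<bar>U l x\<bar>)" by (intro J_nonneg R0 cs) auto
      have "J R 3 (\<lambda>x. \<bar>vort i j x\<bar> * \<bar>U l x\<bar>) \<le> 1/576 * J R 4 (\<lambda>x. (vort i j x)\<^sup>2) + 1 / (4 * (1/576)) * J R 2 (\<lambda>x. (U l x)\<^sup>2)"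
        by (intro J_young R0 cs) auto
      moreover have "J R 4 (\<lambda>x. (vort i j x)\<^sup>2) \<le> ?Y" by (intro J_mono R0 cs vort_le) simp
      ultimately have 3: "J R 3 (\<lambda>x. \<bar>vort i j x\<bar> * \<bar>U l x\<bar>) \<le> 1/576 * ?Y + 144 * ?V" using U2[of l] by simp
      have "8 / R * J R 3 (\<lambda>x. \<bar>vort i j x\<bar> * \<bar>U l x\<bar>) \<le> 8 * J R 3 (\<lambda>x. \<bar>vort i j x\<bar> * \<bar>U l x\<bar>)"
        by (rule mult_right_mono[OF kR 2])
      with 3 have b: "8 / R * J R 3 (\<lambda>x. \<bar>vort i j x\<bar> * \<bar>U l x\<bar>) \<le> 1/72 * ?Y + 1152 * ?V" by simp
      have "\<bar>J R 4 (\<lambda>x. partial_deriv p (vort i j) x * U l x)\<bar> \<le> J R 4 (\<lambda>x. \<bar>partial_deriv p (vort i j) x\<bar> * \<bar>U l x\<bar>)"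
        using J_abs[OF R0, of 4 "\<lambda>x. partial_deriv p (vort i j) x * U l x"] by (simp add: abs_mult cs)
      also have "\<dots> \<le> \<delta> * J R 6 (\<lambda>x. (partial_deriv p (vort i j) x)\<^sup>2) + 1 / (4 * \<delta>) * J R 2 (\<lambda>x. (U l x)\<^sup>2)"
        using \<delta> by (intro J_young R0 cs) auto
      also have "\<dots> \<le> \<delta> * (C * ?Y) + 1 / (4 * \<delta>) * ?V"
      proof (intro add_mono mult_left_mono U2)
        have "J R 6 (\<lambda>x. (partial_deriv p (vort i j) x)\<^sup>2) \<le> ?X" by (intro J_mono R0 cs grad_vort_le) simp
        then show "J R 6 (\<lambda>x. (partial_deriv p (vort i j) x)\<^sup>2) \<le> C * ?Y" using C(2)[OF R] by linarith
      qed (use \<delta> in auto)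
      also have "\<delta> * (C * ?Y) \<le> 1/72 * ?Y" using mult_right_mono[OF \<delta>(2) Y0] by (simp add: mult.assoc)
      finally have c: "\<bar>J R 4 (\<lambda>x. partial_deriv p (vort i j) x * U l x)\<bar> \<le> 1/72 * ?Y + 1 / (4 * \<delta>) * ?V" by simp
      have "1 / (4 * \<delta>) * ?V + 1152 * ?V = 1/2 * (K * ?V)" by (simp add: K_def algebra_simps)
      with 1 b c show ?thesis by linarith
    qed
    have one: "J R 4 (\<lambda>x. (vort i j x)\<^sup>2) \<le> 1/18 * ?Y + K * ?V" for i j
    proof -
      have "J R 4 (\<lambda>x. (vort i j x)\<^sup>2) = J R 4 (\<lambda>x. vort i j x * partial_deriv i (U j) x - vort i j x * partial_deriv j (U i) x)"
        by (simp add: power2_eq_square right_diff_distrib[symmetric] vort_def)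
      also have "\<dots> = J R 4 (\<lambda>x. vort i j x * partial_deriv i (U j) x) - J R 4 (\<lambda>x. vort i j x * partial_deriv j (U i) x)"
        by (rule J_diff[OF R0]) (auto intro!: cs)
      finally show ?thesis using half[of i j i j] half[of i j j i] by linarith
    qed
    have "?Y = (\<Sum>i\<in>UNIV. \<Sum>j\<in>UNIV. J R 4 (\<lambda>x. (vort i j x)\<^sup>2))"
      unfolding vort_sq_def by (intro J_sum2 R0 cs) simp
    also have "\<dots> \<le> (\<Sum>i\<in>(UNIV::3 set). \<Sum>j\<in>(UNIV::3 set). 1/18 * ?Y + K * ?V)"
      by (intro sum_mono one)
    also have "\<dots> = 1/2 * ?Y + 9 * (K * ?V)" by simp
    finally show ?thesis by (simp add: mult.assoc)
  qed
  then show thesis by (rule that)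
qed

lemma J_grad_growth:
  obtains C where "C \<ge> 0" "\<And>R. R \<ge> 1 \<Longrightarrow> J R 4 grad_sq \<le> C * R\<^sup>2"
proof -
  obtain C where C: "\<And>R. R \<ge> 1 \<Longrightarrow> J R 4 vort_sq \<le> C * R\<^sup>2" using J_vort_growth by blast
  have le: "J R 4 grad_sq \<le> (C + 12 * 4\<^sup>2 * (3 * M\<^sup>2 * 4)) * R\<^sup>2" if R: "R \<ge> 1" for R
  proof -
    have R0: "R > 0" using R by simp
    have "J R 4 grad_sq \<le> J R 4 vort_sq + 12 * 4\<^sup>2 / R\<^sup>2 * J R 2 (\<lambda>x. \<Sum>j\<in>UNIV. (U j x)\<^sup>2)"
      using J_div_curl[OF R0, of 2 U] U div by (simp add: grad_sq_def[abs_def] vort_sq_def[abs_def] vort_def[abs_def])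
    also have "12 * 4\<^sup>2 / R\<^sup>2 * J R 2 (\<lambda>x. \<Sum>j\<in>UNIV. (U j x)\<^sup>2) \<le> 12 * 4\<^sup>2 * (3 * M\<^sup>2 * (4 * R\<^sup>2))"
    proof (rule mult_mono)
      have "1 \<le> R\<^sup>2" using R by (simp add: one_le_power)
      then show "12 * 4\<^sup>2 / R\<^sup>2 \<le> 12 * 4\<^sup>2" using R0 by (simp add: divide_simps)
      have "(\<Sum>j\<in>UNIV. (U j x)\<^sup>2) \<le> (\<Sum>j\<in>(UNIV::3 set). M\<^sup>2)" for x
        using bound M by (intro sum_mono) (simp add: abs_le_square_iff[symmetric])
      then have "J R 2 (\<lambda>x. \<Sum>j\<in>UNIV. (U j x)\<^sup>2) \<le> J R 2 (\<lambda>x. 3 * M\<^sup>2 * 1)"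
        by (intro J_mono R0 continuous_intros continuous_flow) auto
      also have "\<dots> \<le> 3 * M\<^sup>2 * (4 * R\<^sup>2)" unfolding J_cmult by (intro mult_left_mono J_one_upper R0) auto
      finally show "J R 2 (\<lambda>x. \<Sum>j\<in>UNIV. (U j x)\<^sup>2) \<le> 3 * M\<^sup>2 * (4 * R\<^sup>2)" .
      show "0 \<le> J R 2 (\<lambda>x. \<Sum>j\<in>UNIV. (U j x)\<^sup>2)"
        by (intro J_nonneg R0 continuous_intros continuous_flow sum_nonneg) auto
    qed simp
    also have "J R 4 vort_sq \<le> C * R\<^sup>2" by (rule C[OF R])
    finally show ?thesis by (simp add: algebra_simps)
  qed
  have "0 \<le> J 1 4 grad_sq" by (intro J_nonneg continuous_flow nonneg_flow) auto
  then have "C + 12 * 4\<^sup>2 * (3 * M\<^sup>2 * 4) \<ge> 0" using le[of 1] by simp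
  with le show thesis using that by blast
qed

lemma J_grad_vort_growth:
  obtains C where "C \<ge> 0" "\<And>R. R \<ge> 1 \<Longrightarrow> J R 6 grad_vort_sq \<le> C * J R 4 grad_sq"
proof -
  obtain C where C: "C \<ge> 0" "\<And>R. R \<ge> 1 \<Longrightarrow> J R 6 grad_vort_sq \<le> C * J R 4 vort_sq"
    using J_grad_vort_le by blast
  have "J R 6 grad_vort_sq \<le> 4 * C * J R 4 grad_sq" if R: "R \<ge> 1" for R
  proof -
    have "J R 4 vort_sq \<le> J R 4 (\<lambda>x. 4 * grad_sq x)"
      using R by (intro J_mono continuous_intros continuous_flow vort_sq_le_grad_sq) auto
    then have "C * J R 4 vort_sq \<le> C * (4 * J R 4 grad_sq)"
      unfolding J_cmult by (rule mult_left_mono[OF _ C(1)])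
    then show ?thesis using C(2)[OF R] by linarith
  qed
  then show thesis using that[of "4 * C"] C(1) by simp
qed

lemma J_grad_Q_growth:
  obtains C where "C \<ge> 0"
    "\<And>R. R \<ge> 1 \<Longrightarrow> J R 6 (\<lambda>x. \<Sum>j\<in>UNIV. (partial_deriv j Q x)\<^sup>2) \<le> C * J R 4 grad_sq"
proof -
  obtain C where C: "C \<ge> 0" "\<And>R. R \<ge> 1 \<Longrightarrow> J R 6 grad_vort_sq \<le> C * J R 4 grad_sq"
    using J_grad_vort_growth by blast
  have "J R 6 (\<lambda>x. \<Sum>j\<in>UNIV. (partial_deriv j Q x)\<^sup>2) \<le> (6 * C + 24 * M\<^sup>2) * J R 4 grad_sq" if R: "R \<ge> 1" for R
  proof -
    have R0: "R > 0" using R by simp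
    have "J R 6 (\<lambda>x. \<Sum>j\<in>UNIV. (partial_deriv j Q x)\<^sup>2) \<le> J R 6 (\<lambda>x. 6 * grad_vort_sq x + 6 * M\<^sup>2 * vort_sq x)"
      by (intro J_mono R0 continuous_intros continuous_flow grad_Q_le) simp
    also have "\<dots> = 6 * J R 6 grad_vort_sq + 6 * M\<^sup>2 * J R 6 vort_sq"
      by (intro J_lincomb R0 continuous_flow) simp
    finally have 1: "J R 6 (\<lambda>x. \<Sum>j\<in>UNIV. (partial_deriv j Q x)\<^sup>2) \<le> 6 * J R 6 grad_vort_sq + 6 * M\<^sup>2 * J R 6 vort_sq" .
    have "J R 6 vort_sq \<le> J R 4 vort_sq"
      by (intro J_power_antimono R0 continuous_flow nonneg_flow) auto
    also have "J R 4 vort_sq \<le> J R 4 (\<lambda>x. 4 * grad_sq x)"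
      by (intro J_mono R0 continuous_intros continuous_flow vort_sq_le_grad_sq) simp
    finally have "J R 6 vort_sq \<le> 4 * J R 4 grad_sq" by (simp only: J_cmult)
    then have "6 * M\<^sup>2 * J R 6 vort_sq \<le> 6 * M\<^sup>2 * (4 * J R 4 grad_sq)" by (intro mult_left_mono) auto
    then show ?thesis using 1 C(2)[OF R] by (simp add: algebra_simps)
  qed
  then show thesis using that[of "6 * C + 24 * M\<^sup>2"] C(1) by simp
qed

end

lemma vector_3_eq: "vector [a, b, c] = a *\<^sub>R axis 1 1 + b *\<^sub>R axis 2 1 + (c *\<^sub>R axis 3 1 :: real^3)"
  by (simp add: vec_eq_iff forall_3 axis_def)

lemma frechet_derivative_eq_sum_partial:
  fixes f :: "real^'n \<Rightarrow> real"
  assumes "smooth f"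
  shows "frechet_derivative f (at x) v = (\<Sum>i\<in>UNIV. v $ i * partial_deriv i f x)"
proof -
  have lin: "linear (frechet_derivative f (at x))"
    using smooth_has_derivative[OF assms] has_derivative_linear by blast
  have "v = (\<Sum>i\<in>UNIV. v $ i *\<^sub>R axis i 1)"
    using basis_expansion[of v] by (simp add: scalar_mult_eq_scaleR)
  then have "frechet_derivative f (at x) v = frechet_derivative f (at x) (\<Sum>i\<in>UNIV. v $ i *\<^sub>R axis i 1)"
    by simp
  also have "\<dots> = (\<Sum>i\<in>UNIV. v $ i * partial_deriv i f x)"
    by (simp add: linear_sum[OF lin] linear_cmul[OF lin] partial_deriv_def)
  finally show ?thesis .
qed

lemma constant_of_partial_derivs_zero:
  fixes f :: "real^'n \<Rightarrow> real"
  assumes "smooth f" "\<And>i x. partial_deriv i f x = 0"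
  shows "f x = f y"
proof -
  have "(f has_derivative (\<lambda>v. 0)) (at z within UNIV)" for z
    using smooth_has_derivative[OF assms(1), of z]
    by (simp add: frechet_derivative_eq_sum_partial[OF assms(1), abs_def] assms(2))
  then show ?thesis using has_derivative_zero_constant[of UNIV f] by (metis UNIV_I convex_UNIV)
qed

context steady_flow
begin

section \<open>Periodicity of the pressure and the energy inequality\<close>

text \<open>The increment of \<open>Q\<close> over a period is a constant \<open>c\<close>. It is the average of \<open>\<partial>\<^sub>3 Q\<close>, which is a
  divergence; so \<open>c R\<^sup>2\<close> is bounded by a boundary term, which is \<open>O(R)\<close>.\<close>

lemma per_smooth_Q: "per_smooth Q"
proof -
  have perD: "z_periodic (partial_deriv j Q)" for j
  proof -
    have "per_smooth (\<lambda>x. (\<Sum>l\<in>UNIV. partial_deriv l (vort l j) x) - lamb j x)"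
      by (intro per_smooth_intros(4,7,8) per_smooth_vort per_smooth_lamb)
    then show ?thesis using per_smoothD(2) by (simp add: partial_deriv_Q[abs_def])
  qed
  define c where "c = Q (0 + z_shift 1) - Q 0"
  have incr: "Q (x + z_shift 1) - Q x = c" for x
  proof -
    have "((\<lambda>x. Q (x + z_shift 1) - Q x) has_derivative (\<lambda>v. 0)) (at x within UNIV)" for x
    proof -
      have "((\<lambda>x. Q (x + z_shift 1)) has_derivative frechet_derivative Q (at (x + z_shift 1))) (at x)"
        by (rule has_derivative_compose[OF _ smooth_has_derivative[OF Q]]) (auto intro!: derivative_eq_intros)
      from has_derivative_diff[OF this smooth_has_derivative[OF Q, of x]]
      show ?thesis using perD
        by (simp add: frechet_derivative_eq_sum_partial[OF Q] z_periodic_def)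
    qed
    then show ?thesis
      unfolding c_def using has_derivative_zero_constant[of UNIV "\<lambda>x. Q (x + z_shift 1) - Q x"] by (metis UNIV_I convex_UNIV)
  qed
  define F where "F x = Q x - c * x $ 3" for x
  have F: "per_smooth F"
    unfolding per_smooth_def
  proof
    show "smooth F" unfolding F_def[abs_def] by (intro smooth_diff smooth_mult Q) auto
    show "z_periodic F" unfolding z_periodic_def F_def
    proof
      fix x show "Q (x + z_shift 1) - c * (x + z_shift 1) $ 3 = Q x - c * x $ 3"
        using incr[of x] by (simp add: axis_def algebra_simps)
    qed
  qed
  have DF: "partial_deriv 3 F = (\<lambda>x. partial_deriv 3 Q x - c)"
    unfolding F_def[abs_def] using Q
    by (simp add: smooth_const smooth_mult smooth_nth partial_deriv_nth)
  obtain C where C: "C \<ge> 0" "\<And>R. R \<ge> 1 \<Longrightarrow> J R 4 grad_sq \<le> C * R\<^sup>2" using J_grad_growth by blast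
  \<comment> \<open>\<open>\<partial>\<^sub>3 Q = \<Sum>\<^sub>l \<partial>\<^sub>l G\<^sub>l + \<partial>\<^sub>3 E\<close> with periodic \<open>G\<^sub>l\<close> and \<open>E = |U|\<^sup>2 / 2\<close>.\<close>
  define G where "G l x = vort l 3 x - U l x * U 3 x" for l x
  define e where "e l x = 1/2 * (U l x * U l x)" for l x
  define E where "E x = (\<Sum>l\<in>UNIV. e l x)" for x
  have G: "per_smooth (G l)" for l
    unfolding G_def[abs_def] by (intro per_smooth_intros(3,4) U per_smooth_vort)
  have e: "per_smooth (e l)" for l
    unfolding e_def[abs_def] by (intro per_smooth_intros(1,3) U)
  have E: "per_smooth E" unfolding E_def[abs_def] by (intro per_smooth_intros(7) e)
  have D3: "partial_deriv 3 Q x = (\<Sum>l\<in>UNIV. partial_deriv l (G l) x) + partial_deriv 3 E x" for x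
  proof -
    have "partial_deriv l (G l) x = partial_deriv l (vort l 3) x - (U l x * partial_deriv l (U 3) x + partial_deriv l (U l) x * U 3 x)" for l
      unfolding G_def[abs_def] by (simp add: smooth_flow smooth_mult)
    moreover have "partial_deriv 3 E x = (\<Sum>l\<in>UNIV. U l x * partial_deriv 3 (U l) x)"
    proof -
      have "partial_deriv 3 (e l) x = U l x * partial_deriv 3 (U l) x" for l
        unfolding e_def[abs_def] partial_deriv_mult[OF smooth_const smooth_mult[OF smooth_flow(1) smooth_flow(1)]]
          partial_deriv_mult[OF smooth_flow(1) smooth_flow(1)] partial_deriv_const by simp
      then show ?thesis unfolding E_def[abs_def] by (simp add: per_smoothD(1)[OF e])
    qed
    ultimately show ?thesis
      unfolding partial_deriv_Q lamb_def vort_def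
      by (simp add: sum_subtractf sum.distrib sum_distrib_right[symmetric] div right_diff_distrib)
  qed
  define K where "K = 36 * (4 * C + 4 * (1 + M\<^sup>2))"
  have le: "\<bar>c\<bar> * (1/2) ^ 6 * R \<le> K" if R: "R \<ge> 1" for R
  proof -
    have R0: "R > 0" using R by simp
    have "J R 6 (\<lambda>x. partial_deriv 3 Q x - c) = 0"
      using J_partial_deriv[OF R0, of 5 F 3] F by (simp add: DF horizontal_def)
    then have "c * J R 6 (\<lambda>x. 1) = J R 6 (partial_deriv 3 Q)"
      using J_diff[OF R0, of 6 "partial_deriv 3 Q" "\<lambda>x. c * 1"] J_cmult[of R 6 c "\<lambda>x. 1"]
      by (simp add: continuous_flow)
    also have "\<dots> = J R 6 (\<lambda>x. \<Sum>l\<in>UNIV. partial_deriv l (G l) x) + J R 6 (partial_deriv 3 E)"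
      unfolding D3[abs_def]
      by (rule J_add[OF R0]) (auto intro!: continuous_intros per_smooth_continuous per_smooth_intros(8) G E)
    also have "J R 6 (partial_deriv 3 E) = 0"
      using J_partial_deriv[OF R0, of 5 E 3] E by (simp add: horizontal_def)
    also have "J R 6 (\<lambda>x. \<Sum>l\<in>UNIV. partial_deriv l (G l) x) = (\<Sum>l\<in>UNIV. J R 6 (partial_deriv l (G l)))"
      by (intro J_sum R0 per_smooth_continuous per_smooth_intros(8) G) simp
    finally have "\<bar>c\<bar> * J R 6 (\<lambda>x. 1) = \<bar>\<Sum>l\<in>UNIV. J R 6 (partial_deriv l (G l))\<bar>"
      using J_nonneg[OF R0, of 6 "\<lambda>x. 1"] by (metis abs_mult abs_of_nonneg add.right_neutral continuous_on_const zero_le_one zero_less_numeral)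
    also have "\<dots> \<le> (\<Sum>l\<in>UNIV. \<bar>J R 6 (partial_deriv l (G l))\<bar>)" by (rule sum_abs)
    also have "\<dots> \<le> (\<Sum>l\<in>(UNIV::3 set). 12 / R * ((4 * C + 4 * (1 + M\<^sup>2)) * R\<^sup>2))"
    proof (rule sum_mono)
      fix l
      have "\<bar>J R 6 (partial_deriv l (G l))\<bar> \<le> 12 / R * J R 5 (\<lambda>x. \<bar>G l x\<bar>)"
        using J_partial_deriv_bound[OF R0, of 5 "G l" l] G by simp
      also have "\<dots> \<le> 12 / R * ((4 * C + 4 * (1 + M\<^sup>2)) * R\<^sup>2)"
      proof (rule mult_left_mono)
        have "J R 5 (\<lambda>x. \<bar>G l x\<bar>) \<le> J R 5 (\<lambda>x. 4 * grad_sq x + (1 + M\<^sup>2) * 1)"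
        proof (rule J_mono[OF R0])
          fix x
          have "\<bar>vort l 3 x\<bar> \<le> (vort l 3 x)\<^sup>2 + 1"
            using zero_le_power2[of "\<bar>vort l 3 x\<bar> - 1/2"] by (simp add: power2_diff) (simp add: power2_eq_square)
          moreover have "(vort l 3 x)\<^sup>2 \<le> 4 * grad_sq x" using vort_le[of l 3 x] vort_sq_le_grad_sq[of x] by linarith
          moreover have "\<bar>U l x * U 3 x\<bar> \<le> M\<^sup>2"
            unfolding abs_mult power2_eq_square using bound M by (intro mult_mono) auto
          ultimately show "\<bar>G l x\<bar> \<le> 4 * grad_sq x + (1 + M\<^sup>2) * 1"
            unfolding G_def using abs_triangle_ineq4[of "vort l 3 x" "U l x * U 3 x"] by simp
        qed (auto intro!: continuous_intros continuous_flow per_smooth_continuous[OF G])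
        also have "\<dots> = 4 * J R 5 grad_sq + (1 + M\<^sup>2) * J R 5 (\<lambda>x. 1)"
          by (intro J_lincomb R0 continuous_intros continuous_flow) simp
        also have "\<dots> \<le> 4 * (C * R\<^sup>2) + (1 + M\<^sup>2) * (4 * R\<^sup>2)"
        proof (intro add_mono mult_left_mono J_one_upper R0)
          have "J R 5 grad_sq \<le> J R 4 grad_sq" by (intro J_power_antimono R0 continuous_flow nonneg_flow) auto
          then show "J R 5 grad_sq \<le> C * R\<^sup>2" using C(2)[OF R] by linarith
        qed auto
        finally show "J R 5 (\<lambda>x. \<bar>G l x\<bar>) \<le> (4 * C + 4 * (1 + M\<^sup>2)) * R\<^sup>2" by (simp add: algebra_simps)
      qed (use R0 in simp)
      finally show "\<bar>J R 6 (partial_deriv l (G l))\<bar> \<le> 12 / R * ((4 * C + 4 * (1 + M\<^sup>2)) * R\<^sup>2)" .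
    qed
    also have "\<dots> = K * R" using R0 by (simp add: K_def power2_eq_square)
    finally have "\<bar>c\<bar> * J R 6 (\<lambda>x. 1) \<le> K * R" .
    moreover have "\<bar>c\<bar> * ((1/2) ^ 6 * R\<^sup>2) \<le> \<bar>c\<bar> * J R 6 (\<lambda>x. 1)"
      by (intro mult_left_mono J_one_lower R0) auto
    ultimately have "(\<bar>c\<bar> * (1/2) ^ 6 * R) * R \<le> K * R" by (simp add: power2_eq_square mult.assoc)
    then show ?thesis using R0 by (simp add: mult_le_cancel_right)
  qed
  have "c = 0"
  proof (rule ccontr)
    assume "c \<noteq> 0"
    define R where "R = max 1 (64 * (\<bar>K\<bar> + 1) / \<bar>c\<bar>)"
    have "64 * (\<bar>K\<bar> + 1) / \<bar>c\<bar> \<le> R" by (simp add: R_def)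
    then have "64 * (\<bar>K\<bar> + 1) \<le> \<bar>c\<bar> * R" using \<open>c \<noteq> 0\<close> by (simp add: field_simps)
    moreover have "\<bar>c\<bar> * R \<le> 64 * K"
    proof -
      have "R \<ge> 1" by (simp add: R_def)
      then show ?thesis using le[of R] by (simp add: power_divide)
    qed
    ultimately show False by simp
  qed
  then have "F = Q" by (simp add: F_def[abs_def])
  with F show ?thesis by simp
qed

text \<open>The Lamb vector is orthogonal to \<open>U\<close>, and \<open>U \<cdot> \<nabla>Q\<close> is the divergence of \<open>Q U\<close>. So both terms on the
  right come from derivatives of the cutoff.\<close>

lemma J_energy:
  assumes R: "R > 0"
  shows "J R 7 grad_sq \<le> 14 / R * J R 6 (\<lambda>x. \<Sum>i\<in>UNIV. \<Sum>j\<in>UNIV. \<bar>partial_deriv i (U j) x\<bar> * \<bar>U j x\<bar>)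
    + 14 / R\<^sup>2 * \<bar>J R 6 (\<lambda>x. Q x * radial_flux U x)\<bar>"
proof -
  note cs = continuous_intros continuous_flow per_smooth_continuous[OF per_smooth_Q]
    per_smooth_continuous[OF per_smooth_intros(8)[OF per_smooth_intros(8)[OF U]]]
    per_smooth_continuous[OF per_smooth_horizontal]
  have parts: "J R 7 (\<lambda>x. (partial_deriv i (U j) x)\<^sup>2) \<le>
      14 / R * J R 6 (\<lambda>x. \<bar>partial_deriv i (U j) x\<bar> * \<bar>U j x\<bar>) - J R 7 (\<lambda>x. partial_deriv i (partial_deriv i (U j)) x * U j x)" for i j
    using J_parts_bound[OF R _ per_smooth_intros(8)[OF U] U, of 6 i j i j]
    by (simp add: power2_eq_square abs_le_iff)
  have "J R 7 grad_sq = (\<Sum>i\<in>UNIV. \<Sum>j\<in>UNIV. J R 7 (\<lambda>x. (partial_deriv i (U j) x)\<^sup>2))"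
    unfolding grad_sq_def by (intro J_sum2 R cs) simp
  also have "\<dots> \<le> (\<Sum>i\<in>UNIV. \<Sum>j\<in>UNIV. 14 / R * J R 6 (\<lambda>x. \<bar>partial_deriv i (U j) x\<bar> * \<bar>U j x\<bar>)
      - J R 7 (\<lambda>x. partial_deriv i (partial_deriv i (U j)) x * U j x))"
    by (intro sum_mono parts)
  also have "\<dots> = 14 / R * (\<Sum>i\<in>UNIV. \<Sum>j\<in>UNIV. J R 6 (\<lambda>x. \<bar>partial_deriv i (U j) x\<bar> * \<bar>U j x\<bar>))
      - (\<Sum>i\<in>UNIV. \<Sum>j\<in>UNIV. J R 7 (\<lambda>x. partial_deriv i (partial_deriv i (U j)) x * U j x))"
    by (simp only: sum_subtractf sum_distrib_left)
  also have "(\<Sum>i\<in>UNIV. \<Sum>j\<in>UNIV. J R 6 (\<lambda>x. \<bar>partial_deriv i (U j) x\<bar> * \<bar>U j x\<bar>)) =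
      J R 6 (\<lambda>x. \<Sum>i\<in>UNIV. \<Sum>j\<in>UNIV. \<bar>partial_deriv i (U j) x\<bar> * \<bar>U j x\<bar>)"
    by (intro J_sum2[symmetric] R cs) simp
  also have "(\<Sum>i\<in>UNIV. \<Sum>j\<in>UNIV. J R 7 (\<lambda>x. partial_deriv i (partial_deriv i (U j)) x * U j x)) =
      14 / R\<^sup>2 * J R 6 (\<lambda>x. Q x * radial_flux U x)"
  proof -
    have "(\<Sum>i\<in>UNIV. \<Sum>j\<in>UNIV. J R 7 (\<lambda>x. partial_deriv i (partial_deriv i (U j)) x * U j x)) =
        J R 7 (\<lambda>x. \<Sum>i\<in>UNIV. \<Sum>j\<in>UNIV. partial_deriv i (partial_deriv i (U j)) x * U j x)"
      by (intro J_sum2[symmetric] R cs) simp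
    also have "\<dots> = J R 7 (\<lambda>x. \<Sum>j\<in>UNIV. U j x * partial_deriv j Q x)"
    proof (rule arg_cong[where f = "J R 7"], rule ext)
      fix x
      have "(\<Sum>i\<in>UNIV. \<Sum>j\<in>UNIV. partial_deriv i (partial_deriv i (U j)) x * U j x) =
          (\<Sum>j\<in>UNIV. (\<Sum>i\<in>UNIV. partial_deriv i (partial_deriv i (U j)) x) * U j x)"
        unfolding sum_distrib_right by (rule sum.swap)
      also have "\<dots> = (\<Sum>j\<in>UNIV. lamb j x * U j x) + (\<Sum>j\<in>UNIV. U j x * partial_deriv j Q x)"
        unfolding momentum lamb_def vort_def by (simp add: distrib_right distrib_left sum.distrib mult.commute)
      also have "(\<Sum>j\<in>UNIV. lamb j x * U j x) = 0"
        unfolding lamb_def vort_def sum_3 by (simp add: algebra_simps)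
      finally show "(\<Sum>i\<in>UNIV. \<Sum>j\<in>UNIV. partial_deriv i (partial_deriv i (U j)) x * U j x) =
          (\<Sum>j\<in>UNIV. U j x * partial_deriv j Q x)" by simp
    qed
    also have "\<dots> = (\<Sum>j\<in>UNIV. J R 7 (\<lambda>x. U j x * partial_deriv j Q x))"
      by (intro J_sum R cs) simp
    also have "\<dots> = (\<Sum>j\<in>UNIV. 14 / R\<^sup>2 * J R 6 (\<lambda>x. horizontal j x * (U j x * Q x)) - J R 7 (\<lambda>x. partial_deriv j (U j) x * Q x))"
      using J_parts[OF R _ U per_smooth_Q, of 6] by (intro sum.cong) auto
    also have "\<dots> = 14 / R\<^sup>2 * (\<Sum>j\<in>UNIV. J R 6 (\<lambda>x. horizontal j x * (U j x * Q x))) - (\<Sum>j\<in>UNIV. J R 7 (\<lambda>x. partial_deriv j (U j) x * Q x))"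
      by (simp only: sum_subtractf sum_distrib_left)
    also have "(\<Sum>j\<in>UNIV. J R 7 (\<lambda>x. partial_deriv j (U j) x * Q x)) = J R 7 (\<lambda>x. \<Sum>j\<in>UNIV. partial_deriv j (U j) x * Q x)"
      by (intro J_sum[symmetric] R cs) simp
    also have "\<dots> = 0" by (simp add: sum_distrib_right[symmetric] div)
    also have "(\<Sum>j\<in>UNIV. J R 6 (\<lambda>x. horizontal j x * (U j x * Q x))) = J R 6 (\<lambda>x. \<Sum>j\<in>UNIV. horizontal j x * (U j x * Q x))"
      by (intro J_sum[symmetric] R cs) simp
    also have "(\<lambda>x. \<Sum>j\<in>UNIV. horizontal j x * (U j x * Q x)) = (\<lambda>x. Q x * radial_flux U x)"
      by (auto simp: radial_flux_eq_sum sum_distrib_left algebra_simps)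
    finally show ?thesis by simp
  qed
  also have "14 / R * J R 6 (\<lambda>x. \<Sum>i\<in>UNIV. \<Sum>j\<in>UNIV. \<bar>partial_deriv i (U j) x\<bar> * \<bar>U j x\<bar>) - 14 / R\<^sup>2 * J R 6 (\<lambda>x. Q x * radial_flux U x)
      \<le> 14 / R * J R 6 (\<lambda>x. \<Sum>i\<in>UNIV. \<Sum>j\<in>UNIV. \<bar>partial_deriv i (U j) x\<bar> * \<bar>U j x\<bar>) + 14 / R\<^sup>2 * \<bar>J R 6 (\<lambda>x. Q x * radial_flux U x)\<bar>"
  proof -
    have "14 / R\<^sup>2 * (- J R 6 (\<lambda>x. Q x * radial_flux U x)) \<le> 14 / R\<^sup>2 * \<bar>J R 6 (\<lambda>x. Q x * radial_flux U x)\<bar>"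
      by (intro mult_left_mono) auto
    then show ?thesis by simp
  qed
  finally show ?thesis .
qed

text \<open>So everything hinges on the work \<open>Q U\<^sup>r\<close> of the Bernoulli function.\<close>

lemma liouville_of_work:
  assumes work: "\<And>\<epsilon>. \<epsilon> > 0 \<Longrightarrow> \<exists>R0. \<forall>R\<ge>R0.
      14 / R\<^sup>2 * \<bar>J R 6 (\<lambda>x. Q x * radial_flux U x)\<bar> \<le> \<epsilon> * (J (2 * R) 7 grad_sq + 1)"
  shows "partial_deriv i (U j) x = 0"
proof -
  let ?h = "\<lambda>x. \<Sum>i\<in>UNIV. \<Sum>j\<in>UNIV. \<bar>partial_deriv i (U j) x\<bar> * \<bar>U j x\<bar>"
  obtain C where C: "C \<ge> 0" "\<And>R. R \<ge> 1 \<Longrightarrow> J R 4 grad_sq \<le> C * R\<^sup>2" using J_grad_growth by blast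
  have "grad_sq x = 0"
  proof (rule liouville_scheme[where h = ?h and e = "\<lambda>_. 9 * M\<^sup>2" and C = 14 and A = "36 * M\<^sup>2" and A' = C])
    fix \<mu> :: real and x :: "real^3" assume \<mu>: "\<mu> > 0"
    have "?h x \<le> (\<Sum>i\<in>UNIV. \<Sum>j\<in>UNIV. \<mu> * (partial_deriv i (U j) x)\<^sup>2 + M\<^sup>2 / \<mu>)"
    proof (intro sum_mono)
      fix i j
      let ?a = "\<bar>partial_deriv i (U j) x\<bar>"
      have "?a * \<bar>U j x\<bar> \<le> ?a * M" using bound by (intro mult_left_mono) auto
      also have "?a * M \<le> \<mu> * ?a\<^sup>2 + M\<^sup>2 / \<mu>"
      proof -
        have "2 * (\<mu> * ?a * M) \<le> \<mu>\<^sup>2 * ?a\<^sup>2 + M\<^sup>2"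
          using zero_le_power2[of "\<mu> * ?a - M"] by (simp add: power2_diff power_mult_distrib)
        moreover have "0 \<le> \<mu> * ?a * M" using \<mu> M by simp
        ultimately have "\<mu> * (?a * M) \<le> \<mu> * (\<mu> * ?a\<^sup>2 + M\<^sup>2 / \<mu>)"
          using \<mu> by (simp add: distrib_left power2_eq_square mult.assoc)
        then show ?thesis using \<mu> by simp
      qed
      finally show "?a * \<bar>U j x\<bar> \<le> \<mu> * (partial_deriv i (U j) x)\<^sup>2 + M\<^sup>2 / \<mu>" by simp
    qed
    also have "\<dots> = \<mu> * grad_sq x + 9 * M\<^sup>2 / \<mu>"
      by (simp add: sum.distrib sum_distrib_left grad_sq_def)
    finally show "?h x \<le> \<mu> * grad_sq x + 9 * M\<^sup>2 / \<mu>" .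
  next
    fix R :: real assume R: "R \<ge> 1"
    have "J R 6 (\<lambda>x. 9 * M\<^sup>2 * 1) \<le> 9 * M\<^sup>2 * (4 * R\<^sup>2)"
      unfolding J_cmult using R by (intro mult_left_mono J_one_upper) auto
    then show "J R 6 (\<lambda>x. 9 * M\<^sup>2) \<le> 36 * M\<^sup>2 * R\<^sup>2" by simp
    have "J R 7 grad_sq \<le> J R 4 grad_sq" using R by (intro J_power_antimono continuous_flow nonneg_flow) auto
    then show "J R 7 grad_sq \<le> C * R\<^sup>2" using C(2)[OF R] by linarith
  next
    fix \<epsilon> :: real assume "\<epsilon> > 0"
    from work[OF this] obtain R0 where R0: "\<And>R. R \<ge> R0 \<Longrightarrow>
      14 / R\<^sup>2 * \<bar>J R 6 (\<lambda>x. Q x * radial_flux U x)\<bar> \<le> \<epsilon> * (J (2 * R) 7 grad_sq + 1)" by auto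
    show "\<exists>R0. \<forall>R\<ge>R0. J R 7 grad_sq \<le> 14 / R * J R 6 ?h + \<epsilon> * (J (2 * R) 7 grad_sq + 1)"
    proof (intro exI[of _ "max 1 R0"] allI impI)
      fix R assume "R \<ge> max 1 R0"
      then show "J R 7 grad_sq \<le> 14 / R * J R 6 ?h + \<epsilon> * (J (2 * R) 7 grad_sq + 1)"
        using J_energy[of R] R0[of R] by auto
    qed
  qed (auto intro!: continuous_intros continuous_flow sum_nonneg nonneg_flow per_smoothD(2) per_smooth_flow)
  then show ?thesis using grad_le[of i j x] by simp
qed

section \<open>Symmetric flows\<close>

text \<open>If \<open>r U\<^sup>r\<close> has mean zero on the fibres, the work pairs it with the oscillation of \<open>Q\<close> only. Pairing with
  weight \<open>R\<close>, the contribution of \<open>\<partial>\<^sub>3 Q\<close> and that of \<open>\<partial>\<^sub>3 (r U\<^sup>r)\<close>, which carries a factor \<open>r \<le> R\<close>, are both of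
  order \<open>R\<close> times the energy; dividing by \<open>R\<^sup>2\<close> makes the work negligible.\<close>

lemma liouville_fibre_flux:
  assumes mean: "\<And>x. fibre_mean (radial_flux U) x = 0"
  shows "partial_deriv i (U j) x = 0"
proof (rule liouville_of_work)
  fix \<epsilon> :: real assume \<epsilon>: "\<epsilon> > 0"
  obtain C where C: "C \<ge> 0"
    "\<And>R. R \<ge> 1 \<Longrightarrow> J R 6 (\<lambda>x. \<Sum>j\<in>UNIV. (partial_deriv j Q x)\<^sup>2) \<le> C * J R 4 grad_sq"
    using J_grad_Q_growth by blast
  define q where "q = (4/3::real) ^ 7"
  have q: "q > 0" by (simp add: q_def)
  define K where "K = 7 * (C + 2) * q"
  have K: "K \<ge> 0" using C q by (simp add: K_def)
  have v: "per_smooth (radial_flux U)" by (rule per_smooth_radial_flux[OF U])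
  have dv: "partial_deriv 3 (radial_flux U) x = radial_flux (\<lambda>i. partial_deriv 3 (U i)) x" for x
    unfolding radial_flux_def[abs_def]
    by (simp add: smooth_flow smooth_mult smooth_nth partial_deriv_nth)
  have le: "14 / R\<^sup>2 * \<bar>J R 6 (\<lambda>x. Q x * radial_flux U x)\<bar> \<le> K / R * J (2 * R) 7 grad_sq" if R: "R \<ge> 1" for R
  proof -
    have R0: "R > 0" using R by simp
    note cs = continuous_intros continuous_flow per_smooth_continuous[OF per_smooth_intros(8)[OF v]]
    have 1: "J R 6 (\<lambda>x. (partial_deriv 3 Q x)\<^sup>2) \<le> C * J R 4 grad_sq"
    proof -
      have "J R 6 (\<lambda>x. (partial_deriv 3 Q x)\<^sup>2) \<le> J R 6 (\<lambda>x. \<Sum>j\<in>UNIV. (partial_deriv j Q x)\<^sup>2)"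
        by (intro J_mono R0 cs component_le_sum_sq[of "\<lambda>j. partial_deriv j Q _"]) simp
      then show ?thesis using C(2)[OF R] by linarith
    qed
    have 2: "J R 6 (\<lambda>x. (partial_deriv 3 (radial_flux U) x)\<^sup>2) \<le> 2 * R\<^sup>2 * J R 4 grad_sq"
    proof -
      have "J R 6 (\<lambda>x. (partial_deriv 3 (radial_flux U) x)\<^sup>2) \<le> J R 6 (\<lambda>x. 2 * R\<^sup>2 * grad_sq x)"
      proof (intro J_mono R0 cs)
        fix x assume x: "0 < cutoff R x"
        let ?a = "partial_deriv 3 (U 1) x" and ?b = "partial_deriv 3 (U 2) x"
        have "(x $ 1)\<^sup>2 + (x $ 2)\<^sup>2 \<le> R\<^sup>2" using cutoff_positiveD(1)[OF x R0] by simp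
        moreover have "?a\<^sup>2 + ?b\<^sup>2 \<le> 2 * grad_sq x" using grad_le[of 3 1 x] grad_le[of 3 2 x] by simp
        ultimately have "((x $ 1)\<^sup>2 + (x $ 2)\<^sup>2) * (?a\<^sup>2 + ?b\<^sup>2) \<le> R\<^sup>2 * (2 * grad_sq x)"
          by (intro mult_mono) auto
        moreover have "(x $ 1 * ?a + x $ 2 * ?b)\<^sup>2 \<le> ((x $ 1)\<^sup>2 + (x $ 2)\<^sup>2) * (?a\<^sup>2 + ?b\<^sup>2)"
          using zero_le_power2[of "x $ 1 * ?b - x $ 2 * ?a"] by (simp add: power2_eq_square algebra_simps)
        ultimately show "(partial_deriv 3 (radial_flux U) x)\<^sup>2 \<le> 2 * R\<^sup>2 * grad_sq x"
          unfolding dv radial_flux_def by simp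
      qed simp
      also have "\<dots> \<le> 2 * R\<^sup>2 * J R 4 grad_sq"
        unfolding J_cmult by (intro mult_left_mono J_power_antimono R0 continuous_flow nonneg_flow) auto
      finally show ?thesis .
    qed
    have "\<bar>J R 6 (\<lambda>x. Q x * radial_flux U x)\<bar> \<le>
        R / 2 * J R 6 (\<lambda>x. (partial_deriv 3 Q x)\<^sup>2) + 1 / (2 * R) * J R 6 (\<lambda>x. (partial_deriv 3 (radial_flux U) x)\<^sup>2)"
      by (intro J_pairing R0 per_smooth_Q v mean) simp
    also have "\<dots> \<le> R / 2 * (C * J R 4 grad_sq) + 1 / (2 * R) * (2 * R\<^sup>2 * J R 4 grad_sq)"
      using R0 by (intro add_mono mult_left_mono 1 2) auto
    also have "\<dots> = R / 2 * (C + 2) * J R 4 grad_sq" using R0 by (simp add: power2_eq_square field_simps)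
    also have "\<dots> \<le> R / 2 * (C + 2) * (q * J (2 * R) 7 grad_sq)"
      unfolding q_def using R0 C(1) by (intro mult_left_mono J_double continuous_flow nonneg_flow) auto
    finally have "14 / R\<^sup>2 * \<bar>J R 6 (\<lambda>x. Q x * radial_flux U x)\<bar> \<le> 14 / R\<^sup>2 * (R / 2 * (C + 2) * (q * J (2 * R) 7 grad_sq))"
      by (intro mult_left_mono) auto
    also have "\<dots> = K / R * J (2 * R) 7 grad_sq" using R0 by (simp add: K_def power2_eq_square)
    finally show ?thesis .
  qed
  show "\<exists>R0. \<forall>R\<ge>R0. 14 / R\<^sup>2 * \<bar>J R 6 (\<lambda>x. Q x * radial_flux U x)\<bar> \<le> \<epsilon> * (J (2 * R) 7 grad_sq + 1)"
  proof (intro exI[of _ "max 1 (K / \<epsilon>)"] allI impI)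
    fix R assume R: "R \<ge> max 1 (K / \<epsilon>)"
    then have "K / R \<le> \<epsilon>" using \<epsilon> by (simp add: field_simps)
    moreover have "0 \<le> J (2 * R) 7 grad_sq" using R by (intro J_nonneg continuous_flow nonneg_flow) auto
    ultimately have "K / R * J (2 * R) 7 grad_sq \<le> \<epsilon> * (J (2 * R) 7 grad_sq + 1)"
      using \<epsilon> by (intro mult_mono) auto
    then show "14 / R\<^sup>2 * \<bar>J R 6 (\<lambda>x. Q x * radial_flux U x)\<bar> \<le> \<epsilon> * (J (2 * R) 7 grad_sq + 1)"
      using le[of R] R by simp
  qed
qed

text \<open>If the fibre mean of the flux density is a radial function, it may itself be used as the radial
  weight in the vanishing of the flux.\<close>

lemma fibre_mean_radial_flux_zero:
  assumes sym: "\<And>x. fibre_mean (radial_flux U) x = fibre_mean (radial_flux U) (vector [sqrt (horizontal_sq x), 0, 0])"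
  shows "fibre_mean (radial_flux U) x = 0"
proof -
  let ?v = "radial_flux U"
  define m where "m = fibre_mean ?v"
  define g where "g t = m (vector [sqrt t, 0, 0])" for t
  have v: "per_smooth ?v" by (rule per_smooth_radial_flux[OF U])
  have cm: "continuous_on UNIV m" unfolding m_def by (rule continuous_on_fibre_mean[OF v])
  have cg: "continuous_on UNIV g"
  proof -
    have "continuous_on UNIV (\<lambda>t. vector [sqrt t, 0, 0] :: real^3)"
      unfolding vector_3_eq by (intro continuous_intros)
    then show ?thesis unfolding g_def[abs_def] by (intro continuous_on_compose2[OF cm]) auto
  qed
  have mg: "m x = g (horizontal_sq x)" for x using sym by (simp add: m_def g_def)
  have chs: "continuous_on UNIV horizontal_sq"
    unfolding horizontal_sq_def[abs_def] by (intro continuous_intros)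
  have hs: "horizontal_sq (x + z_shift t) = horizontal_sq x" for x t by (simp add: horizontal_sq_def axis_def)
  define R where "R = \<bar>x $ 1\<bar> + \<bar>x $ 2\<bar> + 1"
  have R: "R > 0" by (simp add: R_def)
  have "J R 1 (\<lambda>x. (m x)\<^sup>2) = J R 1 (\<lambda>x. integral {0..1} (\<lambda>t. g (horizontal_sq (x + z_shift t)) * ?v (x + z_shift t)))"
    unfolding hs by (simp add: mg power2_eq_square) (simp add: mg[symmetric] m_def fibre_mean_def)
  also have "\<dots> = J R 1 (\<lambda>x. g (horizontal_sq x) * ?v x)"
    using per_smoothD(2)[OF v]
    by (intro J_fibre_average[OF R] continuous_intros continuous_on_compose2[OF cg chs] per_smooth_continuous[OF v])
       (auto simp: z_periodic_def hs[of _ 1, simplified])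
  also have "\<dots> = 0" using J_radial_flux_zero[OF R _ U div cg] by simp
  finally have 0: "J R 1 (\<lambda>x. (m x)\<^sup>2) = 0" .
  have "(m x)\<^sup>2 = 0"
  proof (rule J_eq_0D[OF R _ _ _ _ 0])
    show "z_periodic (\<lambda>x. (m x)\<^sup>2)" by (simp add: mg z_periodic_def hs[of _ 1, simplified])
    have "(x $ 1)\<^sup>2 + (x $ 2)\<^sup>2 \<le> (\<bar>x $ 1\<bar> + \<bar>x $ 2\<bar>)\<^sup>2" by (simp add: power2_sum)
    also have "\<dots> < R\<^sup>2" unfolding R_def by (intro power_strict_mono) auto
    finally show "cutoff R x > 0" using R by (simp add: cutoff_def max_def divide_simps)
  qed (auto intro!: continuous_intros cm)
  then show ?thesis by (simp add: m_def)
qed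

end

lemma fibre_mean_z_shift:
  assumes "continuous_on UNIV F" "z_periodic F"
  shows "fibre_mean F (x + z_shift s) = fibre_mean F x"
proof -
  let ?g = "\<lambda>t. F (x + z_shift t)"
  have c: "continuous_on S ?g" for S
    by (intro continuous_on_compose2[OF assms(1)] continuous_intros) auto
  have per: "?g (t + 1) = ?g t" for t
    using assms(2) by (simp add: z_periodic_def scaleR_left_distrib add.assoc[symmetric])
  have "fibre_mean F (x + z_shift s) = integral {0..1} (?g \<circ> (\<lambda>t. t + s))"
    by (simp add: fibre_mean_def o_def scaleR_left_distrib algebra_simps)
  also have "\<dots> = integral {s..s+1} ?g"
    using integral_shift[of 0 s 1 ?g] c by (simp add: add.commute)
  also have "\<dots> = fibre_mean F x"
    unfolding fibre_mean_def by (rule integral_period_shift[OF c per])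
  finally show ?thesis .
qed

lemma cyl_point_nth [simp]: "cyl_point r \<theta> z $ 1 = r * cos \<theta>" "cyl_point r \<theta> z $ 2 = r * sin \<theta>"
  "cyl_point r \<theta> z $ 3 = z"
  by (simp_all add: cyl_point_def)

lemma cylindrical_coordinates:
  obtains \<theta> where "0 \<le> \<theta>" "\<theta> < 2 * pi" "x = cyl_point (sqrt (horizontal_sq x)) \<theta> (x $ 3)"
proof -
  let ?r = "sqrt (horizontal_sq x)"
  have r2: "?r\<^sup>2 = (x $ 1)\<^sup>2 + (x $ 2)\<^sup>2" by (simp add: horizontal_sq_def)
  show thesis
  proof (cases "?r = 0")
    case True
    then have "x $ 1 = 0" "x $ 2 = 0" using r2 by (auto simp: sum_power2_eq_zero_iff)
    then show thesis using that[of 0] True by (simp add: vec_eq_iff forall_3)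
  next
    case False
    then have "(x $ 1 / ?r)\<^sup>2 + (x $ 2 / ?r)\<^sup>2 = 1"
      unfolding power_divide add_divide_distrib[symmetric] r2[symmetric] by simp
    then obtain \<theta> where "0 \<le> \<theta>" "\<theta> < 2 * pi" "x $ 1 / ?r = cos \<theta>" "x $ 2 / ?r = sin \<theta>"
      by (rule sincos_total_2pi)
    then show thesis using False by (intro that[of \<theta>]) (auto simp: vec_eq_iff forall_3 field_simps)
  qed
qed

lemma cyl_point_z_shift: "cyl_point r \<theta> z + z_shift t = cyl_point r \<theta> (z + t)"
  by (simp add: vec_eq_iff forall_3 axis_def)

lemma smooth_has_real_derivative_along:
  assumes "smooth f" and \<gamma>: "(\<gamma> has_vector_derivative v) (at t)"
  shows "((\<lambda>t. f (\<gamma> t)) has_real_derivative (\<Sum>i\<in>UNIV. v $ i * partial_deriv i f (\<gamma> t))) (at t)"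
proof -
  have "((\<lambda>t. f (\<gamma> t)) has_derivative (\<lambda>h. frechet_derivative f (at (\<gamma> t)) (h *\<^sub>R v))) (at t)"
    using has_derivative_compose[OF \<gamma>[unfolded has_vector_derivative_def] smooth_has_derivative[OF assms(1)]] .
  moreover have "frechet_derivative f (at (\<gamma> t)) (h *\<^sub>R v) = (\<Sum>i\<in>UNIV. v $ i * partial_deriv i f (\<gamma> t)) * h" for h
    unfolding frechet_derivative_eq_sum_partial[OF assms(1)] sum_distrib_right by (simp add: ac_simps)
  ultimately show ?thesis by (simp add: has_field_derivative_def)
qed

lemma cyl_point_derivatives:
  "((\<lambda>r. cyl_point r \<theta> z) has_vector_derivative vector [cos \<theta>, sin \<theta>, 0]) (at r)"
  "((\<lambda>\<theta>. cyl_point r \<theta> z) has_vector_derivative vector [- r * sin \<theta>, r * cos \<theta>, 0]) (at \<theta>)"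
  unfolding cyl_point_def vector_3_eq by (auto intro!: derivative_eq_intros simp: mult.commute)

lemma smooth_cyl_derivatives:
  assumes "smooth f"
  shows "((\<lambda>r. f (cyl_point r \<theta> z)) has_real_derivative
      (cos \<theta> * partial_deriv 1 f (cyl_point r \<theta> z) + sin \<theta> * partial_deriv 2 f (cyl_point r \<theta> z))) (at r)"
    and "((\<lambda>\<theta>. f (cyl_point r \<theta> z)) has_real_derivative
      r * (cos \<theta> * partial_deriv 2 f (cyl_point r \<theta> z) - sin \<theta> * partial_deriv 1 f (cyl_point r \<theta> z))) (at \<theta>)"
  using smooth_has_real_derivative_along[OF assms cyl_point_derivatives(1)[of \<theta> z r]]
    smooth_has_real_derivative_along[OF assms cyl_point_derivatives(2)[of r z \<theta>]]
  by (simp_all add: sum_3 algebra_simps)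

context steady_flow
begin

lemma radial_flux_cyl: "radial_flux U (cyl_point r \<theta> z) =
    r * (cos \<theta> * U 1 (cyl_point r \<theta> z) + sin \<theta> * U 2 (cyl_point r \<theta> z))"
  by (simp add: radial_flux_def algebra_simps)

text \<open>If the swirl does not depend on the angle, then incompressibility reads
  \<open>\<partial>\<^sub>r (r U\<^sup>r) + r \<partial>\<^sub>3 U\<^sub>3 = 0\<close>, so the fibre mean of \<open>r U\<^sup>r\<close> is constant along each ray from the axis, where
  it vanishes.\<close>

lemma fibre_mean_radial_flux_zero_of_swirl:
  assumes sym: "\<And>r \<theta> \<theta>' z. r > 0 \<Longrightarrow>
      cos \<theta> * U 2 (cyl_point r \<theta> z) - sin \<theta> * U 1 (cyl_point r \<theta> z) =
      cos \<theta>' * U 2 (cyl_point r \<theta>' z) - sin \<theta>' * U 1 (cyl_point r \<theta>' z)"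
  shows "fibre_mean (radial_flux U) x = 0"
proof -
  obtain \<theta> where x: "x = cyl_point (sqrt (horizontal_sq x)) \<theta> (x $ 3)"
    by (rule cylindrical_coordinates)
  define z where "z = x $ 3"
  define V' where "V' r t = (cos \<theta> * U 1 (cyl_point r \<theta> (z + t)) + sin \<theta> * U 2 (cyl_point r \<theta> (z + t)))
    + r * (cos \<theta> * (cos \<theta> * partial_deriv 1 (U 1) (cyl_point r \<theta> (z + t)) + sin \<theta> * partial_deriv 2 (U 1) (cyl_point r \<theta> (z + t)))
      + sin \<theta> * (cos \<theta> * partial_deriv 1 (U 2) (cyl_point r \<theta> (z + t)) + sin \<theta> * partial_deriv 2 (U 2) (cyl_point r \<theta> (z + t))))" for r t
  have V': "((\<lambda>r. radial_flux U (cyl_point r \<theta> (z + t))) has_real_derivative V' r t) (at r)" for r t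
    unfolding radial_flux_cyl V'_def
    by (rule derivative_eq_intros smooth_cyl_derivatives smooth_flow refl)+ (simp add: algebra_simps)
  have cc: "continuous_on UNIV (\<lambda>(r, t). F (cyl_point r \<theta> (z + t)))" if "continuous_on UNIV F" for F :: "real^3 \<Rightarrow> real"
    unfolding split_beta cyl_point_def vector_3_eq
    by (intro continuous_on_compose2[OF that] continuous_intros) auto
  have cV': "continuous_on UNIV (\<lambda>(r, t). V' r t)"
    using cc[OF continuous_flow(1)] cc[OF continuous_flow(7)]
    unfolding V'_def split_beta by (intro continuous_intros) auto
  define m where "m r = fibre_mean (radial_flux U) (cyl_point r \<theta> z)" for r
  have v: "per_smooth (radial_flux U)" by (rule per_smooth_radial_flux[OF U])
  have m': "(m has_real_derivative integral {0..1} (V' r)) (at r)" for r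
  proof -
    have "((\<lambda>r. integral (cbox 0 1) (\<lambda>t. radial_flux U (cyl_point r \<theta> (z + t)))) has_real_derivative
        integral (cbox 0 1) (V' r)) (at r within UNIV)"
    proof (rule leibniz_rule_field_derivative)
      show "((\<lambda>r. radial_flux U (cyl_point r \<theta> (z + t))) has_real_derivative V' r t) (at r within UNIV)" for r t
        using V' by simp
      show "(\<lambda>t. radial_flux U (cyl_point r \<theta> (z + t))) integrable_on cbox 0 1" for r
        unfolding cyl_point_def vector_3_eq
        by (intro integrable_continuous continuous_on_compose2[OF per_smooth_continuous[OF v, of UNIV]] continuous_intros) auto
      show "continuous_on (UNIV \<times> cbox 0 1) (\<lambda>(r, t). V' r t)"
        using cV' continuous_on_subset by blast
    qed auto
    then show ?thesis unfolding m_def[abs_def] fibre_mean_def cyl_point_z_shift by simp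
  qed
  have zero: "integral {0..1} (V' r) = 0" if r: "r > 0" for r
  proof -
    have "V' r t = - r * partial_deriv 3 (U 3) (cyl_point r \<theta> z + z_shift t)" for t
    proof -
      let ?p = "cyl_point r \<theta> (z + t)"
      let ?S' = "- (cos \<theta> * U 1 ?p + sin \<theta> * U 2 ?p)
        + r * (cos \<theta> * (cos \<theta> * partial_deriv 2 (U 2) ?p - sin \<theta> * partial_deriv 1 (U 2) ?p)
          - sin \<theta> * (cos \<theta> * partial_deriv 2 (U 1) ?p - sin \<theta> * partial_deriv 1 (U 1) ?p))"
      have S': "((\<lambda>\<theta>. cos \<theta> * U 2 (cyl_point r \<theta> (z + t)) - sin \<theta> * U 1 (cyl_point r \<theta> (z + t))) has_real_derivative ?S') (at \<theta>)"
        by (rule derivative_eq_intros smooth_cyl_derivatives smooth_flow refl)+ (simp add: algebra_simps)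
      have "(\<lambda>\<theta>. cos \<theta> * U 2 (cyl_point r \<theta> (z + t)) - sin \<theta> * U 1 (cyl_point r \<theta> (z + t))) =
          (\<lambda>_. cos \<theta> * U 2 ?p - sin \<theta> * U 1 ?p)"
        using sym[OF r] by blast
      with S' have "((\<lambda>_. cos \<theta> * U 2 ?p - sin \<theta> * U 1 ?p) has_real_derivative ?S') (at \<theta>)" by simp
      then have "?S' = 0" using DERIV_const DERIV_unique by blast
      then have "V' r t = V' r t + ?S'" by simp
      also have "\<dots> = r * ((cos \<theta>)\<^sup>2 + (sin \<theta>)\<^sup>2) * (partial_deriv 1 (U 1) ?p + partial_deriv 2 (U 2) ?p)"
        unfolding V'_def power2_eq_square by algebra
      also have "\<dots> = - r * partial_deriv 3 (U 3) ?p"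
      proof -
        have "partial_deriv 1 (U 1) ?p + partial_deriv 2 (U 2) ?p = - partial_deriv 3 (U 3) ?p"
          using div[of ?p] unfolding sum_3 by linarith
        then show ?thesis by simp
      qed
      finally show ?thesis by (simp add: cyl_point_z_shift)
    qed
    then have "V' r = (\<lambda>t. - r * partial_deriv 3 (U 3) (cyl_point r \<theta> z + z_shift t))" by blast
    then have "integral {0..1} (V' r) = - r * fibre_mean (partial_deriv 3 (U 3)) (cyl_point r \<theta> z)"
      unfolding fibre_mean_def by simp
    then show ?thesis by (simp add: fibre_mean_partial_deriv_3[OF U])
  qed
  have "m r = 0" if "r \<ge> 0" for r
  proof (cases "r = 0")
    case True
    then show ?thesis by (simp add: m_def fibre_mean_def cyl_point_z_shift radial_flux_cyl)
  next
    case False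
    have "m r = m 0"
    proof (rule DERIV_isconst_end[where f = m and a = 0 and b = r])
      show "0 < r" using that False by simp
      show "continuous_on {0..r} m" using m' by (meson DERIV_isCont continuous_at_imp_continuous_on)
      show "DERIV m s :> 0" if "0 < s" "s < r" for s using m'[of s] zero[OF that(1)] by simp
    qed
    then show ?thesis by (simp add: m_def fibre_mean_def cyl_point_z_shift radial_flux_cyl)
  qed
  then show ?thesis using x horizontal_sq_def by (simp add: m_def z_def) (metis real_sqrt_ge_0_iff sum_power2_ge_zero)
qed

lemma fibre_mean_radial_flux_zero_of_radial:
  assumes sym: "\<And>r \<theta> \<theta>' z. r > 0 \<Longrightarrow>
      cos \<theta> * U 1 (cyl_point r \<theta> z) + sin \<theta> * U 2 (cyl_point r \<theta> z) =
      cos \<theta>' * U 1 (cyl_point r \<theta>' z) + sin \<theta>' * U 2 (cyl_point r \<theta>' z)"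
  shows "fibre_mean (radial_flux U) x = 0"
proof (rule fibre_mean_radial_flux_zero)
  fix x
  have v: "per_smooth (radial_flux U)" by (rule per_smooth_radial_flux[OF U])
  let ?r = "sqrt (horizontal_sq x)"
  have r: "?r \<ge> 0" by (simp add: horizontal_sq_def)
  obtain \<theta> where x: "x = cyl_point ?r \<theta> (x $ 3)" by (rule cylindrical_coordinates)
  have rot: "radial_flux U (cyl_point ?r \<theta> z) = radial_flux U (cyl_point ?r 0 z)" for z
    unfolding radial_flux_cyl using sym[of ?r \<theta> z 0] r by (cases "?r = 0") auto
  have "fibre_mean (radial_flux U) x = fibre_mean (radial_flux U) (cyl_point ?r 0 (x $ 3))"
    by (subst x) (simp only: fibre_mean_def cyl_point_z_shift rot)
  also have "cyl_point ?r 0 (x $ 3) = vector [?r, 0, 0] + z_shift (x $ 3)"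
    by (simp add: vec_eq_iff forall_3 axis_def)
  also have "fibre_mean (radial_flux U) \<dots> = fibre_mean (radial_flux U) (vector [?r, 0, 0])"
    by (rule fibre_mean_z_shift[OF per_smooth_continuous[OF v] per_smoothD(2)[OF v]])
  finally show "fibre_mean (radial_flux U) x = fibre_mean (radial_flux U) (vector [?r, 0, 0])" .
qed

section \<open>Decaying radial velocity\<close>

definition rot :: "real \<Rightarrow> real^3 \<Rightarrow> real^3" where
  "rot \<alpha> x = vector [cos \<alpha> * x $ 1 - sin \<alpha> * x $ 2, sin \<alpha> * x $ 1 + cos \<alpha> * x $ 2, x $ 3]"

lemma rot_nth [simp]: "rot \<alpha> x $ 1 = cos \<alpha> * x $ 1 - sin \<alpha> * x $ 2"
  "rot \<alpha> x $ 2 = sin \<alpha> * x $ 1 + cos \<alpha> * x $ 2" "rot \<alpha> x $ 3 = x $ 3"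
  by (simp_all add: rot_def)

lemma rot_0 [simp]: "rot 0 x = x"
  by (simp add: vec_eq_iff forall_3)

lemma rot_z_shift: "rot \<alpha> (x + z_shift t) = rot \<alpha> x + z_shift t"
  by (simp add: vec_eq_iff forall_3 axis_def)

lemma horizontal_sq_rot: "horizontal_sq (rot \<alpha> x) = horizontal_sq x"
proof -
  have "horizontal_sq (rot \<alpha> x) = ((cos \<alpha>)\<^sup>2 + (sin \<alpha>)\<^sup>2) * horizontal_sq x"
    unfolding horizontal_sq_def rot_nth power2_eq_square by (simp only: algebra_simps)
  then show ?thesis by simp
qed

lemma orthogonal_transformation_rot: "orthogonal_transformation (rot \<alpha>)"
proof -
  have "linear (rot \<alpha>)"
    by (rule linearI) (simp_all add: vec_eq_iff forall_3 algebra_simps)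
  moreover have "rot \<alpha> v \<bullet> rot \<alpha> w = ((cos \<alpha>)\<^sup>2 + (sin \<alpha>)\<^sup>2) * (v $ 1 * w $ 1 + v $ 2 * w $ 2) + v $ 3 * w $ 3" for v w
    unfolding inner_vec_def sum_3 inner_real_def rot_nth power2_eq_square by (simp only: algebra_simps)
  then have "rot \<alpha> v \<bullet> rot \<alpha> w = v \<bullet> w" for v w
    by (simp add: inner_vec_def sum_3)
  ultimately show ?thesis by (simp add: orthogonal_transformation_def)
qed

lemma continuous_rot:
  assumes "continuous_on UNIV (F :: real^3 \<Rightarrow> real)"
  shows "continuous_on S (\<lambda>(\<alpha>, x). F (rot \<alpha> x))"
  unfolding split_beta rot_def vector_3_eq
  by (intro continuous_on_compose2[OF assms] continuous_intros) auto

lemma J_rotation_average: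
  assumes R: "R > 0" "k > 0" and F: "continuous_on UNIV F"
  shows "J R k (\<lambda>x. integral {0..2*pi} (\<lambda>\<alpha>. F (rot \<alpha> x))) = 2 * pi * J R k F"
proof -
  let ?G = "\<lambda>x. cutoff R x ^ k * F x"
  have cut: "cutoff R (rot \<alpha> x) = cutoff R x" for \<alpha> x
    using horizontal_sq_rot[of \<alpha> x] by (simp add: cutoff_def horizontal_sq_def)
  have "J R k (\<lambda>x. integral {0..2*pi} (\<lambda>\<alpha>. F (rot \<alpha> x))) = slab_integral (\<lambda>x. integral {0..2*pi} (\<lambda>\<alpha>. ?G (rot \<alpha> x)))"
    by (simp add: J_def cut)
  also have "\<dots> = integral {0..2*pi} (\<lambda>\<alpha>. slab_integral (\<lambda>x. ?G (rot \<alpha> x)))"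
  proof (rule slab_integral_swap[symmetric])
    show "continuous_on UNIV (\<lambda>(\<alpha>, x). ?G (rot \<alpha> x))" by (rule continuous_rot[OF continuous_on_cutoff_mult[OF F]])
    show "vanishes_beyond R (\<lambda>x. ?G (rot \<alpha> x))" for \<alpha> unfolding cut by (rule vanishes_beyond_cutoff[OF R])
  qed
  also have "\<dots> = integral {0..2*pi} (\<lambda>\<alpha>. J R k F)"
    unfolding J_def
    by (intro integral_cong slab_integral_rotate[OF vanishes_beyond_cutoff[OF R] continuous_on_cutoff_mult[OF F]]
          orthogonal_transformation_rot) simp
  also have "\<dots> = 2 * pi * J R k F" by simp
  finally show ?thesis .
qed

definition grad_Q_h :: "real^3 \<Rightarrow> real" where
  "grad_Q_h x = \<bar>partial_deriv 1 Q x\<bar> + \<bar>partial_deriv 2 Q x\<bar>"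

text \<open>Integrated with respect to the angle; the factor \<open>r\<close> of the arc length appears in the estimates.\<close>

definition circle_grad_Q :: "real^3 \<Rightarrow> real" where
  "circle_grad_Q x = integral {0..2*pi} (\<lambda>\<alpha>. grad_Q_h (rot \<alpha> x))"

lemma continuous_grad_Q_h: "continuous_on S grad_Q_h"
  unfolding grad_Q_h_def[abs_def] by (intro continuous_intros continuous_flow)

lemma continuous_circle_grad_Q: "continuous_on UNIV circle_grad_Q"
proof -
  have "continuous_on UNIV (\<lambda>x. integral (cbox 0 (2*pi)) (\<lambda>\<alpha>. grad_Q_h (rot \<alpha> x)))"
  proof (rule integral_continuous_on_param)
    show "continuous_on (UNIV \<times> cbox 0 (2*pi)) (\<lambda>(x, \<alpha>). grad_Q_h (rot \<alpha> x))"
      unfolding split_beta rot_def vector_3_eq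
      by (intro continuous_on_compose2[OF continuous_grad_Q_h[of UNIV]] continuous_intros) auto
  qed
  then show ?thesis by (simp add: circle_grad_Q_def[abs_def])
qed

lemma z_periodic_circle_grad_Q: "z_periodic circle_grad_Q"
proof -
  have "grad_Q_h (y + z_shift 1) = grad_Q_h y" for y
    using per_smoothD(2)[OF per_smooth_intros(8)[OF per_smooth_Q]]
    unfolding grad_Q_h_def z_periodic_def by simp
  then show ?thesis unfolding z_periodic_def circle_grad_Q_def rot_z_shift by simp
qed

lemma Q_rotation_bound:
  assumes \<beta>: "0 \<le> \<beta>" "\<beta> \<le> 2 * pi"
  shows "\<bar>Q (rot \<beta> x) - Q x\<bar> \<le> sqrt (horizontal_sq x) * circle_grad_Q x"
proof -
  let ?r = "sqrt (horizontal_sq x)"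
  let ?D = "\<lambda>\<alpha>. rot \<alpha> x $ 1 * partial_deriv 2 Q (rot \<alpha> x) - rot \<alpha> x $ 2 * partial_deriv 1 Q (rot \<alpha> x)"
  have rotd: "((\<lambda>\<alpha>. rot \<alpha> x) has_vector_derivative vector [- (rot \<alpha> x $ 2), rot \<alpha> x $ 1, 0]) (at \<alpha>)" for \<alpha>
    unfolding rot_nth unfolding rot_def vector_3_eq
    by (auto intro!: derivative_eq_intros simp: algebra_simps)
  have d: "((\<lambda>\<alpha>. Q (rot \<alpha> x)) has_real_derivative ?D \<alpha>) (at \<alpha>)" for \<alpha>
    using smooth_has_real_derivative_along[OF Q rotd[of \<alpha>]] by (simp add: sum_3 algebra_simps del: rot_nth)
  have "(?D has_integral (Q (rot \<beta> x) - Q (rot 0 x))) {0..\<beta>}"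
    by (rule fundamental_theorem_of_calculus[OF \<beta>(1)])
       (use d in \<open>simp add: has_real_derivative_iff_has_vector_derivative has_vector_derivative_at_within\<close>)
  then have eq: "Q (rot \<beta> x) - Q x = integral {0..\<beta>} ?D" by (simp add: integral_unique)
  have cN: "continuous_on S (\<lambda>\<alpha>. grad_Q_h (rot \<alpha> x))" for S
    unfolding rot_def vector_3_eq
    by (intro continuous_on_compose2[OF continuous_grad_Q_h[of UNIV]] continuous_intros) auto
  have iN: "(\<lambda>\<alpha>. ?r * grad_Q_h (rot \<alpha> x)) integrable_on {a..b}" for a b
    by (intro integrable_continuous_real continuous_intros cN)
  have "norm (integral {0..\<beta>} ?D) \<le> integral {0..\<beta>} (\<lambda>\<alpha>. ?r * grad_Q_h (rot \<alpha> x))"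
  proof (rule integral_norm_bound_integral[OF _ iN])
    show "?D integrable_on {0..\<beta>}" using \<open>(?D has_integral _) _\<close> by blast
    fix \<alpha>
    have "?r = sqrt ((rot \<alpha> x $ 1)\<^sup>2 + (rot \<alpha> x $ 2)\<^sup>2)"
      using horizontal_sq_rot[of \<alpha> x] by (simp add: horizontal_sq_def del: rot_nth)
    then have "\<bar>rot \<alpha> x $ 1\<bar> \<le> ?r" "\<bar>rot \<alpha> x $ 2\<bar> \<le> ?r"
      by (metis real_sqrt_sum_squares_ge1 real_sqrt_abs real_sqrt_le_mono power2_abs zero_le_power2 le_add_same_cancel1)
         (metis \<open>?r = sqrt ((rot \<alpha> x $ 1)\<^sup>2 + (rot \<alpha> x $ 2)\<^sup>2)\<close> real_sqrt_abs real_sqrt_le_mono zero_le_power2 le_add_same_cancel2)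
    then have "\<bar>rot \<alpha> x $ 1 * partial_deriv 2 Q (rot \<alpha> x)\<bar> \<le> ?r * \<bar>partial_deriv 2 Q (rot \<alpha> x)\<bar>"
      "\<bar>rot \<alpha> x $ 2 * partial_deriv 1 Q (rot \<alpha> x)\<bar> \<le> ?r * \<bar>partial_deriv 1 Q (rot \<alpha> x)\<bar>"
      unfolding abs_mult by (auto intro!: mult_right_mono simp del: rot_nth)
    then show "norm (?D \<alpha>) \<le> ?r * grad_Q_h (rot \<alpha> x)"
      unfolding grad_Q_h_def distrib_left real_norm_def by linarith
  qed
  also have "\<dots> \<le> integral {0..2*pi} (\<lambda>\<alpha>. ?r * grad_Q_h (rot \<alpha> x))"
    using \<beta> by (intro integral_subset_le iN) (auto simp: grad_Q_h_def horizontal_sq_def)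
  also have "\<dots> = ?r * circle_grad_Q x" by (simp add: circle_grad_Q_def)
  finally show ?thesis by (simp add: eq)
qed

lemma Q_vertical_bound: "\<bar>Q (x + z_shift \<tau>) - Q x\<bar> \<le> fibre_mean (\<lambda>x. \<bar>partial_deriv 3 Q x\<bar>) x"
proof -
  define s where "s = frac \<tau>"
  have s: "0 \<le> s" "s \<le> 1" "\<tau> = s + of_int \<lfloor>\<tau>\<rfloor>" by (auto simp: s_def frac_def) linarith
  have "x + z_shift \<tau> = (x + z_shift s) + z_shift (of_int \<lfloor>\<tau>\<rfloor>)"
    using s(3) by (metis add.assoc scaleR_left_distrib)
  then have eq: "Q (x + z_shift \<tau>) = Q (x + z_shift s)"
    by (simp only: z_periodic_of_int[OF per_smoothD(2)[OF per_smooth_Q]])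
  let ?D = "\<lambda>t. partial_deriv 3 Q (x + z_shift t)"
  have i: "(?D has_integral (Q (x + z_shift s) - Q (x + z_shift 0))) {0..s}"
    by (rule fundamental_theorem_of_calculus[OF s(1)]) (rule smooth_along_line[OF Q])
  have cD: "continuous_on S ?D" for S
    by (intro per_smooth_on_fibre(2) per_smooth_intros(8) per_smooth_Q)
  have "norm (integral {0..s} ?D) \<le> integral {0..s} (\<lambda>t. \<bar>?D t\<bar>)"
    by (intro integral_norm_bound_integral integrable_continuous_real continuous_intros cD) auto
  also have "\<dots> \<le> integral {0..1} (\<lambda>t. \<bar>?D t\<bar>)"
    using s by (intro integral_subset_le integrable_continuous_real continuous_intros cD) auto
  finally have "\<bar>Q (x + z_shift s) - Q x\<bar> \<le> fibre_mean (\<lambda>x. \<bar>partial_deriv 3 Q x\<bar>) x"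
    using integral_unique[OF i] by (simp add: fibre_mean_def)
  then show ?thesis by (simp only: eq)
qed

text \<open>The average of \<open>Q\<close> over the fibre through \<open>(r, 0)\<close> is a radial function, so it may be subtracted
  from \<open>Q\<close> in the work. The difference is estimated by moving first along the fibre and then along the
  circle of radius \<open>r\<close>; the length of the latter is compensated by the decay of \<open>r U\<^sup>r\<close>.\<close>

lemma Q_minus_radial:
  "\<bar>Q x - fibre_mean Q (vector [sqrt (horizontal_sq x), 0, 0])\<bar> \<le>
    fibre_mean (\<lambda>x. \<bar>partial_deriv 3 Q x\<bar>) x + sqrt (horizontal_sq x) * fibre_mean circle_grad_Q x"
proof -
  let ?r = "sqrt (horizontal_sq x)"
  let ?Z = "fibre_mean (\<lambda>x. \<bar>partial_deriv 3 Q x\<bar>) x"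
  obtain \<theta> where \<theta>: "0 \<le> \<theta>" "\<theta> < 2 * pi" "x = cyl_point ?r \<theta> (x $ 3)" by (rule cylindrical_coordinates)
  define \<beta> where "\<beta> = 2 * pi - \<theta>"
  have \<beta>: "0 \<le> \<beta>" "\<beta> \<le> 2 * pi" using \<theta> by (auto simp: \<beta>_def)
  have x12: "x $ 1 = ?r * cos \<theta>" "x $ 2 = ?r * sin \<theta>" using arg_cong[OF \<theta>(3), of "\<lambda>x. x $ 1"] arg_cong[OF \<theta>(3), of "\<lambda>x. x $ 2"] by auto
  have r1: "rot \<beta> x = vector [?r, 0, 0] + z_shift (x $ 3)"
  proof -
    have "cos \<theta> * (?r * cos \<theta>) + sin \<theta> * (?r * sin \<theta>) = ?r * ((cos \<theta>)\<^sup>2 + (sin \<theta>)\<^sup>2)"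
      unfolding power2_eq_square by (simp only: algebra_simps)
    then have "rot \<beta> x $ 1 = ?r" unfolding rot_nth x12 by (simp add: \<beta>_def cos_diff sin_diff)
    moreover have "rot \<beta> x $ 2 = 0" unfolding rot_nth x12 by (simp add: \<beta>_def cos_diff sin_diff)
    ultimately show ?thesis by (simp add: vec_eq_iff forall_3 axis_def del: rot_nth(1,2))
  qed
  let ?o = "vector [?r, 0, 0] :: real^3"
  have point: "\<bar>Q x - Q (rot \<beta> x + z_shift t)\<bar> \<le> ?Z + ?r * circle_grad_Q (x + z_shift t)" for t
  proof -
    have "horizontal_sq (x + z_shift t) = horizontal_sq x" by (simp add: horizontal_sq_def axis_def)
    then have "\<bar>Q (rot \<beta> (x + z_shift t)) - Q (x + z_shift t)\<bar> \<le> ?r * circle_grad_Q (x + z_shift t)"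
      using Q_rotation_bound[OF \<beta>, of "x + z_shift t"] by simp
    then show ?thesis using Q_vertical_bound[of x t] unfolding rot_z_shift by linarith
  qed
  have cQ: "continuous_on S (\<lambda>t. Q (y + z_shift t))" for S y
    by (rule per_smooth_on_fibre(2)[OF per_smooth_Q])
  have cC: "continuous_on S (\<lambda>t. circle_grad_Q (y + z_shift t))" for S y
    by (intro continuous_on_compose2[OF continuous_circle_grad_Q] continuous_intros) auto
  have iQ: "(\<lambda>t. Q (rot \<beta> x + z_shift t)) integrable_on {0..1}" by (intro integrable_continuous_real cQ)
  have "fibre_mean Q ?o = fibre_mean Q (rot \<beta> x)"
    unfolding r1 using per_smooth_Q by (intro fibre_mean_z_shift[symmetric]) (auto dest: per_smoothD)
  then have "Q x - fibre_mean Q ?o = integral {0..1} (\<lambda>t::real. Q x) - integral {0..1} (\<lambda>t. Q (rot \<beta> x + z_shift t))"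
    by (simp add: fibre_mean_def)
  also have "\<dots> = integral {0..1} (\<lambda>t. Q x - Q (rot \<beta> x + z_shift t))"
    by (rule integral_diff[symmetric]) (auto intro: iQ)
  also have "norm \<dots> \<le> integral {0..1} (\<lambda>t. ?Z + ?r * circle_grad_Q (x + z_shift t))"
    using point by (intro integral_norm_bound_integral integrable_continuous_real continuous_intros cQ cC) auto
  also have "\<dots> = ?Z + ?r * fibre_mean circle_grad_Q x"
    by (subst integral_add) (auto simp: fibre_mean_def intro!: integrable_continuous_real continuous_intros cC)
  finally show ?thesis by simp
qed

text \<open>By the Cauchy-Schwarz inequality the integral of \<open>|\<nabla>Q|\<close> over the cylinder of radius \<open>R\<close> is of order \<open>R\<close>
  times \<open>E(2R) + 1\<close>. Against it stands \<open>|r U\<^sup>r|\<close> for the vertical part of \<open>Q\<close> minus the radial function,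
  which is bounded, and \<open>|r U\<^sup>r| r\<close> for the angular part, which is \<open>o(R)\<close>. After division by \<open>R\<^sup>2\<close> both are
  negligible.\<close>

lemma liouville_decay:
  assumes decay: "\<And>\<epsilon>. \<epsilon> > 0 \<Longrightarrow> \<exists>L. \<forall>x. horizontal_sq x \<ge> L\<^sup>2 \<longrightarrow> \<bar>radial_flux U x\<bar> \<le> \<epsilon>"
  shows "partial_deriv i (U j) x = 0"
proof (rule liouville_of_work)
  fix \<epsilon> :: real assume \<epsilon>: "\<epsilon> > 0"
  let ?v = "radial_flux U"
  have v: "per_smooth ?v" by (rule per_smooth_radial_flux[OF U])
  obtain C where C: "C \<ge> 0"
    "\<And>R. R \<ge> 1 \<Longrightarrow> J R 6 (\<lambda>x. \<Sum>j\<in>UNIV. (partial_deriv j Q x)\<^sup>2) \<le> C * J R 4 grad_sq"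
    using J_grad_Q_growth by blast
  define q where "q = (4/3::real) ^ 7"
  have q: "q > 0" by (simp add: q_def)
  define D where "D = C * q + 1"
  have D: "D > 0" using C q by (simp add: D_def add_nonneg_pos)
  have flux_in: "\<bar>?v x\<bar> \<le> 2 * \<bar>L\<bar> * M" if "horizontal_sq x < L\<^sup>2" for x L
  proof -
    have "(x $ 1)\<^sup>2 \<le> L\<^sup>2" "(x $ 2)\<^sup>2 \<le> L\<^sup>2"
      using that zero_le_power2[of "x $ 1"] zero_le_power2[of "x $ 2"] unfolding horizontal_sq_def by linarith+
    then have "\<bar>x $ 1\<bar> \<le> \<bar>L\<bar>" "\<bar>x $ 2\<bar> \<le> \<bar>L\<bar>" by (simp_all add: abs_le_square_iff)
    then have "\<bar>x $ 1 * U 1 x\<bar> \<le> \<bar>L\<bar> * M" "\<bar>x $ 2 * U 2 x\<bar> \<le> \<bar>L\<bar> * M"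
      unfolding abs_mult using bound by (auto intro!: mult_mono)
    then show ?thesis unfolding radial_flux_def by linarith
  qed
  obtain L1 where L1: "\<And>x. horizontal_sq x \<ge> L1\<^sup>2 \<Longrightarrow> \<bar>?v x\<bar> \<le> 1" using decay[of 1] by auto
  define K where "K = 1 + 2 * \<bar>L1\<bar> * M"
  have K1: "K \<ge> 1" using M by (simp add: K_def)
  have K: "\<bar>?v x\<bar> \<le> K" for x
  proof (cases "horizontal_sq x \<ge> L1\<^sup>2")
    case True
    then show ?thesis using L1[OF True] K1 by linarith
  next
    case False
    then show ?thesis using flux_in[of x L1] by (simp add: K_def)
  qed
  define \<epsilon>' where "\<epsilon>' = \<epsilon> / (112 * pi * D)"
  have \<epsilon>': "\<epsilon>' > 0" using \<epsilon> D by (simp add: \<epsilon>'_def)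
  obtain L where L: "\<And>x. horizontal_sq x \<ge> L\<^sup>2 \<Longrightarrow> \<bar>?v x\<bar> \<le> \<epsilon>'" using decay[OF \<epsilon>'] by auto
  define Z where "Z = fibre_mean (\<lambda>x. \<bar>partial_deriv 3 Q x\<bar>)"
  define g where "g t = fibre_mean Q (vector [sqrt t, 0, 0])" for t
  have c3: "continuous_on UNIV (\<lambda>x. \<bar>partial_deriv 3 Q x\<bar>)" by (intro continuous_intros continuous_flow)
  have cZ: "continuous_on UNIV Z"
    unfolding Z_def fibre_mean_def[abs_def] by (rule continuous_on_fibre_integral[OF c3])
  have cC: "continuous_on UNIV (fibre_mean circle_grad_Q)"
    unfolding fibre_mean_def[abs_def] by (rule continuous_on_fibre_integral[OF continuous_circle_grad_Q])
  have cg: "continuous_on UNIV g"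
  proof -
    have "continuous_on UNIV (\<lambda>t. vector [sqrt t, 0, 0] :: real^3)"
      unfolding vector_3_eq by (intro continuous_intros)
    then show ?thesis
      unfolding g_def[abs_def] by (intro continuous_on_compose2[OF continuous_on_fibre_mean[OF per_smooth_Q]]) auto
  qed
  have chs: "continuous_on UNIV horizontal_sq"
    unfolding horizontal_sq_def[abs_def] by (intro continuous_intros)
  note cs = continuous_intros cZ cC per_smooth_continuous[OF v] per_smooth_continuous[OF per_smooth_Q]
    continuous_on_compose2[OF cg chs subset_UNIV]
  have le: "14 / R\<^sup>2 * \<bar>J R 6 (\<lambda>x. Q x * ?v x)\<bar> \<le>
      14 * D * (4 * pi * \<epsilon>' + (K + 4 * pi * K * \<bar>L\<bar>) / R) * (J (2 * R) 7 grad_sq + 1)" if R: "R \<ge> 1" for R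
  proof -
    have R0: "R > 0" using R by simp
    define W where "W = J (2 * R) 7 grad_sq + 1"
    have J0: "J (2 * R) 7 grad_sq \<ge> 0" using R0 by (intro J_nonneg continuous_flow nonneg_flow) auto
    define \<kappa> where "\<kappa> = \<epsilon>' * R + K * \<bar>L\<bar>"
    have \<kappa>: "\<kappa> \<ge> 0" using \<epsilon>' R0 K1 by (simp add: \<kappa>_def)
    have dQ: "J R 6 (\<lambda>x. \<bar>partial_deriv j Q x\<bar>) \<le> R * D * W" for j
    proof -
      have "J R 6 (\<lambda>x. \<bar>partial_deriv j Q x\<bar> * \<bar>1\<bar>) \<le> R * J R 6 (\<lambda>x. (partial_deriv j Q x)\<^sup>2) + 1 / (4 * R) * J R 6 (\<lambda>x. 1\<^sup>2)"
        by (intro J_young R0 continuous_intros continuous_flow) auto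
      also have "\<dots> \<le> R * (C * (q * J (2 * R) 7 grad_sq)) + 1 / (4 * R) * (4 * R\<^sup>2)"
      proof (intro add_mono mult_left_mono)
        have "J R 6 (\<lambda>x. (partial_deriv j Q x)\<^sup>2) \<le> J R 6 (\<lambda>x. \<Sum>j\<in>UNIV. (partial_deriv j Q x)\<^sup>2)"
          by (intro J_mono R0 continuous_intros continuous_flow component_le_sum_sq[of "\<lambda>j. partial_deriv j Q _"]) simp
        also have "\<dots> \<le> C * J R 4 grad_sq" by (rule C(2)[OF R])
        also have "\<dots> \<le> C * (q * J (2 * R) 7 grad_sq)"
          unfolding q_def by (intro mult_left_mono C(1) J_double R0 continuous_flow nonneg_flow) auto
        finally show "J R 6 (\<lambda>x. (partial_deriv j Q x)\<^sup>2) \<le> C * (q * J (2 * R) 7 grad_sq)" .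
        show "J R 6 (\<lambda>x. 1\<^sup>2) \<le> 4 * R\<^sup>2" using J_one_upper[OF R0, of 6] by simp
      qed (use R0 in auto)
      also have "\<dots> = R * (C * q * J (2 * R) 7 grad_sq + 1)" using R0 by (simp add: power2_eq_square algebra_simps)
      also have "\<dots> \<le> R * (D * W)"
      proof (rule mult_left_mono)
        have "D * W = C * q * J (2 * R) 7 grad_sq + C * q + J (2 * R) 7 grad_sq + 1"
          by (simp add: D_def W_def algebra_simps)
        moreover have "0 \<le> C * q" using C(1) q by simp
        ultimately show "C * q * J (2 * R) 7 grad_sq + 1 \<le> D * W" using J0 by linarith
      qed (use R0 in simp)
      finally show ?thesis by (simp add: mult.assoc)
    qed
    have JZ: "J R 6 Z \<le> R * D * W"
    proof -
      have "z_periodic (\<lambda>x. \<bar>partial_deriv 3 Q x\<bar>)"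
        using per_smoothD(2)[OF per_smooth_intros(8)[OF per_smooth_Q]] by (simp add: z_periodic_def)
      then have "J R 6 Z = J R 6 (\<lambda>x. \<bar>partial_deriv 3 Q x\<bar>)"
        using J_fibre_average[OF R0 _ c3, of 6] by (simp add: Z_def fibre_mean_def[abs_def])
      then show ?thesis using dQ[of 3] by simp
    qed
    have JC: "J R 6 (fibre_mean circle_grad_Q) \<le> 2 * pi * (2 * (R * D * W))"
    proof -
      have "J R 6 (fibre_mean circle_grad_Q) = J R 6 circle_grad_Q"
        using J_fibre_average[OF R0 _ continuous_circle_grad_Q z_periodic_circle_grad_Q, of 6]
        by (simp add: fibre_mean_def[abs_def])
      also have "\<dots> = 2 * pi * J R 6 grad_Q_h"
        unfolding circle_grad_Q_def[abs_def] by (rule J_rotation_average[OF R0 _ continuous_grad_Q_h]) simp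
      also have "J R 6 grad_Q_h = J R 6 (\<lambda>x. \<bar>partial_deriv 1 Q x\<bar>) + J R 6 (\<lambda>x. \<bar>partial_deriv 2 Q x\<bar>)"
        unfolding grad_Q_h_def[abs_def] by (intro J_add R0 continuous_intros continuous_flow) simp
      also have "2 * pi * \<dots> \<le> 2 * pi * (2 * (R * D * W))"
        using dQ[of 1] dQ[of 2] by (intro mult_left_mono) auto
      finally show ?thesis .
    qed
    have "J R 6 (\<lambda>x. g (horizontal_sq x) * ?v x) = 0" by (rule J_radial_flux_zero[OF R0 _ U div cg]) simp
    then have "J R 6 (\<lambda>x. Q x * ?v x) = J R 6 (\<lambda>x. Q x * ?v x - g (horizontal_sq x) * ?v x)"
      using J_diff[OF R0, of 6 "\<lambda>x. Q x * ?v x" "\<lambda>x. g (horizontal_sq x) * ?v x"] by (simp add: cs)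
    then have "\<bar>J R 6 (\<lambda>x. Q x * ?v x)\<bar> \<le> J R 6 (\<lambda>x. \<bar>Q x * ?v x - g (horizontal_sq x) * ?v x\<bar>)"
      using J_abs[OF R0, of 6 "\<lambda>x. Q x * ?v x - g (horizontal_sq x) * ?v x"] by (simp add: cs)
    also have "\<dots> \<le> J R 6 (\<lambda>x. K * Z x + \<kappa> * fibre_mean circle_grad_Q x)"
    proof (rule J_mono[OF R0])
      fix x assume x: "0 < cutoff R x"
      let ?r = "sqrt (horizontal_sq x)"
      have Z0: "0 \<le> Z x" unfolding Z_def fibre_mean_def
        by (intro integral_nonneg integrable_continuous_real continuous_on_compose2[OF c3] continuous_intros) auto
      have C0: "0 \<le> fibre_mean circle_grad_Q x"
      proof -
        have "0 \<le> circle_grad_Q y" for y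
          unfolding circle_grad_Q_def rot_def vector_3_eq
          by (intro integral_nonneg integrable_continuous_real continuous_on_compose2[OF continuous_grad_Q_h[of UNIV]] continuous_intros)
             (auto simp: grad_Q_h_def)
        then show ?thesis unfolding fibre_mean_def
          by (intro integral_nonneg integrable_continuous_real continuous_on_compose2[OF continuous_circle_grad_Q] continuous_intros) auto
      qed
      have r: "\<bar>?v x\<bar> * ?r \<le> \<kappa>"
      proof (cases "horizontal_sq x \<ge> L\<^sup>2")
        case True
        have "?r \<le> R" using cutoff_positiveD(1)[OF x R0] R0 by (simp add: horizontal_sq_def real_le_lsqrt)
        then have "\<bar>?v x\<bar> * ?r \<le> \<epsilon>' * R" using L[OF True] \<epsilon>' by (intro mult_mono) (auto simp: horizontal_sq_def)
        moreover have "0 \<le> K * \<bar>L\<bar>" using K1 by simp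
        ultimately show ?thesis by (simp add: \<kappa>_def)
      next
        case False
        then have "?r \<le> sqrt (L\<^sup>2)" by (intro real_sqrt_le_mono) simp
        then have "\<bar>?v x\<bar> * ?r \<le> K * \<bar>L\<bar>" using K[of x] K1 by (intro mult_mono) (auto simp: horizontal_sq_def)
        moreover have "0 \<le> \<epsilon>' * R" using \<epsilon>' R0 by simp
        ultimately show ?thesis unfolding \<kappa>_def by linarith
      qed
      have "\<bar>Q x * ?v x - g (horizontal_sq x) * ?v x\<bar> = \<bar>?v x\<bar> * \<bar>Q x - g (horizontal_sq x)\<bar>"
        by (simp add: abs_mult[symmetric] algebra_simps)
      also have "\<dots> \<le> \<bar>?v x\<bar> * (Z x + ?r * fibre_mean circle_grad_Q x)"
        unfolding g_def Z_def by (intro mult_left_mono Q_minus_radial) simp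
      also have "\<dots> = \<bar>?v x\<bar> * Z x + (\<bar>?v x\<bar> * ?r) * fibre_mean circle_grad_Q x" by (simp add: algebra_simps)
      also have "\<dots> \<le> K * Z x + \<kappa> * fibre_mean circle_grad_Q x"
        by (intro add_mono mult_right_mono K r Z0 C0)
      finally show "\<bar>Q x * ?v x - g (horizontal_sq x) * ?v x\<bar> \<le> K * Z x + \<kappa> * fibre_mean circle_grad_Q x" .
    qed (auto intro!: cs)
    also have "\<dots> = K * J R 6 Z + \<kappa> * J R 6 (fibre_mean circle_grad_Q)"
      by (intro J_lincomb R0 cZ cC) simp
    also have "\<dots> \<le> K * (R * D * W) + \<kappa> * (2 * pi * (2 * (R * D * W)))"
      using K1 \<kappa> by (intro add_mono mult_left_mono JZ JC) auto
    finally have "14 / R\<^sup>2 * \<bar>J R 6 (\<lambda>x. Q x * ?v x)\<bar> \<le> 14 / R\<^sup>2 * (K * (R * D * W) + \<kappa> * (2 * pi * (2 * (R * D * W))))"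
      by (intro mult_left_mono) auto
    also have "\<dots> = 14 * D * (4 * pi * \<epsilon>' + (K + 4 * pi * K * \<bar>L\<bar>) / R) * W"
      using R0 by (simp add: \<kappa>_def power2_eq_square field_simps)
    finally show ?thesis by (simp add: W_def)
  qed
  define N where "N = K + 4 * pi * K * \<bar>L\<bar>"
  have N: "N \<ge> 0" using K1 by (simp add: N_def)
  show "\<exists>R0. \<forall>R\<ge>R0. 14 / R\<^sup>2 * \<bar>J R 6 (\<lambda>x. Q x * ?v x)\<bar> \<le> \<epsilon> * (J (2 * R) 7 grad_sq + 1)"
  proof (intro exI[of _ "max 1 (28 * D * N / \<epsilon>)"] allI impI)
    fix R assume "R \<ge> max 1 (28 * D * N / \<epsilon>)"
    then have R: "R \<ge> 1" "28 * D * N \<le> \<epsilon> * R" using \<epsilon> by (auto simp: field_simps)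
    have "14 * D * (4 * pi * \<epsilon>' + N / R) = \<epsilon> / 2 + 14 * D * N / R"
      using D by (simp add: \<epsilon>'_def distrib_left)
    also have "14 * D * N / R \<le> \<epsilon> / 2" using R by (simp add: divide_simps)
    finally have "14 * D * (4 * pi * \<epsilon>' + N / R) \<le> \<epsilon>" by simp
    moreover have "J (2 * R) 7 grad_sq \<ge> 0" using R by (intro J_nonneg continuous_flow nonneg_flow) auto
    ultimately have "14 * D * (4 * pi * \<epsilon>' + N / R) * (J (2 * R) 7 grad_sq + 1) \<le> \<epsilon> * (J (2 * R) 7 grad_sq + 1)"
      by (intro mult_right_mono) auto
    then show "14 / R\<^sup>2 * \<bar>J R 6 (\<lambda>x. Q x * ?v x)\<bar> \<le> \<epsilon> * (J (2 * R) 7 grad_sq + 1)"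
      using le[OF R(1)] unfolding N_def by linarith
  qed
qed

end

section \<open>Scalar energy estimates\<close>

lemma J_scalar_energy:
  assumes R: "R > 0" and g: "per_smooth g"
  shows "J R 7 (\<lambda>x. \<Sum>l\<in>UNIV. (partial_deriv l g x)\<^sup>2) \<le>
    14 / R * J R 6 (\<lambda>x. \<Sum>l\<in>UNIV. \<bar>partial_deriv l g x\<bar> * \<bar>g x\<bar>)
    - J R 7 (\<lambda>x. (\<Sum>l\<in>UNIV. partial_deriv l (partial_deriv l g) x) * g x)"
proof -
  note cs = continuous_intros per_smooth_continuous g per_smooth_intros(8)
  have parts: "J R 7 (\<lambda>x. (partial_deriv l g x)\<^sup>2) \<le>
      14 / R * J R 6 (\<lambda>x. \<bar>partial_deriv l g x\<bar> * \<bar>g x\<bar>) - J R 7 (\<lambda>x. partial_deriv l (partial_deriv l g) x * g x)" for l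
    using J_parts_bound[OF R _ per_smooth_intros(8)[OF g] g, of 6 l l]
    by (simp add: power2_eq_square abs_le_iff)
  have "J R 7 (\<lambda>x. \<Sum>l\<in>UNIV. (partial_deriv l g x)\<^sup>2) = (\<Sum>l\<in>UNIV. J R 7 (\<lambda>x. (partial_deriv l g x)\<^sup>2))"
    by (intro J_sum R cs) simp
  also have "\<dots> \<le> (\<Sum>l\<in>UNIV. 14 / R * J R 6 (\<lambda>x. \<bar>partial_deriv l g x\<bar> * \<bar>g x\<bar>)
      - J R 7 (\<lambda>x. partial_deriv l (partial_deriv l g) x * g x))"
    by (intro sum_mono parts)
  also have "\<dots> = 14 / R * (\<Sum>l\<in>UNIV. J R 6 (\<lambda>x. \<bar>partial_deriv l g x\<bar> * \<bar>g x\<bar>))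
      - (\<Sum>l\<in>UNIV. J R 7 (\<lambda>x. partial_deriv l (partial_deriv l g) x * g x))"
    by (simp only: sum_subtractf sum_distrib_left)
  also have "(\<Sum>l\<in>UNIV. J R 6 (\<lambda>x. \<bar>partial_deriv l g x\<bar> * \<bar>g x\<bar>)) = J R 6 (\<lambda>x. \<Sum>l\<in>UNIV. \<bar>partial_deriv l g x\<bar> * \<bar>g x\<bar>)"
    by (intro J_sum[symmetric] R cs) simp
  also have "(\<Sum>l\<in>UNIV. J R 7 (\<lambda>x. partial_deriv l (partial_deriv l g) x * g x)) =
      J R 7 (\<lambda>x. (\<Sum>l\<in>UNIV. partial_deriv l (partial_deriv l g) x) * g x)"
    unfolding sum_distrib_right by (intro J_sum[symmetric] R cs) simp
  finally show ?thesis .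
qed

lemma young_product: "a * b \<le> \<mu> * a\<^sup>2 + b\<^sup>2 / (4 * \<mu>)" if "\<mu> > 0" for a b \<mu> :: real
proof -
  have "4 * \<mu> * (a * b) \<le> 4 * \<mu> * (\<mu> * a\<^sup>2 + b\<^sup>2 / (4 * \<mu>))"
    using zero_le_power2[of "2 * \<mu> * a - b"] that
    by (simp add: power2_diff power_mult_distrib distrib_left) (simp add: power2_eq_square algebra_simps)
  then show ?thesis using that by (simp add: mult_le_cancel_left)
qed

context steady_flow
begin

text \<open>The drift is antisymmetric up to a boundary term.\<close>

lemma J_drift_bound:
  assumes R: "R > 0" and g: "per_smooth g"
  shows "\<bar>J R 7 (\<lambda>x. (\<Sum>l\<in>UNIV. U l x * partial_deriv l g x) * g x)\<bar> \<le> 21 * M / R * J R 6 (\<lambda>x. (g x)\<^sup>2)"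
proof -
  note cs = continuous_intros per_smooth_continuous g per_smooth_intros(3,8) U
  let ?S = "J R 7 (\<lambda>x. (\<Sum>l\<in>UNIV. U l x * partial_deriv l g x) * g x)"
  have S: "?S = (\<Sum>l\<in>UNIV. J R 7 (\<lambda>x. U l x * g x * partial_deriv l g x))"
  proof -
    have "?S = J R 7 (\<lambda>x. \<Sum>l\<in>UNIV. U l x * g x * partial_deriv l g x)"
      unfolding sum_distrib_right by (simp add: ac_simps)
    then show ?thesis by (simp add: J_sum[OF R] cs)
  qed
  have zero: "(\<Sum>l\<in>UNIV. J R 7 (\<lambda>x. partial_deriv l (\<lambda>x. U l x * g x) x * g x)) = ?S"
  proof -
    have "(\<Sum>l\<in>UNIV. J R 7 (\<lambda>x. partial_deriv l (\<lambda>x. U l x * g x) x * g x)) =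
        J R 7 (\<lambda>x. \<Sum>l\<in>UNIV. partial_deriv l (\<lambda>x. U l x * g x) x * g x)"
      by (intro J_sum[symmetric] R cs) simp
    also have "(\<lambda>x. \<Sum>l\<in>UNIV. partial_deriv l (\<lambda>x. U l x * g x) x * g x) =
        (\<lambda>x. (\<Sum>l\<in>UNIV. U l x * partial_deriv l g x) * g x)"
    proof
      fix x
      have "(\<Sum>l\<in>UNIV. partial_deriv l (\<lambda>x. U l x * g x) x * g x) =
          (\<Sum>l\<in>UNIV. U l x * partial_deriv l g x) * g x + (\<Sum>l\<in>UNIV. partial_deriv l (U l) x) * g x * g x"
        by (simp add: smooth_flow per_smoothD(1)[OF g] sum_distrib_right distrib_right sum.distrib)
      then show "(\<Sum>l\<in>UNIV. partial_deriv l (\<lambda>x. U l x * g x) x * g x) = (\<Sum>l\<in>UNIV. U l x * partial_deriv l g x) * g x"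
        by (simp add: div)
    qed
    finally show ?thesis .
  qed
  have each: "\<bar>J R 7 (\<lambda>x. U l x * g x * partial_deriv l g x) + J R 7 (\<lambda>x. partial_deriv l (\<lambda>x. U l x * g x) x * g x)\<bar>
      \<le> 14 * M / R * J R 6 (\<lambda>x. (g x)\<^sup>2)" for l
  proof -
    have "\<bar>J R 7 (\<lambda>x. U l x * g x * partial_deriv l g x) + J R 7 (\<lambda>x. partial_deriv l (\<lambda>x. U l x * g x) x * g x)\<bar>
        \<le> 14 / R * J R 6 (\<lambda>x. \<bar>U l x * g x\<bar> * \<bar>g x\<bar>)"
      using J_parts_bound[OF R _ per_smooth_intros(3)[OF U g] g, of 6 l l] by simp
    also have "\<dots> \<le> 14 / R * J R 6 (\<lambda>x. M * (g x)\<^sup>2)"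
    proof (intro mult_left_mono J_mono R cs)
      fix x
      have "\<bar>U l x * g x\<bar> * \<bar>g x\<bar> = \<bar>U l x\<bar> * (g x)\<^sup>2" by (simp add: abs_mult power2_eq_square)
      also have "\<dots> \<le> M * (g x)\<^sup>2" using bound by (intro mult_right_mono) auto
      finally show "\<bar>U l x * g x\<bar> * \<bar>g x\<bar> \<le> M * (g x)\<^sup>2" .
    qed (use R in auto)
    finally show ?thesis by (simp add: J_cmult)
  qed
  have "\<bar>?S + ?S\<bar> = \<bar>\<Sum>l\<in>UNIV. J R 7 (\<lambda>x. U l x * g x * partial_deriv l g x) + J R 7 (\<lambda>x. partial_deriv l (\<lambda>x. U l x * g x) x * g x)\<bar>"
    unfolding sum.distrib zero S[symmetric] ..
  also have "\<dots> \<le> (\<Sum>l\<in>(UNIV::3 set). 14 * M / R * J R 6 (\<lambda>x. (g x)\<^sup>2))"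
    by (rule order_trans[OF sum_abs sum_mono[OF each]])
  also have "\<dots> = 2 * (21 * M / R * J R 6 (\<lambda>x. (g x)\<^sup>2))" by simp
  finally show ?thesis by linarith
qed

text \<open>Liouville theorem for scalars transported by the flow. The hypothesis \<open>square\<close> says that
  \<open>\<Sum> g\<^sup>2\<close> is a divergence plus a term that is linear in \<open>\<nabla>g\<close>, as is the case if \<open>g\<close> consists of first
  derivatives of bounded functions. It turns the drift term \<open>R\<^sup>-\<^sup>1 \<integral> g\<^sup>2\<close> into \<open>R\<^sup>-\<^sup>1 \<integral> |\<nabla>g|\<close>, which
  is an admissible boundary term.\<close>

lemma liouville_transported:
  fixes g :: "3 \<Rightarrow> real^3 \<Rightarrow> real"
  assumes g: "\<And>m. per_smooth (g m)"
    and eq: "\<And>m x. (\<Sum>l\<in>UNIV. partial_deriv l (partial_deriv l (g m)) x) = (\<Sum>l\<in>UNIV. U l x * partial_deriv l (g m) x)"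
    and K: "K > 0"
    and square: "\<And>R. R \<ge> 1 \<Longrightarrow> J R 6 (\<lambda>x. \<Sum>m\<in>UNIV. (g m x)\<^sup>2) \<le>
      K * J R 6 (\<lambda>x. \<Sum>m\<in>UNIV. \<Sum>l\<in>UNIV. \<bar>partial_deriv l (g m) x\<bar>) + K / R * J R 5 (\<lambda>x. \<Sum>m\<in>UNIV. \<bar>g m x\<bar>)"
    and growth: "\<And>R. R \<ge> 1 \<Longrightarrow> J R 4 (\<lambda>x. \<Sum>m\<in>UNIV. (g m x)\<^sup>2) \<le> A * R\<^sup>2"
  shows "g m x = 0"
proof -
  note cs = continuous_intros per_smooth_continuous g per_smooth_intros(8)
  let ?f = "\<lambda>x. \<Sum>m\<in>UNIV. \<Sum>l\<in>UNIV. (partial_deriv l (g m) x)\<^sup>2"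
  let ?G = "\<lambda>x. \<Sum>m\<in>UNIV. (g m x)\<^sup>2"
  let ?a = "\<lambda>x. \<Sum>m\<in>UNIV. \<Sum>l\<in>UNIV. \<bar>partial_deriv l (g m) x\<bar> * \<bar>g m x\<bar>"
  let ?b = "\<lambda>x. \<Sum>m\<in>UNIV. \<Sum>l\<in>UNIV. \<bar>partial_deriv l (g m) x\<bar>"
  define C where "C = 14 + 42 * M * K"
  have C: "C \<ge> 0" "14 \<le> C" "42 * M * K \<le> C" using M K by (auto simp: C_def)
  have energy: "J R 7 ?f \<le> 14 / R * J R 6 ?a + 21 * M / R * J R 6 ?G" if R: "R > 0" for R
  proof -
    have "J R 7 ?f = (\<Sum>m\<in>UNIV. J R 7 (\<lambda>x. \<Sum>l\<in>UNIV. (partial_deriv l (g m) x)\<^sup>2))"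
      by (intro J_sum R cs) simp
    also have "\<dots> \<le> (\<Sum>m\<in>UNIV. 14 / R * J R 6 (\<lambda>x. \<Sum>l\<in>UNIV. \<bar>partial_deriv l (g m) x\<bar> * \<bar>g m x\<bar>)
        + 21 * M / R * J R 6 (\<lambda>x. (g m x)\<^sup>2))"
    proof (rule sum_mono)
      fix m
      show "J R 7 (\<lambda>x. \<Sum>l\<in>UNIV. (partial_deriv l (g m) x)\<^sup>2) \<le>
          14 / R * J R 6 (\<lambda>x. \<Sum>l\<in>UNIV. \<bar>partial_deriv l (g m) x\<bar> * \<bar>g m x\<bar>) + 21 * M / R * J R 6 (\<lambda>x. (g m x)\<^sup>2)"
        using J_scalar_energy[OF R g, of m] J_drift_bound[OF R g, of m] unfolding eq by linarith
    qed
    also have "\<dots> = 14 / R * (\<Sum>m\<in>UNIV. J R 6 (\<lambda>x. \<Sum>l\<in>UNIV. \<bar>partial_deriv l (g m) x\<bar> * \<bar>g m x\<bar>))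
        + 21 * M / R * (\<Sum>m\<in>UNIV. J R 6 (\<lambda>x. (g m x)\<^sup>2))"
      by (simp only: sum.distrib sum_distrib_left)
    also have "(\<Sum>m\<in>UNIV. J R 6 (\<lambda>x. \<Sum>l\<in>UNIV. \<bar>partial_deriv l (g m) x\<bar> * \<bar>g m x\<bar>)) = J R 6 ?a"
      by (intro J_sum[symmetric] R cs) simp
    also have "(\<Sum>m\<in>UNIV. J R 6 (\<lambda>x. (g m x)\<^sup>2)) = J R 6 ?G"
      by (intro J_sum[symmetric] R cs) simp
    finally show ?thesis .
  qed
  have square': "J R 6 ?G \<le> 2 * K * J R 6 ?b + 12 * K\<^sup>2" if R: "R \<ge> 1" for R
  proof -
    have R0: "R > 0" using R by simp
    have "K / R * J R 5 (\<lambda>x. \<Sum>m\<in>UNIV. \<bar>g m x\<bar>) = (\<Sum>m\<in>UNIV. K / R * J R 5 (\<lambda>x. \<bar>g m x\<bar> * \<bar>1\<bar>))"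
      by (simp add: J_sum[OF R0] cs sum_distrib_left)
    also have "\<dots> \<le> (\<Sum>m\<in>UNIV. 1/2 * J R 6 (\<lambda>x. (g m x)\<^sup>2) + 2 * K\<^sup>2)"
    proof (rule sum_mono)
      fix m
      have "J R 5 (\<lambda>x. \<bar>g m x\<bar> * \<bar>1\<bar>) \<le> R / (2 * K) * J R 6 (\<lambda>x. (g m x)\<^sup>2) + 1 / (4 * (R / (2 * K))) * J R 4 (\<lambda>x. 1\<^sup>2)"
        using R0 K by (intro J_young cs) auto
      also have "\<dots> \<le> R / (2 * K) * J R 6 (\<lambda>x. (g m x)\<^sup>2) + 1 / (4 * (R / (2 * K))) * (4 * R\<^sup>2)"
        using R0 K J_one_upper[OF R0, of 4] by (intro add_left_mono mult_left_mono) auto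
      finally have "K / R * J R 5 (\<lambda>x. \<bar>g m x\<bar> * \<bar>1\<bar>) \<le>
          K / R * (R / (2 * K) * J R 6 (\<lambda>x. (g m x)\<^sup>2) + 1 / (4 * (R / (2 * K))) * (4 * R\<^sup>2))"
        using R0 K by (intro mult_left_mono) auto
      also have "\<dots> = 1/2 * J R 6 (\<lambda>x. (g m x)\<^sup>2) + 2 * K\<^sup>2"
        using R0 K by (simp add: field_simps power2_eq_square)
      finally show "K / R * J R 5 (\<lambda>x. \<bar>g m x\<bar> * \<bar>1\<bar>) \<le> 1/2 * J R 6 (\<lambda>x. (g m x)\<^sup>2) + 2 * K\<^sup>2" .
    qed
    also have "\<dots> = 1/2 * J R 6 ?G + 6 * K\<^sup>2"
      by (simp add: J_sum[OF R0] cs sum.distrib sum_distrib_left)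
    finally show ?thesis using square[OF R] by linarith
  qed
  have G4: "J R k ?G \<le> A * R\<^sup>2" if "R \<ge> 1" "k \<ge> 4" for R k
  proof -
    have "J R k ?G \<le> J R 4 ?G" using that by (intro J_power_antimono cs sum_nonneg) auto
    then show ?thesis using growth[OF that(1)] by linarith
  qed
  have f0: "?f x = 0" for x
  proof (rule liouville_scheme[where h = "\<lambda>x. ?a x + ?b x" and e = "\<lambda>x. 3 * ?G x + 9" and C = C
        and A = "3 * A + 36" and A' = "588 * A + 42 * M * A"])
    fix \<mu> :: real and x :: "real^3" assume \<mu>: "\<mu> > 0"
    have "?a x + ?b x \<le> (\<Sum>m\<in>UNIV. \<Sum>l\<in>UNIV. \<mu> * (partial_deriv l (g m) x)\<^sup>2 + ((g m x)\<^sup>2 + 1) / \<mu>)"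
      unfolding sum.distrib[symmetric]
    proof (intro sum_mono)
      fix m l
      let ?d = "\<bar>partial_deriv l (g m) x\<bar>"
      have "?d * \<bar>g m x\<bar> \<le> \<mu> / 2 * ?d\<^sup>2 + \<bar>g m x\<bar>\<^sup>2 / (4 * (\<mu> / 2))" using \<mu> by (intro young_product) simp
      moreover have "?d * 1 \<le> \<mu> / 2 * ?d\<^sup>2 + 1\<^sup>2 / (4 * (\<mu> / 2))" using \<mu> by (intro young_product) simp
      moreover have "(g m x)\<^sup>2 / (2 * \<mu>) + 1 / (2 * \<mu>) \<le> ((g m x)\<^sup>2 + 1) / \<mu>"
        using \<mu> by (simp add: add_divide_distrib[symmetric] divide_simps)
      ultimately show "?d * \<bar>g m x\<bar> + ?d \<le> \<mu> * (partial_deriv l (g m) x)\<^sup>2 + ((g m x)\<^sup>2 + 1) / \<mu>"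
        by simp
    qed
    also have "\<dots> = \<mu> * ?f x + (3 * ?G x + 9) / \<mu>"
      by (simp add: sum.distrib sum_distrib_left add_divide_distrib sum_divide_distrib)
    finally show "?a x + ?b x \<le> \<mu> * ?f x + (3 * ?G x + 9) / \<mu>" .
  next
    fix R :: real assume R: "R \<ge> 1"
    have R0: "R > 0" using R by simp
    have "J R 6 (\<lambda>x. 3 * ?G x + 9 * 1) = 3 * J R 6 ?G + 9 * J R 6 (\<lambda>x. 1)"
      by (intro J_lincomb R0 cs) simp
    also have "\<dots> \<le> 3 * (A * R\<^sup>2) + 9 * (4 * R\<^sup>2)"
      using R by (intro add_mono mult_left_mono G4 J_one_upper) auto
    finally show "J R 6 (\<lambda>x. 3 * ?G x + 9) \<le> (3 * A + 36) * R\<^sup>2" by (simp add: algebra_simps)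
    have A: "0 \<le> A * R\<^sup>2" using G4[OF R, of 4] J_nonneg[OF R0, of 4 ?G] by (simp add: cs sum_nonneg)
    have "14 / R * J R 6 ?a = (\<Sum>m\<in>UNIV. \<Sum>l\<in>UNIV. 14 / R * J R 6 (\<lambda>x. \<bar>partial_deriv l (g m) x\<bar> * \<bar>g m x\<bar>))"
      by (simp add: J_sum2[OF R0] cs sum_distrib_left)
    also have "\<dots> \<le> (\<Sum>m\<in>UNIV. \<Sum>l\<in>UNIV. 1/2 * J R 7 (\<lambda>x. (partial_deriv l (g m) x)\<^sup>2) + 98 * J R 5 (\<lambda>x. (g m x)\<^sup>2))"
    proof (intro sum_mono)
      fix m l
      have "J R 6 (\<lambda>x. \<bar>partial_deriv l (g m) x\<bar> * \<bar>g m x\<bar>) \<le>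
          R / 28 * J R 7 (\<lambda>x. (partial_deriv l (g m) x)\<^sup>2) + 1 / (4 * (R / 28)) * J R 5 (\<lambda>x. (g m x)\<^sup>2)"
        using R0 by (intro J_young cs) auto
      then have "14 / R * J R 6 (\<lambda>x. \<bar>partial_deriv l (g m) x\<bar> * \<bar>g m x\<bar>) \<le>
          14 / R * (R / 28 * J R 7 (\<lambda>x. (partial_deriv l (g m) x)\<^sup>2) + 1 / (4 * (R / 28)) * J R 5 (\<lambda>x. (g m x)\<^sup>2))"
        using R0 by (intro mult_left_mono) auto
      also have "\<dots> = 1/2 * J R 7 (\<lambda>x. (partial_deriv l (g m) x)\<^sup>2) + 98 / R\<^sup>2 * J R 5 (\<lambda>x. (g m x)\<^sup>2)"
        using R0 by (simp add: field_simps power2_eq_square)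
      also have "98 / R\<^sup>2 * J R 5 (\<lambda>x. (g m x)\<^sup>2) \<le> 98 * J R 5 (\<lambda>x. (g m x)\<^sup>2)"
      proof (rule mult_right_mono)
        have "1 \<le> R\<^sup>2" using R by (simp add: one_le_power)
        then show "98 / R\<^sup>2 \<le> 98" by (simp add: divide_simps)
        show "0 \<le> J R 5 (\<lambda>x. (g m x)\<^sup>2)" by (intro J_nonneg R0 cs) auto
      qed
      finally show "14 / R * J R 6 (\<lambda>x. \<bar>partial_deriv l (g m) x\<bar> * \<bar>g m x\<bar>) \<le>
          1/2 * J R 7 (\<lambda>x. (partial_deriv l (g m) x)\<^sup>2) + 98 * J R 5 (\<lambda>x. (g m x)\<^sup>2)" by simp
    qed
    also have "\<dots> = 1/2 * J R 7 ?f + 294 * J R 5 ?G"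
      by (simp add: J_sum2[OF R0] J_sum[OF R0] cs sum.distrib sum_distrib_left)
    also have "J R 5 ?G \<le> A * R\<^sup>2" by (rule G4[OF R]) simp
    finally have "J R 7 ?f \<le> 588 * (A * R\<^sup>2) + 2 * (21 * M / R * J R 6 ?G)" using energy[OF R0] by linarith
    also have "21 * M / R * J R 6 ?G \<le> 21 * M * (A * R\<^sup>2)"
    proof (rule mult_mono)
      show "21 * M / R \<le> 21 * M" using R M by (simp add: divide_simps mult_le_cancel_left1)
      show "J R 6 ?G \<le> A * R\<^sup>2" by (rule G4[OF R]) simp
      show "0 \<le> J R 6 ?G" by (intro J_nonneg R0 cs sum_nonneg) auto
    qed (use M in simp)
    finally show "J R 7 ?f \<le> (588 * A + 42 * M * A) * R\<^sup>2" by (simp add: algebra_simps)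
  next
    fix \<epsilon> :: real assume \<epsilon>: "\<epsilon> > 0"
    show "\<exists>R0. \<forall>R\<ge>R0. J R 7 ?f \<le> C / R * J R 6 (\<lambda>x. ?a x + ?b x) + \<epsilon> * (J (2 * R) 7 ?f + 1)"
    proof (intro exI[of _ "max 1 (252 * M * K\<^sup>2 / \<epsilon>)"] allI impI)
      fix R assume R: "R \<ge> max 1 (252 * M * K\<^sup>2 / \<epsilon>)"
      have R1: "R \<ge> 1" "R > 0" "252 * M * K\<^sup>2 \<le> \<epsilon> * R" using R \<epsilon> by (auto simp: field_simps)
      have a0: "0 \<le> J R 6 ?a" and b0: "0 \<le> J R 6 ?b" by (intro J_nonneg R1 cs sum_nonneg; simp)+
      have "J R 7 ?f \<le> 14 / R * J R 6 ?a + 21 * M / R * (2 * K * J R 6 ?b + 12 * K\<^sup>2)"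
        using energy[OF R1(2)] mult_left_mono[OF square'[OF R1(1)], of "21 * M / R"] M R1 by simp
      also have "\<dots> = 14 / R * J R 6 ?a + 42 * M * K / R * J R 6 ?b + 252 * M * K\<^sup>2 / R"
        using R1 by (simp add: field_simps)
      also have "14 / R * J R 6 ?a \<le> C / R * J R 6 ?a"
        using C R1 by (intro mult_right_mono divide_right_mono a0) auto
      also have "42 * M * K / R * J R 6 ?b \<le> C / R * J R 6 ?b"
        using C R1 by (intro mult_right_mono divide_right_mono b0) auto
      also have "252 * M * K\<^sup>2 / R \<le> \<epsilon>" using R1 by (simp add: divide_simps)
      also have "\<epsilon> \<le> \<epsilon> * (J (2 * R) 7 ?f + 1)"
      proof -
        have "0 \<le> J (2 * R) 7 ?f" using R1 by (intro J_nonneg cs sum_nonneg) auto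
        then show ?thesis using \<epsilon> by simp
      qed
      also have "C / R * J R 6 ?a + C / R * J R 6 ?b = C / R * J R 6 (\<lambda>x. ?a x + ?b x)"
      proof -
        have "J R 6 (\<lambda>x. ?a x + ?b x) = J R 6 ?a + J R 6 ?b" by (intro J_add R1 cs) simp
        then show ?thesis by (simp add: distrib_left)
      qed
      finally show "J R 7 ?f \<le> C / R * J R 6 (\<lambda>x. ?a x + ?b x) + \<epsilon> * (J (2 * R) 7 ?f + 1)" by simp
    qed
  next
    show "z_periodic ?f" by (intro per_smoothD(2) per_smooth_intros(6-8) g)
    show "continuous_on UNIV ?f" "continuous_on UNIV (\<lambda>x. ?a x + ?b x)" "continuous_on UNIV (\<lambda>x. 3 * ?G x + 9)"
      by (intro cs)+
  qed (auto intro!: sum_nonneg add_nonneg_nonneg C(1))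
  have d0: "partial_deriv l (g m) x = 0" for l m x
    using f0[of x] component_le_sum_sq2[of "\<lambda>m l. partial_deriv l (g m) x" m l] by simp
  have const: "g m x = g m 0" for m x
    by (rule constant_of_partial_derivs_zero[OF per_smoothD(1)[OF g] d0])
  have "?G 0 = 0"
  proof (rule ccontr)
    assume "?G 0 \<noteq> 0"
    then have pos: "?G 0 > 0" using sum_nonneg[of UNIV "\<lambda>m. (g m 0)\<^sup>2"] by simp
    define R where "R = max 1 (64 * (12 * K\<^sup>2 + 1) / ?G 0)"
    have R: "R \<ge> 1" "R > 0" by (auto simp: R_def)
    have "?G x = ?G 0 * 1" for x unfolding const[of _ x] by simp
    then have "?G = (\<lambda>x. ?G 0 * 1)" by blast
    moreover have "J R 6 ?b = 0" by (simp add: d0)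
    ultimately have "J R 6 (\<lambda>x. ?G 0 * 1) \<le> 12 * K\<^sup>2"
      using square'[OF R(1)] by (metis add_0 mult_zero_right)
    then have "?G 0 * J R 6 (\<lambda>x. 1) \<le> 12 * K\<^sup>2" unfolding J_cmult .
    moreover have "?G 0 * ((1/2) ^ 6 * R\<^sup>2) \<le> ?G 0 * J R 6 (\<lambda>x. 1)"
      using pos R by (intro mult_left_mono J_one_lower) auto
    moreover have "12 * K\<^sup>2 + 1 \<le> ?G 0 * ((1/2) ^ 6 * R\<^sup>2)"
    proof -
      have "64 * (12 * K\<^sup>2 + 1) / ?G 0 \<le> R" by (simp add: R_def)
      then have "64 * (12 * K\<^sup>2 + 1) \<le> ?G 0 * R" using pos by (simp add: field_simps)
      also have "\<dots> \<le> ?G 0 * R\<^sup>2" using pos R by (intro mult_left_mono) (auto simp: power2_eq_square)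
      finally show ?thesis by (simp add: power_divide)
    qed
    ultimately show False by linarith
  qed
  then have "(g m 0)\<^sup>2 = 0" using component_le_sum_sq[of "\<lambda>m. g m 0" m] by simp
  then show ?thesis using const[of m x] by simp
qed

section \<open>Flows that do not depend on the height\<close>

text \<open>Here the energy inequality has the standard boundary term only.\<close>

lemma liouville_harmonic:
  assumes harm: "\<And>x. (\<Sum>l\<in>UNIV. partial_deriv l (partial_deriv l (U j)) x) = 0"
  shows "partial_deriv i (U j) x = 0"
proof -
  note cs = continuous_intros continuous_flow
  let ?f = "\<lambda>x. \<Sum>l\<in>UNIV. (partial_deriv l (U j) x)\<^sup>2"
  let ?h = "\<lambda>x. \<Sum>l\<in>UNIV. \<bar>partial_deriv l (U j) x\<bar> * \<bar>U j x\<bar>"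
  obtain C where C: "C \<ge> 0" "\<And>R. R \<ge> 1 \<Longrightarrow> J R 4 grad_sq \<le> C * R\<^sup>2" using J_grad_growth by blast
  have "?f x = 0"
  proof (rule liouville_scheme[where h = ?h and e = "\<lambda>x. 3 * M\<^sup>2" and C = 14 and A = "12 * M\<^sup>2" and A' = C])
    fix \<mu> :: real and x :: "real^3" assume \<mu>: "\<mu> > 0"
    have "?h x \<le> (\<Sum>l\<in>UNIV. \<mu> * (partial_deriv l (U j) x)\<^sup>2 + M\<^sup>2 / \<mu>)"
    proof (rule sum_mono)
      fix l
      let ?d = "\<bar>partial_deriv l (U j) x\<bar>"
      have "?d * \<bar>U j x\<bar> \<le> ?d * M" using bound by (intro mult_left_mono) auto
      also have "\<dots> \<le> \<mu> * ?d\<^sup>2 + M\<^sup>2 / (4 * \<mu>)" by (rule young_product[OF \<mu>])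
      also have "M\<^sup>2 / (4 * \<mu>) \<le> M\<^sup>2 / \<mu>" using \<mu> by (intro divide_left_mono) auto
      finally show "?d * \<bar>U j x\<bar> \<le> \<mu> * (partial_deriv l (U j) x)\<^sup>2 + M\<^sup>2 / \<mu>" by simp
    qed
    also have "\<dots> = \<mu> * ?f x + 3 * M\<^sup>2 / \<mu>" by (simp add: sum.distrib sum_distrib_left)
    finally show "?h x \<le> \<mu> * ?f x + 3 * M\<^sup>2 / \<mu>" .
  next
    fix R :: real assume R: "R \<ge> 1"
    have "J R 6 (\<lambda>x. 3 * M\<^sup>2 * 1) \<le> 3 * M\<^sup>2 * (4 * R\<^sup>2)"
      unfolding J_cmult using R by (intro mult_left_mono J_one_upper) auto
    then show "J R 6 (\<lambda>x. 3 * M\<^sup>2) \<le> 12 * M\<^sup>2 * R\<^sup>2" by simp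
    have "J R 7 ?f \<le> J R 7 grad_sq"
    proof (rule J_mono)
      fix x
      have "?f x \<le> (\<Sum>i\<in>UNIV. \<Sum>j\<in>UNIV. (partial_deriv i (U j) x)\<^sup>2)"
        by (intro sum_mono component_le_sum_sq[of "\<lambda>j. partial_deriv _ (U j) x"])
      then show "?f x \<le> grad_sq x" by (simp add: grad_sq_def)
    qed (use R in \<open>auto intro!: cs\<close>)
    also have "\<dots> \<le> J R 4 grad_sq" using R by (intro J_power_antimono continuous_flow nonneg_flow) auto
    finally show "J R 7 ?f \<le> C * R\<^sup>2" using C(2)[OF R] by linarith
  next
    fix \<epsilon> :: real assume \<epsilon>: "\<epsilon> > 0"
    show "\<exists>R0. \<forall>R\<ge>R0. J R 7 ?f \<le> 14 / R * J R 6 ?h + \<epsilon> * (J (2 * R) 7 ?f + 1)"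
    proof (intro exI[of _ 1] allI impI)
      fix R :: real assume R: "R \<ge> 1"
      have "0 \<le> J (2 * R) 7 ?f" using R by (intro J_nonneg cs sum_nonneg) auto
      then have "0 \<le> \<epsilon> * (J (2 * R) 7 ?f + 1)" using \<epsilon> by simp
      then show "J R 7 ?f \<le> 14 / R * J R 6 ?h + \<epsilon> * (J (2 * R) 7 ?f + 1)"
        using J_scalar_energy[of R "U j"] U R unfolding harm by simp
    qed
  next
    show "z_periodic ?f" by (intro per_smoothD(2) per_smooth_intros(6-8) U)
    show "continuous_on UNIV ?f" "continuous_on UNIV ?h" by (intro cs)+
  qed (auto intro!: sum_nonneg)
  then show ?thesis using component_le_sum_sq[of "\<lambda>l. partial_deriv l (U j) x" i] by simp
qed

text \<open>For a flow that does not depend on the height, the vertical vorticity is transported by the flow,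
  without stretching. It vanishes, so the horizontal velocity is harmonic and hence constant. The
  remaining vorticity components are then transported as well.\<close>

lemma liouville_planar:
  assumes planar: "\<And>j x. partial_deriv 3 (U j) x = 0"
  shows "partial_deriv i (U j) x = 0"
proof -
  note cs = continuous_intros continuous_flow
  have planar_fun: "partial_deriv 3 (U j) = (\<lambda>x. 0)" for j using planar by blast
  have planar': "partial_deriv 3 (partial_deriv i (U j)) x = 0" for i j x
    by (simp add: partial_deriv_commute[OF smooth_flow(1), of 3 i] planar_fun)
  have dvort: "partial_deriv l (vort i j) x = partial_deriv l (partial_deriv i (U j)) x - partial_deriv l (partial_deriv j (U i)) x" for i j l x
    unfolding vort_def[abs_def] by (simp add: smooth_partial_deriv smooth_flow)
  have vort3: "partial_deriv 3 (vort i j) x = 0" for i j x unfolding dvort planar' by simp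
  have div2: "partial_deriv 2 (U 2) x = - partial_deriv 1 (U 1) x" for x
    using div[of x] planar[of 3 x] by (simp add: sum_3)
  have dlamb: "partial_deriv i (lamb j) x =
      (\<Sum>l\<in>UNIV. U l x * partial_deriv i (vort l j) x + partial_deriv i (U l) x * vort l j x)" for i j x
    unfolding lamb_def[abs_def] by (simp add: smooth_flow smooth_mult)
  obtain C where C: "C \<ge> 0" "\<And>R. R \<ge> 1 \<Longrightarrow> J R 4 grad_sq \<le> C * R\<^sup>2" using J_grad_growth by blast
  have vort_growth: "J R 4 vort_sq \<le> 4 * C * R\<^sup>2" if R: "R \<ge> 1" for R
  proof -
    have "J R 4 vort_sq \<le> J R 4 (\<lambda>x. 4 * grad_sq x)"
      using R by (intro J_mono cs vort_sq_le_grad_sq) auto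
    then show ?thesis using C(2)[OF R] by (simp add: J_cmult)
  qed
  \<comment> \<open>A vorticity component times a derivative of the bounded field \<open>U\<close>, integrated by parts.\<close>
  have by_parts: "\<bar>J R 6 (\<lambda>x. vort a b x * partial_deriv i (U j) x)\<bar> \<le>
      M * J R 6 (\<lambda>x. \<bar>partial_deriv i (vort a b) x\<bar>) + 12 * M / R * J R 5 (\<lambda>x. \<bar>vort a b x\<bar>)" if R: "R \<ge> 1" for R a b i j
  proof -
    have R0: "R > 0" using R by simp
    have "\<bar>J R 6 (\<lambda>x. vort a b x * partial_deriv i (U j) x) + J R 6 (\<lambda>x. partial_deriv i (vort a b) x * U j x)\<bar>
        \<le> 12 / R * J R 5 (\<lambda>x. \<bar>vort a b x\<bar> * \<bar>U j x\<bar>)"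
      using J_parts_bound[OF R0 _ per_smooth_vort U, of 5 a b i j] by simp
    also have "\<dots> \<le> 12 / R * J R 5 (\<lambda>x. M * \<bar>vort a b x\<bar>)"
      using R0 bound by (intro mult_left_mono J_mono cs) (auto simp: mult.commute[of M] intro!: mult_left_mono)
    finally have 1: "\<bar>J R 6 (\<lambda>x. vort a b x * partial_deriv i (U j) x) + J R 6 (\<lambda>x. partial_deriv i (vort a b) x * U j x)\<bar>
        \<le> 12 * M / R * J R 5 (\<lambda>x. \<bar>vort a b x\<bar>)" by (simp add: J_cmult)
    have "\<bar>J R 6 (\<lambda>x. partial_deriv i (vort a b) x * U j x)\<bar> \<le> J R 6 (\<lambda>x. \<bar>partial_deriv i (vort a b) x * U j x\<bar>)"
      by (intro J_abs R0 cs) simp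
    also have "\<dots> \<le> J R 6 (\<lambda>x. M * \<bar>partial_deriv i (vort a b) x\<bar>)"
      using R0 bound by (intro J_mono cs) (auto simp: abs_mult mult.commute[of M] intro!: mult_left_mono)
    finally show ?thesis using 1 by (simp add: J_cmult)
  qed
  have J_le: "J R k (\<lambda>x. \<bar>F i x\<bar>) \<le> J R k (\<lambda>x. \<Sum>i\<in>UNIV. \<bar>F i x\<bar>)"
    if "R > 0" "k > 0" "\<And>i. continuous_on UNIV (F i)" for R k i and F :: "3 \<Rightarrow> real^3 \<Rightarrow> real"
    using that by (intro J_mono continuous_intros member_le_sum) auto
  \<comment> \<open>A single scalar, entered as a constant family.\<close>
  have \<omega>0: "vort 1 2 x = 0" for x
  proof (rule liouville_transported[where g = "\<lambda>_. vort 1 2" and K = "72 * M + 1" and A = "12 * C"])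
    show "per_smooth (vort 1 2)" by (rule per_smooth_vort)
    show "(\<Sum>l\<in>UNIV. partial_deriv l (partial_deriv l (vort 1 2)) x) = (\<Sum>l\<in>UNIV. U l x * partial_deriv l (vort 1 2) x)" for x
    proof -
      have c: "partial_deriv 2 (partial_deriv 1 (U 3)) x = partial_deriv 1 (partial_deriv 2 (U 3)) x"
        by (simp add: partial_deriv_commute[OF smooth_flow(1), of 2 1])
      have d2: "partial_deriv 1 (U 1) x = - partial_deriv 2 (U 2) x" using div2[of x] by simp
      show ?thesis
        unfolding vorticity_equation dlamb
        by (simp add: sum_3 dvort planar' planar_fun vort_def c d2 algebra_simps)
    qed
    fix R :: real assume R: "R \<ge> 1"
    have R0: "R > 0" using R by simp
    let ?B = "J R 6 (\<lambda>x. \<Sum>m\<in>(UNIV::3 set). \<Sum>l\<in>UNIV. \<bar>partial_deriv l (vort 1 2) x\<bar>)"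
    let ?D = "J R 5 (\<lambda>x. \<Sum>m\<in>(UNIV::3 set). \<bar>vort 1 2 x\<bar>)"
    have B: "3 * J R 6 (\<lambda>x. \<bar>partial_deriv i (vort 1 2) x\<bar>) \<le> ?B" for i
    proof -
      have "J R 6 (\<lambda>x. \<bar>partial_deriv i (vort 1 2) x\<bar>) \<le> J R 6 (\<lambda>x. \<Sum>l\<in>UNIV. \<bar>partial_deriv l (vort 1 2) x\<bar>)"
        by (rule J_le[where F = "\<lambda>l. partial_deriv l (vort 1 2)"]) (use R0 in \<open>auto intro!: cs\<close>)
      then show ?thesis by (simp add: J_cmult)
    qed
    have D: "?D = 3 * J R 5 (\<lambda>x. \<bar>vort 1 2 x\<bar>)" by (simp add: J_cmult)
    have D0: "0 \<le> J R 5 (\<lambda>x. \<bar>vort 1 2 x\<bar>)" by (intro J_nonneg R0 cs) auto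
    have "J R 6 (\<lambda>x. \<Sum>m\<in>(UNIV::3 set). (vort 1 2 x)\<^sup>2) = 3 * J R 6 (\<lambda>x. (vort 1 2 x)\<^sup>2)" by (simp add: J_cmult)
    also have "J R 6 (\<lambda>x. (vort 1 2 x)\<^sup>2) = J R 6 (\<lambda>x. vort 1 2 x * partial_deriv 1 (U 2) x - vort 1 2 x * partial_deriv 2 (U 1) x)"
      by (simp add: power2_eq_square right_diff_distrib[symmetric] vort_def)
    also have "\<dots> = J R 6 (\<lambda>x. vort 1 2 x * partial_deriv 1 (U 2) x) - J R 6 (\<lambda>x. vort 1 2 x * partial_deriv 2 (U 1) x)"
      by (intro J_diff R0 cs) simp
    finally have "J R 6 (\<lambda>x. \<Sum>m\<in>(UNIV::3 set). (vort 1 2 x)\<^sup>2) \<le>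
        M * (3 * J R 6 (\<lambda>x. \<bar>partial_deriv 1 (vort 1 2) x\<bar>)) + M * (3 * J R 6 (\<lambda>x. \<bar>partial_deriv 2 (vort 1 2) x\<bar>))
        + 72 * M / R * J R 5 (\<lambda>x. \<bar>vort 1 2 x\<bar>)"
      using by_parts[OF R, of 1 2 1 2] by_parts[OF R, of 1 2 2 1] by simp
    also have "\<dots> \<le> M * ?B + M * ?B + 72 * M / R * J R 5 (\<lambda>x. \<bar>vort 1 2 x\<bar>)"
      using M by (intro add_mono mult_left_mono B order_refl) auto
    also have "\<dots> \<le> (72 * M + 1) * ?B + (72 * M + 1) / R * ?D"
    proof -
      have "0 \<le> ?B" using B[of 1] J_nonneg[OF R0, of 6 "\<lambda>x. \<bar>partial_deriv 1 (vort 1 2) x\<bar>"] by (simp add: cs)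
      then have "(2 * M) * ?B \<le> (72 * M + 1) * ?B" using M by (intro mult_right_mono) auto
      moreover have "72 * M / R * J R 5 (\<lambda>x. \<bar>vort 1 2 x\<bar>) \<le> (72 * M + 1) / R * ?D"
        unfolding D using M R0 D0 by (intro mult_mono divide_right_mono) auto
      ultimately show ?thesis by simp
    qed
    finally show "J R 6 (\<lambda>x. \<Sum>m\<in>(UNIV::3 set). (vort 1 2 x)\<^sup>2) \<le> (72 * M + 1) * ?B + (72 * M + 1) / R * ?D" .
    have "J R 4 (\<lambda>x. \<Sum>m\<in>(UNIV::3 set). (vort 1 2 x)\<^sup>2) = 3 * J R 4 (\<lambda>x. (vort 1 2 x)\<^sup>2)" by (simp add: J_cmult)
    also have "J R 4 (\<lambda>x. (vort 1 2 x)\<^sup>2) \<le> J R 4 vort_sq" by (intro J_mono R0 cs vort_le) simp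
    finally show "J R 4 (\<lambda>x. \<Sum>m\<in>(UNIV::3 set). (vort 1 2 x)\<^sup>2) \<le> 12 * C * R\<^sup>2" using vort_growth[OF R] by simp
  qed (use M in simp)
  have const: "partial_deriv i (U j) x = 0" if "j = 1 \<or> j = 2" for i j x
  proof (rule liouville_harmonic)
    have "vort 1 2 = (\<lambda>x. 0)" "vort 2 1 = (\<lambda>x. 0)" using \<omega>0 vort_antisym[of 2 1] by auto
    moreover have "vort a a = (\<lambda>x. 0)" for a by (simp add: vort_def[abs_def])
    ultimately show "(\<Sum>l\<in>UNIV. partial_deriv l (partial_deriv l (U j)) x) = 0" for x
      unfolding laplacian_eq_vort sum_3 vort3 using that by auto
  qed
  have g: "vort m 3 = partial_deriv m (U 3)" for m
    unfolding vort_def[abs_def] planar by simp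
  have "vort m 3 x = 0" for m x
  proof (rule liouville_transported[where g = "\<lambda>m. vort m 3" and K = "12 * M + 1" and A = "4 * C"])
    show "per_smooth (vort m 3)" for m by (rule per_smooth_vort)
    show "(\<Sum>l\<in>UNIV. partial_deriv l (partial_deriv l (vort m 3)) x) = (\<Sum>l\<in>UNIV. U l x * partial_deriv l (vort m 3) x)" for m x
    proof -
      have "partial_deriv 3 (lamb m) x = 0" unfolding dlamb vort3 planar by simp
      moreover have "partial_deriv m (lamb 3) x = (\<Sum>l\<in>UNIV. U l x * partial_deriv m (vort l 3) x)"
        unfolding dlamb sum_3 using const vort_def[of 3 3 x] by simp
      moreover have "partial_deriv m (vort l 3) x = partial_deriv l (vort m 3) x" for l
        unfolding g by (simp add: partial_deriv_commute[OF smooth_flow(1), of m l])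
      ultimately show ?thesis unfolding vorticity_equation by simp
    qed
    fix R :: real assume R: "R \<ge> 1"
    have R0: "R > 0" using R by simp
    let ?B = "J R 6 (\<lambda>x. \<Sum>m\<in>UNIV. \<Sum>l\<in>UNIV. \<bar>partial_deriv l (vort m 3) x\<bar>)"
    let ?D = "J R 5 (\<lambda>x. \<Sum>m\<in>UNIV. \<bar>vort m 3 x\<bar>)"
    have "J R 6 (\<lambda>x. \<Sum>m\<in>UNIV. (vort m 3 x)\<^sup>2) = (\<Sum>m\<in>UNIV. J R 6 (\<lambda>x. vort m 3 x * partial_deriv m (U 3) x))"
      unfolding g[symmetric] by (simp add: J_sum[OF R0] cs power2_eq_square)
    also have "\<dots> \<le> (\<Sum>m\<in>UNIV. M * J R 6 (\<lambda>x. \<Sum>l\<in>UNIV. \<bar>partial_deriv l (vort m 3) x\<bar>) + 12 * M / R * J R 5 (\<lambda>x. \<bar>vort m 3 x\<bar>))"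
    proof (rule sum_mono)
      fix m
      have "J R 6 (\<lambda>x. \<bar>partial_deriv m (vort m 3) x\<bar>) \<le> J R 6 (\<lambda>x. \<Sum>l\<in>UNIV. \<bar>partial_deriv l (vort m 3) x\<bar>)"
        by (rule J_le[where F = "\<lambda>l. partial_deriv l (vort m 3)"]) (use R0 in \<open>auto intro!: cs\<close>)
      from mult_left_mono[OF this M]
      show "J R 6 (\<lambda>x. vort m 3 x * partial_deriv m (U 3) x) \<le>
          M * J R 6 (\<lambda>x. \<Sum>l\<in>UNIV. \<bar>partial_deriv l (vort m 3) x\<bar>) + 12 * M / R * J R 5 (\<lambda>x. \<bar>vort m 3 x\<bar>)"
        using by_parts[OF R, of m 3 m 3] by simp
    qed
    also have "\<dots> = M * ?B + 12 * M / R * ?D"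
      by (simp add: J_sum[OF R0] cs sum.distrib sum_distrib_left)
    also have "\<dots> \<le> (12 * M + 1) * ?B + (12 * M + 1) / R * ?D"
    proof (intro add_mono mult_right_mono divide_right_mono)
      show "0 \<le> ?B" "0 \<le> ?D" by (intro J_nonneg R0 cs sum_nonneg; simp)+
    qed (use M R0 in auto)
    finally show "J R 6 (\<lambda>x. \<Sum>m\<in>UNIV. (vort m 3 x)\<^sup>2) \<le> (12 * M + 1) * ?B + (12 * M + 1) / R * ?D" .
    have "J R 4 (\<lambda>x. \<Sum>m\<in>UNIV. (vort m 3 x)\<^sup>2) \<le> J R 4 vort_sq"
    proof (intro J_mono R0 cs)
      show "(\<Sum>m\<in>UNIV. (vort m 3 x)\<^sup>2) \<le> vort_sq x" for x
        unfolding vort_sq_def by (intro sum_mono component_le_sum_sq[of "\<lambda>j. vort _ j x"])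
    qed simp
    then show "J R 4 (\<lambda>x. \<Sum>m\<in>UNIV. (vort m 3 x)\<^sup>2) \<le> 4 * C * R\<^sup>2" using vort_growth[OF R] by linarith
  qed (use M in simp)
  then show ?thesis using const g exhaust_3[of j] by metis
qed

section \<open>Small flows\<close>

text \<open>The vertical derivative \<open>w = \<partial>\<^sub>3 U\<close> has mean zero on the fibres. The only term of its energy
  identity that is not a boundary term is \<open>\<integral> w\<^sub>l \<partial>\<^sub>l w\<^sub>j U\<^sub>j\<close>, and by the sharp Wirtinger inequality it is at
  most \<open>sup |U| / (2\<pi>)\<close> times the energy.\<close>

lemma vertical_derivative_zero:
  assumes N: "0 < N" "N < 2 * pi" and small: "\<And>x. (\<Sum>j\<in>UNIV. (U j x)\<^sup>2) \<le> N\<^sup>2"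
  shows "partial_deriv 3 (U j) x = 0"
proof -
  define w where "w j = partial_deriv 3 (U j)" for j
  define p where "p x = partial_deriv 3 Q x - (\<Sum>l\<in>UNIV. U l x * w l x)" for x
  have w: "per_smooth (w j)" for j unfolding w_def by (rule per_smooth_intros(8)[OF U])
  have p: "per_smooth p"
    unfolding p_def[abs_def] by (intro per_smooth_intros(3,4,7,8) per_smooth_Q U w)
  note sm = smooth_flow(1) per_smoothD(1)[OF w] per_smoothD(1)[OF p]
  note cs = continuous_intros continuous_flow per_smooth_continuous w p per_smooth_intros(8)
  have divw: "(\<Sum>i\<in>UNIV. partial_deriv i (w i) x) = 0" for x
    unfolding w_def by (rule partial_deriv_div)
  have mean: "fibre_mean (w j) x = 0" for j x unfolding w_def by (rule fibre_mean_partial_deriv_3[OF U])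
  define W where "W x = (\<Sum>j\<in>UNIV. (w j x)\<^sup>2)" for x
  define G where "G x = (\<Sum>j\<in>UNIV. \<Sum>l\<in>UNIV. (partial_deriv l (w j) x)\<^sup>2)" for x
  have W: "per_smooth W" unfolding W_def[abs_def] by (intro per_smooth_intros(6,7) w)
  have G: "per_smooth G" unfolding G_def[abs_def] by (intro per_smooth_intros(6-8) w)
  have W0: "0 \<le> W x" and G0: "0 \<le> G x" for x by (auto simp: W_def G_def intro!: sum_nonneg)
  have Wgrad: "W x \<le> grad_sq x" for x
    unfolding W_def w_def grad_sq_def
    by (rule member_le_sum[of 3 UNIV "\<lambda>i. \<Sum>j\<in>UNIV. (partial_deriv i (U j) x)\<^sup>2"]) (auto intro: sum_nonneg)

  \<comment> \<open>The equation for \<open>w\<close>, with the pressure \<open>p = \<partial>\<^sub>3 P\<close>.\<close>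
  have eqw: "(\<Sum>l\<in>UNIV. partial_deriv l (partial_deriv l (w j)) x) =
      (\<Sum>l\<in>UNIV. w l x * partial_deriv l (U j) x) + (\<Sum>l\<in>UNIV. U l x * partial_deriv l (w j) x) + partial_deriv j p x" for j x
  proof -
    have "(\<lambda>x. \<Sum>l\<in>UNIV. partial_deriv l (partial_deriv l (U j)) x) = (\<lambda>x. lamb j x + partial_deriv j Q x)"
      using momentum by (auto simp: lamb_def vort_def)
    then have "partial_deriv 3 (\<lambda>x. \<Sum>l\<in>UNIV. partial_deriv l (partial_deriv l (U j)) x) x =
        partial_deriv 3 (\<lambda>x. lamb j x + partial_deriv j Q x) x" by simp
    then have 1: "(\<Sum>l\<in>UNIV. partial_deriv 3 (partial_deriv l (partial_deriv l (U j))) x) =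
        partial_deriv 3 (lamb j) x + partial_deriv 3 (partial_deriv j Q) x"
      by (simp add: smooth_partial_deriv smooth_flow)
    have comm: "partial_deriv 3 (partial_deriv l (partial_deriv l (U j))) = partial_deriv l (partial_deriv l (w j))" for l
      unfolding w_def by (simp add: partial_deriv_commute[of _ 3 l] smooth_flow smooth_partial_deriv)
    have commw: "partial_deriv 3 (partial_deriv l (U j)) = partial_deriv l (w j)" for l j
      unfolding w_def by (simp add: partial_deriv_commute[of _ 3 l] smooth_flow)
    have dl: "partial_deriv 3 (lamb j) x = (\<Sum>l\<in>UNIV. U l x * (partial_deriv l (w j) x - partial_deriv j (w l) x) +
        w l x * (partial_deriv l (U j) x - partial_deriv j (U l) x))"
    proof -
      have "partial_deriv 3 (vort l j) x = partial_deriv l (w j) x - partial_deriv j (w l) x" for l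
        unfolding vort_def[abs_def] by (simp add: smooth_partial_deriv smooth_flow commw)
      moreover have "partial_deriv 3 (lamb j) x =
          (\<Sum>l\<in>UNIV. U l x * partial_deriv 3 (vort l j) x + partial_deriv 3 (U l) x * vort l j x)"
        unfolding lamb_def[abs_def] by (simp add: smooth_flow smooth_mult)
      ultimately show ?thesis unfolding vort_def[symmetric] w_def by simp
    qed
    have dp: "partial_deriv j p x = partial_deriv 3 (partial_deriv j Q) x -
        (\<Sum>l\<in>UNIV. U l x * partial_deriv j (w l) x + partial_deriv j (U l) x * w l x)"
      unfolding p_def[abs_def]
      by (simp add: sm smooth_mult smooth_sum smooth_partial_deriv Q partial_deriv_commute[OF Q, of j 3])
    show ?thesis
      using 1 unfolding comm dl dp by (simp add: sum.distrib sum_subtractf algebra_simps)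
  qed

  \<comment> \<open>\<open>S\<close> is the interior term, \<open>H\<close> collects all boundary terms: those of the Laplacian, of the two
    transport terms, and of the pressure.\<close>
  define S where "S x = (\<Sum>j\<in>UNIV. \<Sum>l\<in>UNIV. w l x * U j x * partial_deriv l (w j) x)" for x
  let ?a = "\<lambda>x. \<Sum>j\<in>UNIV. \<Sum>l\<in>UNIV. \<bar>partial_deriv l (w j) x\<bar> * \<bar>w j x\<bar>"
  let ?c = "\<lambda>x. \<Sum>j\<in>UNIV. \<bar>w j x\<bar> * \<bar>p x\<bar>"
  define H where "H x = (?a x + 5 * M * W x) + ?c x" for x
  have cS: "continuous_on UNIV S" unfolding S_def[abs_def] by (intro cs U)
  have cH: "continuous_on UNIV H" unfolding H_def[abs_def] by (intro cs W)
  have JS: "J R 7 (\<lambda>x. \<Sum>j\<in>UNIV. (\<Sum>l\<in>UNIV. w l x * partial_deriv l (U j) x) * w j x) \<ge>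
      - J R 7 S - 42 * M / R * J R 6 W" if R: "R > 0" for R
  proof -
    have each: "J R 7 (\<lambda>x. w l x * w j x * partial_deriv l (U j) x) \<ge>
        - J R 7 (\<lambda>x. partial_deriv l (\<lambda>x. w l x * w j x) x * U j x) - 14 * M / R * J R 6 (\<lambda>x. \<bar>w l x\<bar> * \<bar>w j x\<bar>)" for l j
    proof -
      have "\<bar>J R 7 (\<lambda>x. w l x * w j x * partial_deriv l (U j) x) + J R 7 (\<lambda>x. partial_deriv l (\<lambda>x. w l x * w j x) x * U j x)\<bar>
          \<le> 14 / R * J R 6 (\<lambda>x. \<bar>w l x * w j x\<bar> * \<bar>U j x\<bar>)"
        using J_parts_bound[OF R _ per_smooth_intros(3)[OF w w] U, of 6 l j l j] by simp
      also have "\<dots> \<le> 14 / R * J R 6 (\<lambda>x. M * (\<bar>w l x\<bar> * \<bar>w j x\<bar>))"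
        using R bound by (intro mult_left_mono J_mono cs per_smooth_intros(3))
          (auto simp: abs_mult mult.commute[of M] intro!: mult_left_mono)
      finally show ?thesis by (simp add: J_cmult)
    qed
    have "J R 7 (\<lambda>x. \<Sum>j\<in>UNIV. (\<Sum>l\<in>UNIV. w l x * partial_deriv l (U j) x) * w j x) =
        J R 7 (\<lambda>x. \<Sum>j\<in>UNIV. \<Sum>l\<in>UNIV. w l x * w j x * partial_deriv l (U j) x)"
      unfolding sum_distrib_right by (simp add: ac_simps)
    also have "\<dots> = (\<Sum>j\<in>UNIV. \<Sum>l\<in>UNIV. J R 7 (\<lambda>x. w l x * w j x * partial_deriv l (U j) x))"
      by (intro J_sum2 R cs) simp
    also have "\<dots> \<ge> (\<Sum>j\<in>UNIV. \<Sum>l\<in>UNIV. - J R 7 (\<lambda>x. partial_deriv l (\<lambda>x. w l x * w j x) x * U j x) - 14 * M / R * J R 6 (\<lambda>x. \<bar>w l x\<bar> * \<bar>w j x\<bar>))"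
      by (intro sum_mono each)
    also have "(\<Sum>j\<in>UNIV. \<Sum>l\<in>UNIV. - J R 7 (\<lambda>x. partial_deriv l (\<lambda>x. w l x * w j x) x * U j x) - 14 * M / R * J R 6 (\<lambda>x. \<bar>w l x\<bar> * \<bar>w j x\<bar>)) =
        - (\<Sum>j\<in>UNIV. \<Sum>l\<in>UNIV. J R 7 (\<lambda>x. partial_deriv l (\<lambda>x. w l x * w j x) x * U j x)) - 14 * M / R * (\<Sum>j\<in>UNIV. \<Sum>l\<in>UNIV. J R 6 (\<lambda>x. \<bar>w l x\<bar> * \<bar>w j x\<bar>))"
      by (simp only: sum_subtractf sum_negf sum_distrib_left)
    also have "(\<Sum>j\<in>UNIV. \<Sum>l\<in>UNIV. J R 7 (\<lambda>x. partial_deriv l (\<lambda>x. w l x * w j x) x * U j x)) = J R 7 S"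
    proof -
      have "(\<Sum>j\<in>UNIV. \<Sum>l\<in>UNIV. J R 7 (\<lambda>x. partial_deriv l (\<lambda>x. w l x * w j x) x * U j x)) =
          J R 7 (\<lambda>x. \<Sum>j\<in>UNIV. \<Sum>l\<in>UNIV. partial_deriv l (\<lambda>x. w l x * w j x) x * U j x)"
        by (intro J_sum2[symmetric] R cs per_smooth_intros(3)) simp
      also have "(\<lambda>x. \<Sum>j\<in>UNIV. \<Sum>l\<in>UNIV. partial_deriv l (\<lambda>x. w l x * w j x) x * U j x) = S"
      proof
        fix x
        have "(\<Sum>l\<in>UNIV. partial_deriv l (\<lambda>x. w l x * w j x) x * U j x) =
            (\<Sum>l\<in>UNIV. w l x * U j x * partial_deriv l (w j) x) + (\<Sum>l\<in>UNIV. partial_deriv l (w l) x) * w j x * U j x" for j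
        proof -
          have "partial_deriv l (\<lambda>x. w l x * w j x) x = w l x * partial_deriv l (w j) x + partial_deriv l (w l) x * w j x" for l
            by (simp add: sm)
          then show ?thesis
            unfolding sum_distrib_right sum.distrib[symmetric] by (intro sum.cong refl) (simp add: algebra_simps)
        qed
        then show "(\<Sum>j\<in>UNIV. \<Sum>l\<in>UNIV. partial_deriv l (\<lambda>x. w l x * w j x) x * U j x) = S x"
          by (simp add: divw S_def)
      qed
      finally show ?thesis .
    qed
    finally have 1: "- J R 7 S - 14 * M / R * (\<Sum>j\<in>UNIV. \<Sum>l\<in>UNIV. J R 6 (\<lambda>x. \<bar>w l x\<bar> * \<bar>w j x\<bar>)) \<le>
        J R 7 (\<lambda>x. \<Sum>j\<in>UNIV. (\<Sum>l\<in>UNIV. w l x * partial_deriv l (U j) x) * w j x)" .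
    have "(\<Sum>j\<in>UNIV. \<Sum>l\<in>UNIV. J R 6 (\<lambda>x. \<bar>w l x\<bar> * \<bar>w j x\<bar>)) = J R 6 (\<lambda>x. \<Sum>j\<in>UNIV. \<Sum>l\<in>UNIV. \<bar>w l x\<bar> * \<bar>w j x\<bar>)"
      by (intro J_sum2[symmetric] R cs) simp
    also have "\<dots> \<le> J R 6 (\<lambda>x. 3 * W x)"
    proof (intro J_mono R cs W)
      fix x
      have "(\<Sum>j\<in>UNIV. \<Sum>l\<in>UNIV. \<bar>w l x\<bar> * \<bar>w j x\<bar>) = (\<Sum>l\<in>UNIV. \<bar>w l x\<bar>)\<^sup>2"
        by (simp add: power2_eq_square sum_distrib_left sum_distrib_right)
      also have "\<dots> \<le> 3 * (\<Sum>l\<in>UNIV. \<bar>w l x\<bar>\<^sup>2)" by (rule sum_sq_3)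
      finally show "(\<Sum>j\<in>UNIV. \<Sum>l\<in>UNIV. \<bar>w l x\<bar> * \<bar>w j x\<bar>) \<le> 3 * W x" by (simp add: W_def)
    qed simp
    finally have "14 * M / R * (\<Sum>j\<in>UNIV. \<Sum>l\<in>UNIV. J R 6 (\<lambda>x. \<bar>w l x\<bar> * \<bar>w j x\<bar>)) \<le> 14 * M / R * (3 * J R 6 W)"
      unfolding J_cmult using R M by (intro mult_left_mono) auto
    with 1 show ?thesis by simp
  qed
  have Jp: "\<bar>J R 7 (\<lambda>x. \<Sum>j\<in>UNIV. partial_deriv j p x * w j x)\<bar> \<le> 14 / R * J R 6 ?c" if R: "R > 0" for R
  proof -
    have "J R 7 (\<lambda>x. \<Sum>j\<in>UNIV. partial_deriv j p x * w j x) = (\<Sum>j\<in>UNIV. J R 7 (\<lambda>x. w j x * partial_deriv j p x))"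
      by (simp add: J_sum[OF R] cs mult.commute)
    moreover have "(\<Sum>j\<in>UNIV. J R 7 (\<lambda>x. partial_deriv j (w j) x * p x)) = 0"
    proof -
      have "(\<Sum>j\<in>UNIV. J R 7 (\<lambda>x. partial_deriv j (w j) x * p x)) = J R 7 (\<lambda>x. \<Sum>j\<in>UNIV. partial_deriv j (w j) x * p x)"
        by (intro J_sum[symmetric] R cs) simp
      then show ?thesis by (simp add: sum_distrib_right[symmetric] divw)
    qed
    ultimately have "\<bar>J R 7 (\<lambda>x. \<Sum>j\<in>UNIV. partial_deriv j p x * w j x)\<bar> =
        \<bar>\<Sum>j\<in>UNIV. J R 7 (\<lambda>x. w j x * partial_deriv j p x) + J R 7 (\<lambda>x. partial_deriv j (w j) x * p x)\<bar>"
      by (simp add: sum.distrib)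
    also have "\<dots> \<le> (\<Sum>j\<in>UNIV. 14 / R * J R 6 (\<lambda>x. \<bar>w j x\<bar> * \<bar>p x\<bar>))"
      using J_parts_bound[OF R _ w p, of 6] by (intro order_trans[OF sum_abs sum_mono]) simp
    also have "\<dots> = 14 / R * J R 6 ?c" by (simp add: J_sum[OF R] cs sum_distrib_left)
    finally show ?thesis .
  qed
  have energy: "J R 7 G \<le> 14 / R * J R 6 H + J R 7 S" if R: "R > 0" for R
  proof -
    have "J R 7 G = (\<Sum>j\<in>UNIV. J R 7 (\<lambda>x. \<Sum>l\<in>UNIV. (partial_deriv l (w j) x)\<^sup>2))"
      unfolding G_def by (intro J_sum R cs) simp
    also have "\<dots> \<le> (\<Sum>j\<in>UNIV. 14 / R * J R 6 (\<lambda>x. \<Sum>l\<in>UNIV. \<bar>partial_deriv l (w j) x\<bar> * \<bar>w j x\<bar>)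
        - J R 7 (\<lambda>x. (\<Sum>l\<in>UNIV. partial_deriv l (partial_deriv l (w j)) x) * w j x))"
      by (intro sum_mono J_scalar_energy R w)
    also have "\<dots> = 14 / R * (\<Sum>j\<in>UNIV. J R 6 (\<lambda>x. \<Sum>l\<in>UNIV. \<bar>partial_deriv l (w j) x\<bar> * \<bar>w j x\<bar>))
        - (\<Sum>j\<in>UNIV. J R 7 (\<lambda>x. (\<Sum>l\<in>UNIV. partial_deriv l (partial_deriv l (w j)) x) * w j x))"
      by (simp only: sum_subtractf sum_distrib_left)
    also have "(\<Sum>j\<in>UNIV. J R 6 (\<lambda>x. \<Sum>l\<in>UNIV. \<bar>partial_deriv l (w j) x\<bar> * \<bar>w j x\<bar>)) = J R 6 ?a"
      by (intro J_sum[symmetric] R cs) simp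
    also have "(\<Sum>j\<in>UNIV. J R 7 (\<lambda>x. (\<Sum>l\<in>UNIV. partial_deriv l (partial_deriv l (w j)) x) * w j x)) =
        J R 7 (\<lambda>x. \<Sum>j\<in>UNIV. (\<Sum>l\<in>UNIV. w l x * partial_deriv l (U j) x) * w j x)
        + (\<Sum>j\<in>UNIV. J R 7 (\<lambda>x. (\<Sum>l\<in>UNIV. U l x * partial_deriv l (w j) x) * w j x))
        + J R 7 (\<lambda>x. \<Sum>j\<in>UNIV. partial_deriv j p x * w j x)"
    proof -
      have "J R 7 (\<lambda>x. (\<Sum>l\<in>UNIV. partial_deriv l (partial_deriv l (w j)) x) * w j x) =
          J R 7 (\<lambda>x. (\<Sum>l\<in>UNIV. w l x * partial_deriv l (U j) x) * w j x)
          + J R 7 (\<lambda>x. (\<Sum>l\<in>UNIV. U l x * partial_deriv l (w j) x) * w j x)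
          + J R 7 (\<lambda>x. partial_deriv j p x * w j x)" for j
        unfolding eqw distrib_right by (simp add: J_add[OF R] cs U)
      moreover have "(\<Sum>j\<in>UNIV. J R 7 (\<lambda>x. (\<Sum>l\<in>UNIV. w l x * partial_deriv l (U j) x) * w j x)) =
          J R 7 (\<lambda>x. \<Sum>j\<in>UNIV. (\<Sum>l\<in>UNIV. w l x * partial_deriv l (U j) x) * w j x)"
        by (intro J_sum[symmetric] R cs) simp
      moreover have "(\<Sum>j\<in>UNIV. J R 7 (\<lambda>x. partial_deriv j p x * w j x)) = J R 7 (\<lambda>x. \<Sum>j\<in>UNIV. partial_deriv j p x * w j x)"
        by (intro J_sum[symmetric] R cs) simp
      ultimately show ?thesis by (simp add: sum.distrib)
    qed
    finally have 1: "J R 7 G \<le> 14 / R * J R 6 ?a + J R 7 S + 42 * M / R * J R 6 W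
        - (\<Sum>j\<in>UNIV. J R 7 (\<lambda>x. (\<Sum>l\<in>UNIV. U l x * partial_deriv l (w j) x) * w j x)) + 14 / R * J R 6 ?c"
      using JS[OF R] Jp[OF R] by linarith
    have "- (\<Sum>j\<in>UNIV. J R 7 (\<lambda>x. (\<Sum>l\<in>UNIV. U l x * partial_deriv l (w j) x) * w j x)) \<le> (\<Sum>j\<in>UNIV. 21 * M / R * J R 6 (\<lambda>x. (w j x)\<^sup>2))"
      unfolding sum_negf[symmetric] using J_drift_bound[OF R w] by (intro sum_mono) (simp add: abs_le_iff)
    also have "\<dots> = 21 * M / R * J R 6 W" unfolding W_def by (simp add: J_sum[OF R] cs sum_distrib_left)
    moreover have "63 * M / R * J R 6 W = 42 * M / R * J R 6 W + 21 * M / R * J R 6 W" by simp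
    ultimately have 2: "J R 7 G \<le> 14 / R * J R 6 ?a + 63 * M / R * J R 6 W + 14 / R * J R 6 ?c + J R 7 S"
      using 1 by linarith
    have "J R 6 (\<lambda>x. (?a x + 5 * M * W x) + ?c x) = J R 6 (\<lambda>x. ?a x + 5 * M * W x) + J R 6 ?c"
      by (intro J_add R cs W) simp
    also have "J R 6 (\<lambda>x. ?a x + 5 * M * W x) = J R 6 ?a + J R 6 (\<lambda>x. 5 * M * W x)"
      by (intro J_add R cs W) simp
    finally have "J R 6 H = J R 6 ?a + 5 * M * J R 6 W + J R 6 ?c"
      unfolding H_def by (simp add: J_cmult)
    then have "14 / R * J R 6 H = 14 / R * J R 6 ?a + 70 * M / R * J R 6 W + 14 / R * J R 6 ?c"
      by (simp add: distrib_left)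
    moreover have "63 * M / R * J R 6 W \<le> 70 * M / R * J R 6 W"
      using M R W0 by (intro mult_right_mono divide_right_mono J_nonneg cs W) auto
    ultimately show ?thesis using 2 by linarith
  qed
  have JW: "J R k W \<le> 1 / (4 * pi\<^sup>2) * J R k G" if R: "R > 0" "k > 0" for R k
  proof -
    have "4 * pi\<^sup>2 * J R k W = (\<Sum>j\<in>UNIV. 4 * pi\<^sup>2 * J R k (\<lambda>x. (w j x)\<^sup>2))"
      unfolding W_def by (simp add: J_sum[OF R] cs sum_distrib_left)
    also have "\<dots> \<le> (\<Sum>j\<in>UNIV. J R k (\<lambda>x. (partial_deriv 3 (w j) x)\<^sup>2))"
      by (intro sum_mono J_wirtinger R w mean)
    also have "\<dots> = J R k (\<lambda>x. \<Sum>j\<in>UNIV. (partial_deriv 3 (w j) x)\<^sup>2)"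
      by (intro J_sum[symmetric] R cs)
    also have "\<dots> \<le> J R k G"
    proof (intro J_mono R cs G)
      show "(\<Sum>j\<in>UNIV. (partial_deriv 3 (w j) x)\<^sup>2) \<le> G x" for x
        unfolding G_def by (intro sum_mono component_le_sum_sq[of "\<lambda>l. partial_deriv l (w _) x"])
    qed
    finally show ?thesis by (simp add: field_simps)
  qed
  \<comment> \<open>The weights are such that both terms contribute \<open>N / (4\<pi>)\<close> times the integral of \<open>G\<close>, the first one by
    Wirtinger's inequality.\<close>
  have S_le: "S x \<le> pi * N * W x + N / (4 * pi) * G x" for x
  proof -
    have "S x \<le> (\<Sum>j\<in>UNIV. \<Sum>l\<in>UNIV. pi / N * (w l x * U j x)\<^sup>2 + N / (4 * pi) * (partial_deriv l (w j) x)\<^sup>2)"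
      unfolding S_def
    proof (intro sum_mono)
      fix j l
      show "w l x * U j x * partial_deriv l (w j) x \<le> pi / N * (w l x * U j x)\<^sup>2 + N / (4 * pi) * (partial_deriv l (w j) x)\<^sup>2"
        using young_product[of "pi / N" "w l x * U j x" "partial_deriv l (w j) x"] N by (simp add: mult.commute[of N])
    qed
    also have "\<dots> = pi / N * (W x * (\<Sum>j\<in>UNIV. (U j x)\<^sup>2)) + N / (4 * pi) * G x"
    proof -
      have "(\<Sum>j\<in>UNIV. \<Sum>l\<in>UNIV. (w l x * U j x)\<^sup>2) = W x * (\<Sum>j\<in>UNIV. (U j x)\<^sup>2)"
        unfolding W_def power_mult_distrib sum_product by (rule sum.swap)
      then show ?thesis unfolding G_def sum.distrib sum_distrib_left[symmetric] by simp
    qed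
    also have "pi / N * (W x * (\<Sum>j\<in>UNIV. (U j x)\<^sup>2)) \<le> pi / N * (W x * N\<^sup>2)"
      using N W0 small by (intro mult_left_mono) auto
    also have "\<dots> = pi * N * W x" using N by (simp add: power2_eq_square)
    finally show ?thesis by simp
  qed
  define \<theta> where "\<theta> = 1 - N / (2 * pi)"
  have \<theta>: "\<theta> > 0" using N by (simp add: \<theta>_def divide_simps)
  have energy': "J R 7 G \<le> 14 / \<theta> / R * J R 6 H" if R: "R > 0" for R
  proof -
    have "J R 7 S \<le> J R 7 (\<lambda>x. pi * N * W x + N / (4 * pi) * G x)"
      using S_le by (intro J_mono R cS cs W G) auto
    also have "\<dots> = pi * N * J R 7 W + N / (4 * pi) * J R 7 G" by (intro J_lincomb R cs W G) simp
    also have "pi * N * J R 7 W \<le> pi * N * (1 / (4 * pi\<^sup>2) * J R 7 G)"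
      using N by (intro mult_left_mono JW R) auto
    also have "pi * N * (1 / (4 * pi\<^sup>2) * J R 7 G) + N / (4 * pi) * J R 7 G = N / (2 * pi) * J R 7 G"
      by (simp add: power2_eq_square field_simps)
    finally have "\<theta> * J R 7 G \<le> 14 / R * J R 6 H"
      using energy[OF R] by (simp add: \<theta>_def left_diff_distrib)
    then have "J R 7 G \<le> 14 / R * J R 6 H / \<theta>" by (simp only: pos_le_divide_eq[OF \<theta>] mult.commute)
    then show ?thesis by (simp add: mult.commute)
  qed
  obtain C where C: "C \<ge> 0" "\<And>R. R \<ge> 1 \<Longrightarrow> J R 4 grad_sq \<le> C * R\<^sup>2" using J_grad_growth by blast
  obtain CQ where CQ: "CQ \<ge> 0"
    "\<And>R. R \<ge> 1 \<Longrightarrow> J R 6 (\<lambda>x. \<Sum>j\<in>UNIV. (partial_deriv j Q x)\<^sup>2) \<le> CQ * J R 4 grad_sq"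
    using J_grad_Q_growth by blast
  obtain CV where CV: "CV \<ge> 0" "\<And>R. R \<ge> 1 \<Longrightarrow> J R 6 grad_vort_sq \<le> CV * J R 4 grad_sq"
    using J_grad_vort_growth by blast
  have W_growth: "J R k W \<le> C * R\<^sup>2" if "R \<ge> 1" "k \<ge> 4" for R k
  proof -
    have "J R k W \<le> J R k grad_sq" using that Wgrad by (intro J_mono cs W) auto
    also have "\<dots> \<le> J R 4 grad_sq" using that by (intro J_power_antimono cs nonneg_flow) auto
    finally show ?thesis using C(2)[OF that(1)] by linarith
  qed
  have G_growth: "J R 7 G \<le> (CV * C + 588 * C) * R\<^sup>2" if R: "R \<ge> 1" for R
  proof -
    have R0: "R > 0" using R by simp
    have "J R 7 (\<lambda>x. \<Sum>i\<in>UNIV. \<Sum>j\<in>UNIV. (partial_deriv i (w j) x)\<^sup>2) \<le>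
        J R 7 (\<lambda>x. \<Sum>i\<in>UNIV. \<Sum>j\<in>UNIV. (partial_deriv i (w j) x - partial_deriv j (w i) x)\<^sup>2) +
        588 / R\<^sup>2 * J R 5 W"
      using J_div_curl[OF R0, of 5 w] w divw by (simp add: W_def[abs_def])
    also have "(\<lambda>x. \<Sum>i\<in>UNIV. \<Sum>j\<in>UNIV. (partial_deriv i (w j) x)\<^sup>2) = G"
      unfolding G_def[abs_def] by (rule ext) (rule sum.swap)
    also have "J R 7 (\<lambda>x. \<Sum>i\<in>UNIV. \<Sum>j\<in>UNIV. (partial_deriv i (w j) x - partial_deriv j (w i) x)\<^sup>2) \<le> CV * (C * R\<^sup>2)"
    proof -
      have "J R 7 (\<lambda>x. \<Sum>i\<in>UNIV. \<Sum>j\<in>UNIV. (partial_deriv i (w j) x - partial_deriv j (w i) x)\<^sup>2) \<le> J R 7 grad_vort_sq"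
      proof (intro J_mono R0 cs)
        fix x
        have "partial_deriv i (w j) x - partial_deriv j (w i) x = partial_deriv 3 (vort i j) x" for i j
          unfolding vort_def[abs_def] w_def
          by (simp add: smooth_partial_deriv smooth_flow partial_deriv_commute[OF smooth_flow(1), of 3])
        then show "(\<Sum>i\<in>UNIV. \<Sum>j\<in>UNIV. (partial_deriv i (w j) x - partial_deriv j (w i) x)\<^sup>2) \<le> grad_vort_sq x"
          unfolding grad_vort_sq_def
          by (simp only:) (intro sum_mono component_le_sum_sq[of "\<lambda>l. partial_deriv l (vort _ _) x"])
      qed simp
      also have "\<dots> \<le> J R 6 grad_vort_sq" by (intro J_power_antimono R0 cs nonneg_flow) auto
      also have "\<dots> \<le> CV * J R 4 grad_sq" by (rule CV(2)[OF R])
      also have "\<dots> \<le> CV * (C * R\<^sup>2)" by (intro mult_left_mono CV(1) C(2)[OF R])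
      finally show ?thesis .
    qed
    also have "588 / R\<^sup>2 * J R 5 W \<le> 588 * (C * R\<^sup>2)"
    proof (rule mult_mono)
      have "1 \<le> R\<^sup>2" using R by (simp add: one_le_power)
      then show "588 / R\<^sup>2 \<le> 588" by (simp add: divide_simps)
      show "J R 5 W \<le> C * R\<^sup>2" by (rule W_growth[OF R]) simp
      show "0 \<le> J R 5 W" by (intro J_nonneg R0 cs W W0) simp
    qed simp
    finally show ?thesis by (simp add: algebra_simps)
  qed
  have WG: "J R 7 (\<lambda>x. W x + G x) \<le> 2 * J R 7 G" if "R > 0" for R
  proof -
    have "1 / (4 * pi\<^sup>2) \<le> 1"
    proof -
      have "1 \<le> pi * pi" using pi_ge_two mult_mono[of 1 pi 1 pi] by simp
      then show ?thesis by (simp add: divide_simps power2_eq_square)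
    qed
    then have "1 / (4 * pi\<^sup>2) * J R 7 G \<le> 1 * J R 7 G"
      using that by (intro mult_right_mono J_nonneg cs G G0) auto
    then have "J R 7 W \<le> J R 7 G" using JW[OF that, of 7] by simp
    moreover have "J R 7 (\<lambda>x. W x + G x) = J R 7 W + J R 7 G" using that by (intro J_add cs W G) auto
    ultimately show ?thesis by linarith
  qed
  let ?e = "\<lambda>x. 2 * ((1 + 7 * M\<^sup>2) * W x + (p x)\<^sup>2)"
  \<comment> \<open>The scheme is applied to \<open>W + G\<close> since \<open>H\<close> contains \<open>W\<close> itself.\<close>
  have "W x + G x = 0" for x
  proof (rule liouville_scheme[where h = H and e = ?e and C = "28 / \<theta>"
        and A = "2 * ((1 + 7 * M\<^sup>2) * C + (2 * (CQ * C) + 6 * M\<^sup>2 * C))" and A' = "2 * (CV * C + 588 * C)"])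
    fix \<mu> :: real and x :: "real^3" assume \<mu>: "\<mu> > 0"
    define \<nu> where "\<nu> = \<mu> / 2"
    have \<nu>: "\<nu> > 0" using \<mu> by (simp add: \<nu>_def)
    have "?a x \<le> (\<Sum>j\<in>UNIV. \<Sum>l\<in>UNIV. \<nu> * \<bar>partial_deriv l (w j) x\<bar>\<^sup>2 + \<bar>w j x\<bar>\<^sup>2 / (4 * \<nu>))"
      by (intro sum_mono young_product \<nu>)
    also have "\<dots> = \<nu> * G x + 3 * W x / (4 * \<nu>)"
      by (simp add: G_def W_def sum.distrib sum_distrib_left sum_divide_distrib)
    also have "3 * W x / (4 * \<nu>) \<le> W x / \<nu>" using \<nu> W0[of x] by (simp add: divide_simps)
    finally have 1: "?a x \<le> \<nu> * G x + W x / \<nu>" by simp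
    have "?c x \<le> (\<Sum>j\<in>UNIV. \<nu> * \<bar>w j x\<bar>\<^sup>2 + \<bar>p x\<bar>\<^sup>2 / (4 * \<nu>))"
      by (intro sum_mono young_product \<nu>)
    also have "\<dots> = \<nu> * W x + 3 * (p x)\<^sup>2 / (4 * \<nu>)" by (simp add: W_def sum.distrib sum_distrib_left)
    also have "3 * (p x)\<^sup>2 / (4 * \<nu>) \<le> (p x)\<^sup>2 / \<nu>" using \<nu> by (simp add: divide_simps)
    finally have 2: "?c x \<le> \<nu> * W x + (p x)\<^sup>2 / \<nu>" by simp
    have "5 * M \<le> \<nu> + 7 * M\<^sup>2 / \<nu>"
    proof -
      have "1 * (5 * M) \<le> \<nu> * 1\<^sup>2 + (5 * M)\<^sup>2 / (4 * \<nu>)" by (rule young_product[OF \<nu>])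
      also have "(5 * M)\<^sup>2 / (4 * \<nu>) \<le> 7 * M\<^sup>2 / \<nu>" using \<nu> by (simp add: divide_simps power_mult_distrib)
      finally show ?thesis by simp
    qed
    then have "5 * M * W x \<le> (\<nu> + 7 * M\<^sup>2 / \<nu>) * W x" by (rule mult_right_mono[OF _ W0])
    also have "\<dots> = \<nu> * W x + 7 * M\<^sup>2 * W x / \<nu>" by (simp add: distrib_right)
    finally have "H x \<le> \<nu> * (2 * W x + G x) + ((1 + 7 * M\<^sup>2) * W x + (p x)\<^sup>2) / \<nu>"
      using 1 2 unfolding H_def by (simp add: add_divide_distrib algebra_simps)
    also have "\<nu> * (2 * W x + G x) \<le> \<mu> * (W x + G x)"
      using \<mu> G0[of x] by (simp add: \<nu>_def algebra_simps)
    also have "((1 + 7 * M\<^sup>2) * W x + (p x)\<^sup>2) / \<nu> = ?e x / \<mu>" by (simp add: \<nu>_def)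
    finally show "H x \<le> \<mu> * (W x + G x) + ?e x / \<mu>" by simp
  next
    fix R :: real assume R: "R \<ge> 1"
    have R0: "R > 0" using R by simp
    have "J R 6 (\<lambda>x. (p x)\<^sup>2) \<le> J R 6 (\<lambda>x. 2 * (\<Sum>j\<in>UNIV. (partial_deriv j Q x)\<^sup>2) + 6 * M\<^sup>2 * W x)"
    proof (intro J_mono R0 cs W)
      fix x
      have "(p x)\<^sup>2 \<le> 2 * (partial_deriv 3 Q x)\<^sup>2 + 2 * (\<Sum>l\<in>UNIV. U l x * w l x)\<^sup>2"
        using zero_le_power2[of "partial_deriv 3 Q x + (\<Sum>l\<in>UNIV. U l x * w l x)"]
        unfolding p_def power2_sum power2_diff by linarith
      moreover have "(\<Sum>l\<in>UNIV. U l x * w l x)\<^sup>2 \<le> 3 * (\<Sum>l\<in>UNIV. (U l x * w l x)\<^sup>2)" by (rule sum_sq_3)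
      moreover have "(\<Sum>l\<in>UNIV. (U l x * w l x)\<^sup>2) \<le> (\<Sum>l\<in>UNIV. M\<^sup>2 * (w l x)\<^sup>2)"
      proof (rule sum_mono)
        fix l
        have "(U l x)\<^sup>2 \<le> M\<^sup>2" using bound[of l x] M by (simp add: abs_le_square_iff[symmetric])
        then show "(U l x * w l x)\<^sup>2 \<le> M\<^sup>2 * (w l x)\<^sup>2" unfolding power_mult_distrib by (rule mult_right_mono) simp
      qed
      moreover have "(\<Sum>l\<in>UNIV. M\<^sup>2 * (w l x)\<^sup>2) = M\<^sup>2 * W x" by (simp add: W_def sum_distrib_left)
      moreover have "(partial_deriv 3 Q x)\<^sup>2 \<le> (\<Sum>j\<in>UNIV. (partial_deriv j Q x)\<^sup>2)"
        by (rule component_le_sum_sq)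
      ultimately show "(p x)\<^sup>2 \<le> 2 * (\<Sum>j\<in>UNIV. (partial_deriv j Q x)\<^sup>2) + 6 * M\<^sup>2 * W x" by linarith
    qed simp
    also have "\<dots> = 2 * J R 6 (\<lambda>x. \<Sum>j\<in>UNIV. (partial_deriv j Q x)\<^sup>2) + 6 * M\<^sup>2 * J R 6 W"
      by (intro J_lincomb R0 cs W) simp
    also have "\<dots> \<le> 2 * (CQ * (C * R\<^sup>2)) + 6 * M\<^sup>2 * (C * R\<^sup>2)"
    proof (intro add_mono mult_left_mono W_growth R)
      show "J R 6 (\<lambda>x. \<Sum>j\<in>UNIV. (partial_deriv j Q x)\<^sup>2) \<le> CQ * (C * R\<^sup>2)"
        using CQ(2)[OF R] mult_left_mono[OF C(2)[OF R] CQ(1)] by linarith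
    qed auto
    finally have p2: "J R 6 (\<lambda>x. (p x)\<^sup>2) \<le> (2 * (CQ * C) + 6 * M\<^sup>2 * C) * R\<^sup>2" by (simp add: algebra_simps)
    have "J R 6 ?e = 2 * J R 6 (\<lambda>x. (1 + 7 * M\<^sup>2) * W x + 1 * (p x)\<^sup>2)" unfolding mult_1 by (rule J_cmult)
    also have "J R 6 (\<lambda>x. (1 + 7 * M\<^sup>2) * W x + 1 * (p x)\<^sup>2) = (1 + 7 * M\<^sup>2) * J R 6 W + 1 * J R 6 (\<lambda>x. (p x)\<^sup>2)"
      by (intro J_lincomb R0 cs W) simp
    also have "2 * \<dots> \<le> 2 * ((1 + 7 * M\<^sup>2) * (C * R\<^sup>2) + 1 * ((2 * (CQ * C) + 6 * M\<^sup>2 * C) * R\<^sup>2))"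
      by (intro mult_left_mono add_mono W_growth R p2) auto
    finally show "J R 6 ?e \<le> 2 * ((1 + 7 * M\<^sup>2) * C + (2 * (CQ * C) + 6 * M\<^sup>2 * C)) * R\<^sup>2"
      by (simp add: algebra_simps)
    show "J R 7 (\<lambda>x. W x + G x) \<le> 2 * (CV * C + 588 * C) * R\<^sup>2"
      using WG[OF R0] G_growth[OF R] by linarith
  next
    fix \<epsilon> :: real assume \<epsilon>: "\<epsilon> > 0"
    show "\<exists>R0. \<forall>R\<ge>R0. J R 7 (\<lambda>x. W x + G x) \<le> 28 / \<theta> / R * J R 6 H + \<epsilon> * (J (2 * R) 7 (\<lambda>x. W x + G x) + 1)"
    proof (intro exI[of _ 1] allI impI)
      fix R :: real assume R: "R \<ge> 1"
      have "0 \<le> J (2 * R) 7 (\<lambda>x. W x + G x)" using R W0 G0 by (intro J_nonneg cs W G add_nonneg_nonneg) auto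
      then have "0 \<le> \<epsilon> * (J (2 * R) 7 (\<lambda>x. W x + G x) + 1)" using \<epsilon> by simp
      then show "J R 7 (\<lambda>x. W x + G x) \<le> 28 / \<theta> / R * J R 6 H + \<epsilon> * (J (2 * R) 7 (\<lambda>x. W x + G x) + 1)"
        using WG[of R] energy'[of R] R by simp
    qed
  next
    show "z_periodic (\<lambda>x. W x + G x)" by (intro per_smoothD(2) per_smooth_intros(2) W G)
    show "continuous_on UNIV (\<lambda>x. W x + G x)" "continuous_on UNIV H" "continuous_on UNIV ?e"
      by (intro cs cH W G)+
    show "0 \<le> H x" for x using W0[of x] M by (auto simp: H_def intro!: add_nonneg_nonneg sum_nonneg)
    show "0 \<le> ?e x" for x using W0[of x] by simp
    show "0 \<le> 28 / \<theta>" using \<theta> by simp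
  qed (use W0 G0 in simp)
  then have "W x = 0" using W0[of x] G0[of x] by (smt (verit))
  then show ?thesis using component_le_sum_sq[of "\<lambda>j. w j x" j] by (simp add: W_def w_def)
qed

end

section \<open>The theorem\<close>

lemma smooth_steady_NS_solution_components:
  fixes u :: "real^3 \<Rightarrow> real^3"
  assumes sol: "smooth_steady_NS_solution u" and B: "\<And>x. norm (u x) \<le> B"
  shows "\<exists>Q. steady_flow (\<lambda>i x. u x $ i) Q B"
proof -
  obtain P :: "real^3 \<Rightarrow> real" where u: "smooth u" "\<And>x. u (x + axis 3 1) = u x" and P: "smooth P"
    and NS: "\<And>x. - laplacian u x + advection u u x + gradient P x = 0" and div: "\<And>x. divergence u x = 0"
    using sol unfolding smooth_steady_NS_solution_def by blast
  define U where "U i x = u x $ i" for i x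
  have sU: "smooth (U i)" for i unfolding U_def[abs_def] by (rule smooth_component[OF u(1)])
  define e where "e l x = 1/2 * (U l x * U l x)" for l x
  have se: "smooth (e l)" for l unfolding e_def[abs_def] by (intro smooth_mult smooth_const sU)
  have de: "partial_deriv j (e l) x = U l x * partial_deriv j (U l) x" for j l x
    unfolding e_def[abs_def] partial_deriv_mult[OF smooth_const smooth_mult[OF sU sU]]
      partial_deriv_mult[OF sU sU] partial_deriv_const by simp
  define Q where "Q x = P x + (\<Sum>l\<in>UNIV. e l x)" for x
  have sQ: "smooth Q" unfolding Q_def[abs_def] by (intro smooth_add smooth_sum P se)
  have dQ: "partial_deriv j Q x = partial_deriv j P x + (\<Sum>l\<in>UNIV. U l x * partial_deriv j (U l) x)" for j x
    unfolding Q_def[abs_def] by (simp add: P se smooth_sum de)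
  have dU: "partial_deriv i (U j) = (\<lambda>x. partial_deriv i u x $ j)" for i j
    unfolding U_def[abs_def] by (rule partial_deriv_component[OF u(1)])
  have ddU: "partial_deriv i (partial_deriv i (U j)) x = partial_deriv i (partial_deriv i u) x $ j" for i j x
    unfolding dU by (simp add: partial_deriv_component smooth_partial_deriv u(1))
  have "steady_flow U Q B"
  proof
    show "per_smooth (U i)" for i using sU u(2) by (simp add: per_smooth_def z_periodic_def U_def)
    show "\<bar>U i x\<bar> \<le> B" for i x
      using component_le_norm_cart[of "u x" i] B[of x] by (simp add: U_def)
    show "(\<Sum>i\<in>UNIV. partial_deriv i (U i) x) = 0" for x
      using div[of x] by (simp add: divergence_def U_def[abs_def])
    show "smooth Q" by (rule sQ)
    show "(\<Sum>l\<in>UNIV. partial_deriv l (partial_deriv l (U j)) x) =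
        (\<Sum>l\<in>UNIV. U l x * (partial_deriv l (U j) x - partial_deriv j (U l) x)) + partial_deriv j Q x" for j x
    proof -
      have "(- laplacian u x + advection u u x + gradient P x) $ j = 0" by (simp only: NS zero_index)
      then have "(\<Sum>l\<in>UNIV. partial_deriv l (partial_deriv l (U j)) x) =
          (\<Sum>l\<in>UNIV. U l x * partial_deriv l (U j) x) + partial_deriv j P x"
        unfolding ddU unfolding dU U_def by (simp add: laplacian_def advection_def gradient_def)
      then show ?thesis unfolding dQ by (simp add: right_diff_distrib sum_subtractf)
    qed
  qed
  then show ?thesis unfolding U_def[abs_def] by blast
qed

lemma swirl_comp_eq: "swirl_comp u r \<theta> z = cos \<theta> * u (cyl_point r \<theta> z) $ 2 - sin \<theta> * u (cyl_point r \<theta> z) $ 1"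
  by (simp add: swirl_comp_def e_theta_def inner_vec_def sum_3)

lemma radial_comp_eq: "radial_comp u r \<theta> z = cos \<theta> * u (cyl_point r \<theta> z) $ 1 + sin \<theta> * u (cyl_point r \<theta> z) $ 2"
  by (simp add: radial_comp_def e_r_def inner_vec_def sum_3)

lemma norm_e_r: "norm (e_r \<theta>) = 1"
  by (simp add: e_r_def norm_eq_1 inner_vec_def sum_3 power2_eq_square[symmetric])

lemma radial_comp_decay:
  fixes u :: "real^3 \<Rightarrow> real^3"
  assumes B: "\<And>x. norm (u x) \<le> B"
    and lim: "((\<lambda>r. SUP (\<theta>, z)\<in>UNIV. \<bar>r * radial_comp u r \<theta> z\<bar>) \<longlongrightarrow> 0) at_top"
    and \<epsilon>: "\<epsilon> > 0"
  shows "\<exists>L. \<forall>x. horizontal_sq x \<ge> L\<^sup>2 \<longrightarrow> \<bar>radial_flux (\<lambda>i x. u x $ i) x\<bar> \<le> \<epsilon>"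
proof -
  have "\<forall>\<^sub>F r in at_top. (SUP (\<theta>, z)\<in>UNIV. \<bar>r * radial_comp u r \<theta> z\<bar>) < \<epsilon>"
    using order_tendstoD(2)[OF lim \<epsilon>] .
  then obtain r0 where r0: "\<And>r. r \<ge> r0 \<Longrightarrow> (SUP (\<theta>, z)\<in>UNIV. \<bar>r * radial_comp u r \<theta> z\<bar>) < \<epsilon>"
    by (auto simp: eventually_at_top_linorder)
  show ?thesis
  proof (intro exI[of _ "\<bar>r0\<bar>"] allI impI)
    fix x assume x: "horizontal_sq x \<ge> \<bar>r0\<bar>\<^sup>2"
    let ?r = "sqrt (horizontal_sq x)"
    have "?r \<ge> sqrt (\<bar>r0\<bar>\<^sup>2)" using x by (rule real_sqrt_le_mono)
    then have r: "?r \<ge> r0" by simp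
    obtain \<theta> where \<theta>: "x = cyl_point ?r \<theta> (x $ 3)" by (rule cylindrical_coordinates)
    have x12: "x $ 1 = ?r * cos \<theta>" "x $ 2 = ?r * sin \<theta>"
      using arg_cong[OF \<theta>, of "\<lambda>y. y $ 1"] arg_cong[OF \<theta>, of "\<lambda>y. y $ 2"] by (simp_all add: cyl_point_def)
    have "radial_flux (\<lambda>i x. u x $ i) x = ?r * radial_comp u ?r \<theta> (x $ 3)"
      unfolding radial_comp_eq \<theta>[symmetric] radial_flux_def x12 by (simp add: distrib_left mult.assoc)
    moreover have "\<bar>?r * radial_comp u ?r \<theta> (x $ 3)\<bar> \<le> (SUP (\<theta>, z)\<in>UNIV. \<bar>?r * radial_comp u ?r \<theta> z\<bar>)"
    proof -
      have "bdd_above ((\<lambda>(\<theta>, z). \<bar>?r * radial_comp u ?r \<theta> z\<bar>) ` UNIV)"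
      proof (rule bdd_aboveI2)
        fix y :: "real \<times> real"
        have "\<bar>radial_comp u ?r (fst y) (snd y)\<bar> \<le> norm (u (cyl_point ?r (fst y) (snd y))) * norm (e_r (fst y))"
          unfolding radial_comp_def by (rule Cauchy_Schwarz_ineq2)
        also have "\<dots> \<le> B" using B by (simp add: norm_e_r)
        finally show "(case y of (\<theta>, z) \<Rightarrow> \<bar>?r * radial_comp u ?r \<theta> z\<bar>) \<le> \<bar>?r\<bar> * B"
          by (auto simp: split_beta abs_mult intro!: mult_left_mono)
      qed
      from cSUP_upper[OF UNIV_I this, of "(\<theta>, x $ 3)"] show ?thesis by simp
    qed
    ultimately show "\<bar>radial_flux (\<lambda>i x. u x $ i) x\<bar> \<le> \<epsilon>" using r0[OF r] by simp
  qed
qed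

theorem theorem1p4:
  fixes u :: "real^3 \<Rightarrow> real^3"
  assumes "smooth_steady_NS_solution u"
    and "bounded (range u)"
  shows "(axisymmetric (swirl_comp u) \<or>
          axisymmetric (radial_comp u) \<or>
          ((\<lambda>r. SUP (\<theta>, z)\<in>UNIV. \<bar>r * radial_comp u r \<theta> z\<bar>) \<longlongrightarrow> 0) at_top \<or>
          (SUP x. norm (u x)) < 2 * pi
            \<longrightarrow> u constant_on UNIV) \<and>
         (axisymmetric (swirl_comp u) \<or>
          axisymmetric (radial_comp u) \<or>
          ((\<lambda>r. SUP (\<theta>, z)\<in>UNIV. \<bar>r * radial_comp u r \<theta> z\<bar>) \<longlongrightarrow> 0) at_top
            \<longrightarrow> (\<exists>c::real. \<forall>x. u x = vector [0, 0, c]))"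
proof -
  let ?decay = "((\<lambda>r. SUP (\<theta>, z)\<in>UNIV. \<bar>r * radial_comp u r \<theta> z\<bar>) \<longlongrightarrow> 0) at_top"
  let ?U = "\<lambda>i x. u x $ i"
  obtain B where B: "\<And>x. norm (u x) \<le> B" using assms(2) by (auto simp: bounded_iff)
  obtain Q where "steady_flow ?U Q B" using smooth_steady_NS_solution_components[OF assms(1) B] by blast
  then interpret steady_flow ?U Q B .
  have const: "u x = u y" if "\<And>i j x. partial_deriv i (?U j) x = 0" for x y
  proof -
    have "?U j x = ?U j y" for j by (rule constant_of_partial_derivs_zero[OF smooth_flow(1) that])
    then show ?thesis by (simp add: vec_eq_iff)
  qed
  have swirl: "u x = u y" if sym: "axisymmetric (swirl_comp u)" for x y
  proof (rule const, rule liouville_fibre_flux, rule fibre_mean_radial_flux_zero_of_swirl)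
    fix r \<theta> \<theta>' z :: real assume "r > 0"
    then show "cos \<theta> * u (cyl_point r \<theta> z) $ 2 - sin \<theta> * u (cyl_point r \<theta> z) $ 1 =
        cos \<theta>' * u (cyl_point r \<theta>' z) $ 2 - sin \<theta>' * u (cyl_point r \<theta>' z) $ 1"
      using sym unfolding axisymmetric_def swirl_comp_eq by blast
  qed
  have radial: "u x = u y" if sym: "axisymmetric (radial_comp u)" for x y
  proof (rule const, rule liouville_fibre_flux, rule fibre_mean_radial_flux_zero_of_radial)
    fix r \<theta> \<theta>' z :: real assume "r > 0"
    then show "cos \<theta> * u (cyl_point r \<theta> z) $ 1 + sin \<theta> * u (cyl_point r \<theta> z) $ 2 =
        cos \<theta>' * u (cyl_point r \<theta>' z) $ 1 + sin \<theta>' * u (cyl_point r \<theta>' z) $ 2"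
      using sym unfolding axisymmetric_def radial_comp_eq by blast
  qed
  have decay: "u x = u y" if ?decay for x y
    by (rule const, rule liouville_decay, rule radial_comp_decay[OF B that])
  have small: "u x = u y" if "(SUP x. norm (u x)) < 2 * pi" for x y
  proof (rule const, rule liouville_planar)
    define s where "s = (SUP x. norm (u x))"
    have le: "norm (u x) \<le> s" for x
      unfolding s_def using B by (intro cSUP_upper bdd_aboveI2[of _ _ B]) auto
    have s0: "s \<ge> 0" using le[of 0] norm_ge_zero[of "u 0"] by linarith
    \<comment> \<open>Between the supremum and \<open>2\<pi>\<close>, and positive even if \<open>u = 0\<close>.\<close>
    define N where "N = (s + 2 * pi) / 2"
    have N: "0 < N" "N < 2 * pi" "s \<le> N" using s0 that pi_gt_zero by (auto simp: N_def s_def)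
    have "(\<Sum>j\<in>UNIV. (u x $ j)\<^sup>2) \<le> N\<^sup>2" for x
    proof -
      have "(\<Sum>j\<in>UNIV. (u x $ j)\<^sup>2) = (norm (u x))\<^sup>2"
        by (simp add: norm_vec_def L2_set_def sum_nonneg)
      also have "\<dots> \<le> N\<^sup>2" using le[of x] N by (intro power_mono) auto
      finally show ?thesis .
    qed
    then show "partial_deriv 3 (?U j) x = 0" for j x by (rule vertical_derivative_zero[OF N(1,2)])
  qed
  have vertical: "\<exists>c. \<forall>x. u x = vector [0, 0, c]" if "\<And>x y. u x = u y" "u 0 $ 1 = 0" "u 0 $ 2 = 0"
  proof (intro exI allI)
    fix x
    show "u x = vector [0, 0, u 0 $ 3]" using that(1)[of x 0] that(2,3) by (simp add: vec_eq_iff forall_3)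
  qed
  have "u constant_on UNIV"
    if "axisymmetric (swirl_comp u) \<or> axisymmetric (radial_comp u) \<or> ?decay \<or> (SUP x. norm (u x)) < 2 * pi"
  proof -
    have "\<forall>x. u x = u 0"
      using that
    proof (elim disjE)
      assume "axisymmetric (swirl_comp u)" then show ?thesis by (intro allI swirl)
    next
      assume "axisymmetric (radial_comp u)" then show ?thesis by (intro allI radial)
    next
      assume ?decay then show ?thesis by (intro allI decay)
    next
      assume "(SUP x. norm (u x)) < 2 * pi" then show ?thesis by (intro allI small)
    qed
    then show ?thesis by (auto simp: constant_on_def)
  qed
  moreover have "\<exists>c::real. \<forall>x. u x = vector [0, 0, c]"
    if "axisymmetric (swirl_comp u) \<or> axisymmetric (radial_comp u) \<or> ?decay"
    using that
  proof (elim disjE)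
    assume sym: "axisymmetric (swirl_comp u)"
    have u0: "u x = u 0" for x by (rule swirl[OF sym])
    have eq: "cos \<theta> * u 0 $ 2 - sin \<theta> * u 0 $ 1 = cos \<theta>' * u 0 $ 2 - sin \<theta>' * u 0 $ 1" for \<theta> \<theta>'
    proof -
      have "swirl_comp u 1 \<theta> 0 = swirl_comp u 1 \<theta>' 0" using sym by (simp add: axisymmetric_def)
      then show ?thesis
        unfolding swirl_comp_eq u0[of "cyl_point 1 \<theta> 0"] u0[of "cyl_point 1 \<theta>' 0"] .
    qed
    show ?thesis
      using eq[of 0 pi] eq[of "pi/2" "- (pi/2)"] by (intro vertical swirl[OF sym]) auto
  next
    assume sym: "axisymmetric (radial_comp u)"
    have u0: "u x = u 0" for x by (rule radial[OF sym])
    have eq: "cos \<theta> * u 0 $ 1 + sin \<theta> * u 0 $ 2 = cos \<theta>' * u 0 $ 1 + sin \<theta>' * u 0 $ 2" for \<theta> \<theta>'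
    proof -
      have "radial_comp u 1 \<theta> 0 = radial_comp u 1 \<theta>' 0" using sym by (simp add: axisymmetric_def)
      then show ?thesis
        unfolding radial_comp_eq u0[of "cyl_point 1 \<theta> 0"] u0[of "cyl_point 1 \<theta>' 0"] .
    qed
    show ?thesis
      using eq[of 0 pi] eq[of "pi/2" "- (pi/2)"] by (intro vertical radial[OF sym]) auto
  next
    assume lim: ?decay
    have u0: "u x = u 0" for x by (rule decay[OF lim])
    let ?S = "(u 0 $ 1)\<^sup>2 + (u 0 $ 2)\<^sup>2"
    have "?S = 0"
    proof (rule ccontr)
      assume "?S \<noteq> 0"
      then have S: "?S > 0" by (metis sum_power2_ge_zero order_le_imp_less_or_eq)
      obtain L where L: "\<And>x. horizontal_sq x \<ge> L\<^sup>2 \<Longrightarrow> \<bar>radial_flux ?U x\<bar> \<le> 1"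
        using radial_comp_decay[OF B lim, of 1] by auto
      define t where "t = max (\<bar>L\<bar> / sqrt ?S) (2 / ?S)"
      \<comment> \<open>Far out in the direction of the constant velocity the flux density \<open>t |u\<^sub>h|\<^sup>2\<close> exceeds \<open>1\<close>.\<close>
      let ?x = "vector [t * u 0 $ 1, t * u 0 $ 2, 0] :: real^3"
      have t: "t \<ge> \<bar>L\<bar> / sqrt ?S" "t \<ge> 2 / ?S" by (auto simp: t_def)
      have "\<bar>L\<bar> \<le> t * sqrt ?S" using t(1) S by (simp add: pos_divide_le_eq)
      then have "L\<^sup>2 \<le> (t * sqrt ?S)\<^sup>2" by (metis abs_ge_zero power2_abs power_mono)
      also have "\<dots> = horizontal_sq ?x"
        using S by (simp add: horizontal_sq_def power_mult_distrib distrib_left)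
      finally have "\<bar>radial_flux ?U ?x\<bar> \<le> 1" by (rule L)
      moreover have "radial_flux ?U ?x = t * ?S"
        unfolding radial_flux_def u0[of ?x] by (simp add: power2_eq_square algebra_simps)
      moreover have "2 \<le> t * ?S" using t(2) S by (simp add: pos_divide_le_eq)
      ultimately show False by linarith
    qed
    then show ?thesis by (intro vertical decay[OF lim]) (auto simp: sum_power2_eq_zero_iff)
  qed
  ultimately show ?thesis by blast
qed

end
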